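(* Let $\Bbbk$ be a commutative $\mathbb{Z}[\delta]$-algebra, $S$ a finite set, and $\underline x$ a $1$-morphism of the $S$-colored Temperley–Lieb 2-category $\mathcal{STL}$ over $\Bbbk$. Suppose that the quantum binomial coefficient ${k \brack m}$ is invertible in $\Bbbk$ whenever $0\le m\le k$ and $k+1$ is the length of a maximal alternating subsequence of $\underline x$. Then the top idempotent $JW(\underline x)$ exists and equals the horizontal concatenation (composition of $2$-morphisms along the shared colors), from left to right, of the top idempotents $JW(\underline y)$ of the maximal alternating subsequences $\underline y$ of $\underline x$. On the other hand, if some such ${k\brack m}$ is not invertible in $\Bbbk$, then $JW(\underline x)$ does not exist.
   Context: **The 2-category $\mathcal{STL}$ over $\Bbbk$.** Objects: elements of $S$ ("colors"). $1$-morphisms: nonempty sequences $\underline x=s_1\cdots s_m$ with $s_i\in S$, $s_i\neq s_{i+1}$, with source $s_m$, target $s_1$, length $\ell(\underline x)=m$, drawn as $m-1$ points on a line separating regions colored $s_1,\dots,s_m$; composition is gluing along the shared color, $(s_1\cdots s_m)(t_1\cdots t_k)=s_1\cdots s_mt_2\cdots t_k$ if $s_m=t_1$. $2$-morphisms are generated over $\Bbbk$ by colored caps $brb\to b$ and cups $b\to brb$ ($b\ne r\in S$), modulo isotopy and the relation that any closed circle (for any coloring of inside and outside by distinct colors) equals $-\delta$. $\mathrm{Hom}(\underline x,\underline y)$ has as $\Bbbk$-basis the $S$-colored crossingless matchings in the strip (adjacent regions of different colors) with bottom boundary $\underline x$ and top boundary $\underline y$; "coefficient of the identity" in $\mathrm{End}(\underline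 x)$ refers to this basis. **Top idempotent.** $B(\underline x)\subset\mathrm{End}(\underline x)$ is the set of $f$ with $fc=0$ for every cup $c$ (diagram with target $\underline x$ consisting of a single cup and vertical strands). $JW(\underline x)$ *exists* if $B(\underline x)$ contains an element whose coefficient of the identity is invertible; then $JW(\underline x)$ is the unique element of $B(\underline x)$ whose coefficient of the identity is $1$ (it is idempotent and also killed by all caps on top). **Alternating subsequences.** A subsequence of $\underline x$ means a consecutive subsequence; it is alternating if it alternates between two colors, and maximal alternating if it cannot be extended to a longer alternating subsequence of $\underline x$. Consecutive maximal alternating subsequences share exactly one color. **Quantum numbers.** $[0]=0$, $[1]=1$, $[2]=\delta$, $[2][m]=[m+1]+[m-1]$; ${k\brack m}=\frac{[1][2]\cdots[k]}{[1]\cdots[m]\,[1]\cdots[k-m]}$, which is a polynomial in $\delta$ with integer coefficients, regarded as an element of $\Bbbk$. *)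

theory Defs
  imports "HOL-Library.Poly_Mapping" "HOL-Computational_Algebra.Polynomial"
begin

text \<open>
  The ground ring is a commutative ring \<open>'k\<close> with a chosen element \<open>\<delta>\<close>, that is, a commutative
  \<open>\<int>[\<delta>]\<close>-algebra.
\<close>

section \<open>One-morphisms\<close>

text \<open>The source of \<open>s\<^sub>1 \<dots> s\<^sub>m\<close> is its last colour, the target its first colour.\<close>

definition one_morphism :: "'c set \<Rightarrow> 'c list \<Rightarrow> bool" where
  "one_morphism S x \<longleftrightarrow> x \<noteq> [] \<and> distinct_adj x \<and> set x \<subseteq> S"

text \<open>Meaningful only if \<open>last x = hd y\<close>.\<close>

definition comp1 :: "'c list \<Rightarrow> 'c list \<Rightarrow> 'c list" where
  "comp1 x y = x @ tl y"


section \<open>Coloured crossingless matchings\<close>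

text \<open>
  The \<open>length x - 1\<close> points on the bottom line and the \<open>length y - 1\<close> points on the top line of
  the strip are numbered from left to right, starting with 0. A strand is the two-element set of
  its end points. Since diagrams are taken up to isotopy and contain no closed circles, the pairing
  of the points determines the matching; since every region meets the boundary of the strip,
  the two boundary words determine the colours of all regions.
\<close>

datatype point = Bot nat | Top nat

datatype 'c diagram = Diagram (lower: "'c list") (upper: "'c list") (strands: "point set set")

definition points :: "'c diagram \<Rightarrow> point set" where
  "points D = Bot ` {..<length (lower D) - 1} \<union> Top ` {..<length (upper D) - 1}"

definition matching :: "'c diagram \<Rightarrow> bool" where
  "matching D \<longleftrightarrow> (\<forall>e\<in>strands D. e \<subseteq> points D \<and> card e = 2) \<and>
     (\<forall>p\<in>points D. \<exists>!e. e \<in> strands D \<and> p \<in> e)"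

text \<open>
  Walk around the boundary of the strip: the bottom line from left to right, then the top line from
  right to left. Points are numbered in the order in which they are met. The \<open>p\<close>-th
  boundary interval lies just before the \<open>p\<close>-th point, and its colour is the \<open>p\<close>-th entry of
  \<open>boundary_colors\<close>; the first and last intervals are both part of the leftmost region.
\<close>

fun position :: "'c diagram \<Rightarrow> point \<Rightarrow> nat" where
  "position D (Bot i) = i"
| "position D (Top j) = (length (lower D) - 1) + (length (upper D) - 1) - 1 - j"

definition boundary_colors :: "'c diagram \<Rightarrow> 'c list" where
  "boundary_colors D = lower D @ tl (rev (upper D))"

definition crossingless :: "'c diagram \<Rightarrow> bool" where
  "crossingless D \<longleftrightarrow> \<not> (\<exists>a b c d. {a, b} \<in> strands D \<and> {c, d} \<in> strands D \<and>
     position D a < position D c \<and> position D c < position D b \<and> position D b < position D d)"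

text \<open>A strand from the \<open>i\<close>-th to the \<open>j\<close>-th point, \<open>i < j\<close>, cuts off the boundary intervals
  \<open>i + 1, \<dots>, j\<close>. Two intervals lie on the same region iff no strand separates them.\<close>

definition same_region :: "'c diagram \<Rightarrow> nat \<Rightarrow> nat \<Rightarrow> bool" where
  "same_region D p q \<longleftrightarrow>
     (\<forall>a b. {a, b} \<in> strands D \<and> position D a < position D b \<longrightarrow>
        (p \<in> {position D a <.. position D b} \<longleftrightarrow> q \<in> {position D a <.. position D b}))"

text \<open>
  The last condition says that the boundary colours extend to a colouring of the regions.
  Adjacent regions have different colours because the regions on the two sides of a strand contain
  the two boundary intervals next to an end point of the strand, and the boundary words are
  one-morphisms.
\<close>

definition colored_matching :: "'c set \<Rightarrow> 'c diagram \<Rightarrow> bool" where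
  "colored_matching S D \<longleftrightarrow>
     one_morphism S (lower D) \<and> one_morphism S (upper D) \<and>
     hd (lower D) = hd (upper D) \<and> last (lower D) = last (upper D) \<and>
     matching D \<and> crossingless D \<and>
     (\<forall>p < length (boundary_colors D). \<forall>q < length (boundary_colors D).
        same_region D p q \<longrightarrow> boundary_colors D ! p = boundary_colors D ! q)"

definition id_diagram :: "'c list \<Rightarrow> 'c diagram" where
  "id_diagram x = Diagram x x {{Bot i, Top i} |i. i < length x - 1}"

definition cup :: "'c \<Rightarrow> 'c \<Rightarrow> 'c diagram" where
  "cup b r = Diagram [b] [b, r, b] {{Top 0, Top 1}}"

fun shift :: "'c diagram \<Rightarrow> point \<Rightarrow> point" where
  "shift D (Bot i) = Bot (length (lower D) - 1 + i)"
| "shift D (Top j) = Top (length (upper D) - 1 + j)"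

text \<open>Horizontal composition: \<open>E\<close> is placed to the right of \<open>D\<close>.\<close>

definition hcomp_diagram :: "'c diagram \<Rightarrow> 'c diagram \<Rightarrow> 'c diagram" where
  "hcomp_diagram D E = Diagram (comp1 (lower D) (lower E)) (comp1 (upper D) (upper E))
     (strands D \<union> (\<lambda>e. shift D ` e) ` strands E)"

text \<open>
  Vertical composition \<open>E \<circ> D\<close>: stack \<open>E\<close> on top of \<open>D\<close>, so that the top points of \<open>D\<close> and the bottom
  points of \<open>E\<close> become the points \<open>Mid i\<close>. The strands of the stacked picture form a graph on
  the points of three lines. Its components that contain points of the outer lines are the
  strands of the composite, and its components inside the middle line are the closed circles.
\<close>

datatype vertex = Low nat | Mid nat | High nat

fun lower_half :: "point \<Rightarrow> vertex" where
  "lower_half (Bot i) = Low i"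
| "lower_half (Top i) = Mid i"

fun upper_half :: "point \<Rightarrow> vertex" where
  "upper_half (Bot i) = Mid i"
| "upper_half (Top i) = High i"

fun outer :: "point \<Rightarrow> vertex" where
  "outer (Bot i) = Low i"
| "outer (Top i) = High i"

definition stacked :: "'c diagram \<Rightarrow> 'c diagram \<Rightarrow> vertex set set" where
  "stacked E D = (\<lambda>e. lower_half ` e) ` strands D \<union> (\<lambda>e. upper_half ` e) ` strands E"

definition connected_in :: "vertex set set \<Rightarrow> vertex \<Rightarrow> vertex \<Rightarrow> bool" where
  "connected_in G = (\<lambda>v w. {v, w} \<in> G)\<^sup>*\<^sup>*"

definition vcomp_diagram :: "'c diagram \<Rightarrow> 'c diagram \<Rightarrow> 'c diagram" where
  "vcomp_diagram E D = Diagram (lower D) (upper E)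
     {{p, q} |p q. p \<noteq> q \<and> connected_in (stacked E D) (outer p) (outer q)}"

definition circles :: "'c diagram \<Rightarrow> 'c diagram \<Rightarrow> vertex set set" where
  "circles E D = {C. (\<exists>i < length (upper D) - 1. C = {v. connected_in (stacked E D) (Mid i) v}) \<and>
     C \<subseteq> range Mid}"


section \<open>Two-morphisms\<close>

type_synonym ('c, 'k) two_morphism = "'c diagram \<Rightarrow>\<^sub>0 'k"

definition Hom :: "'c set \<Rightarrow> 'c list \<Rightarrow> 'c list \<Rightarrow> ('c, 'k::comm_ring_1) two_morphism set" where
  "Hom S x y = {f. \<forall>D \<in> Poly_Mapping.keys f. colored_matching S D \<and> lower D = x \<and> upper D = y}"

definition basis :: "'c diagram \<Rightarrow> ('c, 'k::comm_ring_1) two_morphism" where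
  "basis D = Poly_Mapping.single D 1"

text \<open>\<open>vcomp \<delta> g f\<close> is \<open>g \<circ> f\<close>: each closed circle is replaced by \<open>- \<delta>\<close>.\<close>

definition vcomp :: "'k::comm_ring_1 \<Rightarrow> ('c, 'k) two_morphism \<Rightarrow> ('c, 'k) two_morphism \<Rightarrow>
    ('c, 'k) two_morphism" where
  "vcomp \<delta> g f = (\<Sum>E \<in> Poly_Mapping.keys g. \<Sum>D \<in> Poly_Mapping.keys f.
     Poly_Mapping.single (vcomp_diagram E D)
       (Poly_Mapping.lookup g E * Poly_Mapping.lookup f D * (- \<delta>) ^ card (circles E D)))"

definition hcomp :: "('c, 'k::comm_ring_1) two_morphism \<Rightarrow> ('c, 'k) two_morphism \<Rightarrow>
    ('c, 'k) two_morphism" where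
  "hcomp f g = (\<Sum>D \<in> Poly_Mapping.keys f. \<Sum>E \<in> Poly_Mapping.keys g.
     Poly_Mapping.single (hcomp_diagram D E) (Poly_Mapping.lookup f D * Poly_Mapping.lookup g E))"

text \<open>Used for nonempty lists only.\<close>

fun hconcat :: "('c, 'k::comm_ring_1) two_morphism list \<Rightarrow> ('c, 'k) two_morphism" where
  "hconcat [f] = f"
| "hconcat (f # g # fs) = hcomp f (hconcat (g # fs))"


section \<open>Top idempotents\<close>

text \<open>A single cup with vertical strands on both sides; the source of the diagram is \<open>u @ [b] @ v\<close>.\<close>

definition cups_into :: "'c list \<Rightarrow> 'c diagram set" where
  "cups_into x = {hcomp_diagram (id_diagram (u @ [b])) (hcomp_diagram (cup b r) (id_diagram (b # v)))
     |u b r v. x = u @ [b, r, b] @ v}"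

definition cup_killed :: "'c set \<Rightarrow> 'k::comm_ring_1 \<Rightarrow> 'c list \<Rightarrow> ('c, 'k) two_morphism set" where
  "cup_killed S \<delta> x = {f \<in> Hom S x x. \<forall>c \<in> cups_into x. vcomp \<delta> f (basis c) = 0}"

definition id_coeff :: "'c list \<Rightarrow> ('c, 'k::comm_ring_1) two_morphism \<Rightarrow> 'k" where
  "id_coeff x f = Poly_Mapping.lookup f (id_diagram x)"

definition JW_exists :: "'c set \<Rightarrow> 'k::comm_ring_1 \<Rightarrow> 'c list \<Rightarrow> bool" where
  "JW_exists S \<delta> x \<longleftrightarrow> (\<exists>f \<in> cup_killed S \<delta> x. id_coeff x f dvd 1)"

definition JW :: "'c set \<Rightarrow> 'k::comm_ring_1 \<Rightarrow> 'c list \<Rightarrow> ('c, 'k) two_morphism" where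
  "JW S \<delta> x = (THE f. f \<in> cup_killed S \<delta> x \<and> id_coeff x f = 1)"


section \<open>Maximal alternating subsequences\<close>

text \<open>A one-morphism of length 1 counts as alternating.\<close>

definition alternating :: "'c list \<Rightarrow> bool" where
  "alternating y \<longleftrightarrow> y \<noteq> [] \<and> distinct_adj y \<and> card (set y) \<le> 2"

definition slice :: "'c list \<Rightarrow> nat \<Rightarrow> nat \<Rightarrow> 'c list" where
  "slice x i j = take (j - i) (drop i x)"

definition alternating_at :: "'c list \<Rightarrow> nat \<Rightarrow> nat \<Rightarrow> bool" where
  "alternating_at x i j \<longleftrightarrow> i < j \<and> j \<le> length x \<and> alternating (slice x i j)"

definition max_alternating_at :: "'c list \<Rightarrow> nat \<Rightarrow> nat \<Rightarrow> bool" where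
  "max_alternating_at x i j \<longleftrightarrow> alternating_at x i j \<and>
     (\<forall>i' j'. alternating_at x i' j' \<and> i' \<le> i \<and> j \<le> j' \<longrightarrow> i' = i \<and> j' = j)"

text \<open>The maximal alternating subsequences in the order of their occurrence, from left to right;
  the same word may occur more than once.\<close>

definition max_alternating :: "'c list \<Rightarrow> 'c list list" where
  "max_alternating x =
     [slice x i j. i \<leftarrow> [0..<length x], j \<leftarrow> [0..<Suc (length x)], max_alternating_at x i j]"


section \<open>Quantum numbers\<close>

text \<open>Quantum numbers are elements of \<open>\<int>[\<delta>]\<close>, with \<open>\<delta>\<close> the polynomial variable.\<close>

fun qnum :: "nat \<Rightarrow> int poly" where
  "qnum 0 = 0"
| "qnum (Suc 0) = 1"
| "qnum (Suc (Suc m)) = [:0, 1:] * qnum (Suc m) - qnum m"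

definition qfact :: "nat \<Rightarrow> int poly" where
  "qfact k = (\<Prod>i=1..k. qnum i)"

text \<open>The division is exact, see \<open>qbinom_mult\<close> below.\<close>

definition qbinom :: "nat \<Rightarrow> nat \<Rightarrow> int poly" where
  "qbinom k m = qfact k div (qfact m * qfact (k - m))"

definition qbinom_in :: "'k::comm_ring_1 \<Rightarrow> nat \<Rightarrow> nat \<Rightarrow> 'k" where
  "qbinom_in \<delta> k m = poly (map_poly of_int (qbinom k m)) \<delta>"

lemma qfact_Suc: "qfact (Suc k) = qnum (Suc k) * qfact k"
  by (simp add: qfact_def prod.nat_ivl_Suc' mult.commute)

lemma qnum_add: "qnum (m + Suc l) = qnum (Suc m) * qnum (Suc l) - qnum m * qnum l"
proof -
  define X :: "int poly" where "X = [:0, 1:]"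
  have rec: "qnum (Suc (Suc j)) = X * qnum (Suc j) - qnum j" for j
    by (simp only: qnum.simps X_def)
  have "qnum (m + Suc l) = qnum (Suc m) * qnum (Suc l) - qnum m * qnum l \<and>
        qnum (Suc m + Suc l) = qnum (Suc (Suc m)) * qnum (Suc l) - qnum (Suc m) * qnum l"
  proof (induction m)
    case 0
    show ?case by (simp add: rec del: qnum.simps(3))
  next
    case (Suc m)
    have "qnum (Suc (Suc m) + Suc l) = X * qnum (Suc m + Suc l) - qnum (m + Suc l)"
      using rec[of "m + Suc l"] by simp
    also have "\<dots> = X * (qnum (Suc (Suc m)) * qnum (Suc l) - qnum (Suc m) * qnum l)
        - (qnum (Suc m) * qnum (Suc l) - qnum m * qnum l)"
      by (simp only: conjunct1[OF Suc.IH] conjunct2[OF Suc.IH])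
    also have "\<dots> = qnum (Suc (Suc (Suc m))) * qnum (Suc l) - qnum (Suc (Suc m)) * qnum l"
      by (simp add: rec algebra_simps del: qnum.simps(3))
    finally show ?case using Suc.IH by blast
  qed
  then show ?thesis by blast
qed

lemma qfact_dvd: "qfact m * qfact l dvd qfact (m + l)"
proof (induction "m + l" arbitrary: m l)
  case 0
  then show ?case by (simp add: qfact_def)
next
  case (Suc n)
  show ?case
  proof (cases "m = 0 \<or> l = 0")
    case True
    then show ?thesis by (auto simp: qfact_def)
  next
    case False
    then obtain a b where ab: "m = Suc a" "l = Suc b"
      by (meson nat.exhaust)
    have n: "n = Suc a + b" "n = a + Suc b" using Suc.hyps(2) ab by auto
    have 1: "qfact (Suc a) * qfact b dvd qfact n" using Suc.hyps(1)[OF n(1)] n(1) by simp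
    have 2: "qfact a * qfact (Suc b) dvd qfact n" using Suc.hyps(1)[OF n(2)] n(2) by simp
    have eq: "qfact (m + l) = qnum (Suc m) * (qnum (Suc b) * qfact n) - qnum b * (qnum (Suc a) * qfact n)"
    proof -
      have "m + l = Suc n" "m + Suc b = Suc n" using ab n by auto
      then have "qnum (Suc n) = qnum (Suc m) * qnum (Suc b) - qnum m * qnum b"
        and "qfact (m + l) = qnum (Suc n) * qfact n"
        using qnum_add[of m b] by (simp_all only: qfact_Suc)
      then show ?thesis by (simp only: ab(1) left_diff_distrib right_diff_distrib mult_ac)
    qed
    have "qfact m * qfact l dvd qnum (Suc b) * qfact n"
      using mult_dvd_mono[OF dvd_refl 1, of "qnum (Suc b)"] ab
      by (simp add: qfact_Suc mult_ac)
    moreover have "qfact m * qfact l dvd qnum (Suc a) * qfact n"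
      using mult_dvd_mono[OF dvd_refl 2, of "qnum (Suc a)"] ab
      by (simp add: qfact_Suc mult_ac)
    ultimately show ?thesis unfolding eq by (rule dvd_diff[OF dvd_mult dvd_mult])
  qed
qed

lemma qbinom_mult: "m \<le> k \<Longrightarrow> qbinom k m * (qfact m * qfact (k - m)) = qfact k"
  using qfact_dvd[of m "k - m"] by (simp add: qbinom_def)

end

theory Submission
  imports Defs
begin

text \<open>
  Diagrams act faithfully on sign sequences \<open>V\<^sup>\<otimes>\<^sup>n\<close> after adjoining \<open>q\<close> with \<open>\<delta> = q + q\<inverse>\<close>, and this
  representation is unitriangular with coefficients in \<open>\<int>[q, q\<inverse>]\<close>. Let \<open>F\<close> be the matrix of an element
  killed by cups, with coefficient \<open>a\<close> of the identity. Every other coloured diagram contains a cap at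
  a turnback of the word, so computing \<open>\<Sum>A. F A B * F A B'\<close> in two ways shows that \<open>F\<close> is symmetric, hence
  determined by \<open>a\<close>. On the block of a maximal alternating subsequence with \<open>n\<close> points the entries of
  weight \<open>k\<close> are powers of \<open>q\<close> times a constant \<open>r\<close>, and applying the functional that kills all cups gives
  \<open>r * (n choose k) = a\<close> up to powers of \<open>-q\<close>; so the quantum binomials are invertible if \<open>a\<close> is. Conversely, over
  \<open>\<int>[\<delta>]\<close> the single clasp expansion yields a killed element with \<open>a = [n]!\<close>, and the same formula together with
  unitriangularity shows that all its coefficients become divisible by \<open>[n]!\<close> after multiplication
  with the product of the binomials. For general words no cup straddles two maximal alternating
  subsequences, so the horizontal composite of the pieces is killed by all cups.
\<close>

section \<open>Noncrossing matchings of an interval\<close>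

text \<open>The ground ring may have zero divisors, so identities are kept multiplied by the
  identity coefficient \<open>a\<close>, and only units, or nonzero polynomials over
  \<int>[\<delta>], are cancelled. This is why existence is proved over \<int>[\<delta>], a domain,
  and transported by evaluation, while nonexistence is proved over the given ring itself. The
  symmetry of \<open>F\<close> does the work of reflecting diagrams: being killed by cups relates
  only the rows of \<open>F\<close>, and symmetry carries these relations over to the columns, so
  that a single constant is left for each weight of a block. Quantum binomials enter because the sum
  of \<open>q ^ (2 * \<Sum>B)\<close> over the \<open>k\<close>-subsets of a block is a shifted
  Gaussian binomial. Each weight \<open>k\<close> has its own denominator, the binomial of
  \<open>n\<close> and \<open>k\<close>. A common multiplier for all weights is enough, since it
  turns up as the identity coefficient of the quotient, where it only has to be a unit after
  evaluation; no sharper bound on denominators is sought.\<close>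

fun compat :: "nat \<times> nat \<Rightarrow> nat \<times> nat \<Rightarrow> bool" where
  "compat (a, b) (c, d) \<longleftrightarrow> b < c \<or> d < a \<or> a < c \<and> d < b \<or> c < a \<and> b < d"

text \<open>All inequalities in \<open>compat\<close> are strict, so distinct arcs share no end
  point; with the covering condition this makes the elements perfect matchings, each arc being
  stored once with its left end first.\<close>

definition nc :: "nat \<Rightarrow> (nat \<times> nat) set set" where
  "nc N = {T. (\<forall>(a, b)\<in>T. a < b \<and> b < N) \<and> (\<forall>e\<in>T. \<forall>f\<in>T. e \<noteq> f \<longrightarrow> compat e f) \<and>
     (\<forall>i<N. \<exists>a b. (a, b) \<in> T \<and> (i = a \<or> i = b))}"

definition linked :: "(nat \<times> nat) set \<Rightarrow> nat \<Rightarrow> nat \<Rightarrow> bool" where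
  "linked T a b \<longleftrightarrow> (a, b) \<in> T \<or> (b, a) \<in> T"

lemma linked_sym: "linked T a b \<longleftrightarrow> linked T b a"
  by (auto simp: linked_def)

lemma nc_less: "T \<in> nc N \<Longrightarrow> (a, b) \<in> T \<Longrightarrow> a < b \<and> b < N"
  by (auto simp: nc_def)

lemma nc_compat:
  "T \<in> nc N \<Longrightarrow> (a, b) \<in> T \<Longrightarrow> (c, d) \<in> T \<Longrightarrow>
     (a, b) = (c, d) \<or> b < c \<or> d < a \<or> a < c \<and> d < b \<or> c < a \<and> b < d"
  unfolding nc_def by fastforce

lemma nc_linked: "T \<in> nc N \<Longrightarrow> i < N \<Longrightarrow> \<exists>k. linked T i k"
  unfolding nc_def linked_def by blast

lemma linked_less: "T \<in> nc N \<Longrightarrow> linked T a b \<Longrightarrow> a < N \<and> b < N \<and> a \<noteq> b"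
  unfolding linked_def using nc_less by fastforce

lemma linked_unique:
  assumes "T \<in> nc N" "linked T a b" "linked T a c"
  shows "b = c"
proof -
  consider "(a, b) \<in> T" "(a, c) \<in> T" | "(a, b) \<in> T" "(c, a) \<in> T" | "(b, a) \<in> T" "(a, c) \<in> T"
    | "(b, a) \<in> T" "(c, a) \<in> T"
    using assms by (auto simp: linked_def)
  then show ?thesis
  proof cases
    case 1
    then show ?thesis using nc_compat[OF assms(1) 1] nc_less[OF assms(1) 1(1)] nc_less[OF assms(1) 1(2)] by auto
  next
    case 2
    then show ?thesis using nc_compat[OF assms(1) 2] nc_less[OF assms(1) 2(1)] nc_less[OF assms(1) 2(2)] by auto
  next
    case 3
    then show ?thesis using nc_compat[OF assms(1) 3] nc_less[OF assms(1) 3(1)] nc_less[OF assms(1) 3(2)] by auto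
  next
    case 4
    then show ?thesis using nc_compat[OF assms(1) 4] nc_less[OF assms(1) 4(1)] nc_less[OF assms(1) 4(2)] by auto
  qed
qed

lemma linked_arc: "T \<in> nc N \<Longrightarrow> linked T a b \<Longrightarrow> a < b \<Longrightarrow> (a, b) \<in> T"
  unfolding linked_def using nc_less by fastforce

lemma nc_finite: "T \<in> nc N \<Longrightarrow> finite T"
  by (rule finite_subset[of _ "{..<N} \<times> {..<N}"]) (auto dest: nc_less intro: less_trans)

lemma finite_nc: "finite (nc N)"
proof (rule finite_subset)
  show "nc N \<subseteq> Pow ({..<N} \<times> {..<N})" by (auto dest: nc_less intro: less_trans)
qed auto

lemma nc_cover: "T \<in> nc N \<Longrightarrow> i < N \<Longrightarrow> i \<in> fst ` T \<or> i \<in> snd ` T"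
  using nc_linked[of T N i] by (force simp: linked_def)

lemma fst_snd_disjoint: "T \<in> nc N \<Longrightarrow> fst ` T \<inter> snd ` T = {}"
proof -
  assume T: "T \<in> nc N"
  have False if "(a, b) \<in> T" "(c, a) \<in> T" for a b c
    using nc_compat[OF T that] nc_less[OF T that(1)] nc_less[OF T that(2)] by auto
  then show ?thesis by force
qed

lemma inj_fst_nc: "T \<in> nc N \<Longrightarrow> inj_on fst T"
  using linked_unique unfolding inj_on_def linked_def by fastforce

lemma inj_snd_nc: "T \<in> nc N \<Longrightarrow> inj_on snd T"
  using linked_unique unfolding inj_on_def linked_def by fastforce

lemma fst_un_snd: "T \<in> nc N \<Longrightarrow> fst ` T \<union> snd ` T = {..<N}"
proof -
  assume T: "T \<in> nc N"
  have "fst ` T \<union> snd ` T \<subseteq> {..<N}" using nc_less[OF T] by force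
  then show ?thesis using nc_cover[OF T] by blast
qed

lemma sum_arcs:
  fixes g :: "nat \<Rightarrow> 'a::comm_monoid_add"
  assumes T: "T \<in> nc N"
  shows "(\<Sum>i<N. g i) = (\<Sum>(a, b)\<in>T. g a + g b)"
proof -
  have "(\<Sum>i<N. g i) = sum g (fst ` T \<union> snd ` T)" by (simp add: fst_un_snd[OF T])
  also have "\<dots> = sum g (fst ` T) + sum g (snd ` T)"
    by (rule sum.union_disjoint) (use nc_finite[OF T] fst_snd_disjoint[OF T] in auto)
  also have "\<dots> = (\<Sum>e\<in>T. g (fst e)) + (\<Sum>e\<in>T. g (snd e))"
    by (simp add: sum.reindex inj_fst_nc[OF T] inj_snd_nc[OF T])
  finally show ?thesis by (simp add: sum.distrib case_prod_beta)
qed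

lemma card_nc: "T \<in> nc N \<Longrightarrow> 2 * card T = N"
  using sum_arcs[of T N "\<lambda>_. 1::nat"] by (simp add: case_prod_beta)

lemma nc_linked_inside:
  assumes T: "T \<in> nc N" and ab: "(a, b) \<in> T" and i: "a < i" "i < b"
  obtains k where "linked T i k" "a < k" "k < b"
proof -
  have "i < N" using i nc_less[OF T ab] by simp
  then obtain k where k: "linked T i k" using nc_linked[OF T] by blast
  have "a < k \<and> k < b"
  proof (cases "(i, k) \<in> T")
    case True
    then show ?thesis using nc_compat[OF T ab True] nc_less[OF T True] i by auto
  next
    case False
    then have "(k, i) \<in> T" using k by (simp add: linked_def)
    then show ?thesis using nc_compat[OF T ab, of k i] nc_less[OF T, of k i] i by auto
  qed
  then show ?thesis using that k by blast
qed

text \<open>Unless the arc is already short, the point \<open>Suc a\<close> opens a strictly shorter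
  arc inside it, and the descent ends at an arc between neighbours.\<close>

lemma nc_adjacent:
  assumes T: "T \<in> nc N" and "(a, b) \<in> T"
  shows "\<exists>i. (i, Suc i) \<in> T \<and> a \<le> i \<and> i < b"
  using assms(2)
proof (induction "b - a" arbitrary: a b rule: less_induct)
  case less
  show ?case
  proof (cases "b = Suc a")
    case True
    then show ?thesis using less.prems by auto
  next
    case False
    then have i: "a < Suc a" "Suc a < b" using nc_less[OF T less.prems] by auto
    then obtain k where k: "linked T (Suc a) k" "a < k" "k < b"
      using nc_linked_inside[OF T less.prems i] by blast
    have "Suc a < k" using k linked_less[OF T k(1)] by simp
    then have ak: "(Suc a, k) \<in> T" using linked_arc[OF T k(1)] by simp
    have "k - Suc a < b - a" using k by auto
    from less.hyps[OF this ak] k show ?thesis by auto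
  qed
qed

text \<open>The points strictly inside an arc are matched among themselves, so there are evenly
  many. This parity makes every matching colourable when the boundary word alternates.\<close>

lemma nc_odd:
  assumes T: "T \<in> nc N" and ab: "(a, b) \<in> T"
  shows "odd (b - a)"
proof -
  define U where "U = {e\<in>T. a < fst e \<and> snd e < b}"
  have U: "U \<subseteq> T" by (auto simp: U_def)
  have fin: "finite U" using U nc_finite[OF T] finite_subset by blast
  have inj: "inj_on fst U" "inj_on snd U"
    using inj_on_subset[OF inj_fst_nc[OF T] U] inj_on_subset[OF inj_snd_nc[OF T] U] by auto
  have eq: "{a<..<b} = fst ` U \<union> snd ` U"
  proof (intro equalityI subsetI)
    fix i assume "i \<in> {a<..<b}"
    then obtain k where k: "linked T i k" "a < k" "k < b" and i: "a < i" "i < b"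
      using nc_linked_inside[OF T ab] by auto
    then have "(i, k) \<in> U \<or> (k, i) \<in> U" by (auto simp: U_def linked_def)
    then show "i \<in> fst ` U \<union> snd ` U" by force
  next
    fix i assume "i \<in> fst ` U \<union> snd ` U"
    then show "i \<in> {a<..<b}" using nc_less[OF T] by (fastforce simp: U_def)
  qed
  have "fst ` U \<inter> snd ` U = {}" using fst_snd_disjoint[OF T] U by blast
  then have "card {a<..<b} = 2 * card U"
    unfolding eq using fin by (simp add: card_Un_disjoint card_image inj)
  then have "b - Suc a = 2 * card U" by simp
  then show ?thesis using nc_less[OF T ab] by presburger
qed

text \<open>A closing point is joined to the innermost opening point that is still free.\<close>

lemma nc_openers_inj:
  assumes T: "T \<in> nc N" and U: "U \<in> nc N" and eq: "fst ` T = fst ` U"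
  shows "T = U"
proof -
  have sub: "(a, b) \<in> W" if V: "V \<in> nc N" and W: "W \<in> nc N" and eq: "fst ` V = fst ` W"
    and "(a, b) \<in> V" for V W a b
    using that(4)
  proof (induction "b - a" arbitrary: a b rule: less_induct)
    case less
    have ab: "a < b" "b < N" using nc_less[OF V less.prems] by auto
    have inner: "linked W i k" if "linked V i k" "a < i" "i < b" "a < k" "k < b" for i k
    proof -
      have "(i, k) \<in> V \<and> i < k \<or> (k, i) \<in> V \<and> k < i"
        using that(1) nc_less[OF V] by (auto simp: linked_def)
      moreover have "i < k \<Longrightarrow> k - i < b - a" "k < i \<Longrightarrow> i - k < b - a" using that by arith+
      ultimately have "(i, k) \<in> W \<or> (k, i) \<in> W"
        using less.hyps by blast
      then show ?thesis by (auto simp: linked_def)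
    qed
    have out: "k \<le> a \<or> b \<le> k" if "linked W i k" "i \<le> a \<or> b \<le> i" for i k
    proof (rule ccontr)
      assume "\<not> (k \<le> a \<or> b \<le> k)"
      then have k: "a < k" "k < b" by auto
      then obtain l where "linked V k l" "a < l" "l < b"
        using nc_linked_inside[OF V less.prems] by blast
      then have "linked W k l" "a < l" "l < b" using inner k by auto
      then show False using linked_unique[OF W, of k i l] that by (auto simp: linked_sym)
    qed
    have "a \<in> fst ` W" using less.prems eq by force
    then obtain d where d: "(a, d) \<in> W" by auto
    have "b \<notin> fst ` V" using fst_snd_disjoint[OF V] less.prems by force
    then have "b \<in> snd ` W" using nc_cover[OF W ab(2)] eq by auto
    then obtain c where c: "(c, b) \<in> W" by auto
    \<comment> \<open>The inner points are used up by shorter arcs, so in \<open>W\<close> the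
      partners of \<open>a\<close> and \<open>b\<close> lie at or beyond the opposite ends; two
      distinct arcs of this kind would cross or share an end.\<close>
    have "b \<le> d" using out[of a d] d nc_less[OF W d] by (auto simp: linked_def)
    moreover have "c \<le> a" using out[of b c] c nc_less[OF W c] by (auto simp: linked_def)
    ultimately have "(a, d) = (c, b)"
      using nc_compat[OF W d c] nc_less[OF W d] nc_less[OF W c] ab by auto
    then show ?case using d by simp
  qed
  show ?thesis using sub[OF T U eq] sub[OF U T eq[symmetric]] by auto
qed

definition id_arcs :: "nat \<Rightarrow> (nat \<times> nat) set" where
  "id_arcs N = (\<lambda>i. (i, 2 * N - 1 - i)) ` {..<N}"

lemma id_arcs_nc: "id_arcs N \<in> nc (2 * N)"
proof -
  have "\<exists>a b. (a, b) \<in> id_arcs N \<and> (i = a \<or> i = b)" if "i < 2 * N" for i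
  proof (cases "i < N")
    case True
    then show ?thesis by (auto simp: id_arcs_def)
  next
    case False
    then have "(2 * N - 1 - i, i) = (2 * N - 1 - i, 2 * N - 1 - (2 * N - 1 - i))" "2 * N - 1 - i < N"
      using that by auto
    then show ?thesis unfolding id_arcs_def by blast
  qed
  then show ?thesis by (auto simp: nc_def id_arcs_def)
qed

lemma fst_id_arcs: "fst ` id_arcs N = {..<N}"
  by (simp add: id_arcs_def image_image)

lemma card_openers: "T \<in> nc (2 * N) \<Longrightarrow> card (fst ` T) = N"
  using card_nc[of T "2 * N"] by (simp add: card_image inj_fst_nc)

lemma card_closers: "T \<in> nc (2 * N) \<Longrightarrow> card (snd ` T) = N"
  using card_nc[of T "2 * N"] by (simp add: card_image inj_snd_nc)

text \<open>A closing point among the first \<open>N\<close> would, by \<open>nc_adjacent\<close>,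
  produce a short arc there. Without such an arc the \<open>N\<close> openers are exactly the bottom
  points, and the openers determine the matching.\<close>

lemma nc_bottom_arc:
  assumes T: "T \<in> nc (2 * N)" and "T \<noteq> id_arcs N"
  shows "\<exists>i. Suc i < N \<and> (i, Suc i) \<in> T"
proof (rule ccontr)
  assume no: "\<not> ?thesis"
  have "{..<N} \<subseteq> fst ` T"
  proof (rule ccontr)
    assume "\<not> {..<N} \<subseteq> fst ` T"
    then obtain i where "i < N" "i \<notin> fst ` T" by auto
    then have "i \<in> snd ` T" using nc_cover[OF T, of i] by auto
    then obtain a where a: "(a, i) \<in> T" by auto
    from nc_adjacent[OF T a] no \<open>i < N\<close> show False by auto
  qed
  then have "{..<N} = fst ` T"
    by (rule card_subset_eq[rotated]) (use card_openers[OF T] nc_finite[OF T] in auto)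
  then have "T = id_arcs N"
    by (intro nc_openers_inj[OF T id_arcs_nc]) (simp add: fst_id_arcs)
  then show False using assms by simp
qed

lemma nc_top_arc:
  assumes T: "T \<in> nc (2 * N)" and "T \<noteq> id_arcs N"
  shows "\<exists>i. N \<le> i \<and> Suc i < 2 * N \<and> (i, Suc i) \<in> T"
proof (rule ccontr)
  assume no: "\<not> ?thesis"
  have "{N..<2 * N} \<subseteq> snd ` T"
  proof (rule ccontr)
    assume "\<not> {N..<2 * N} \<subseteq> snd ` T"
    then obtain i where i: "N \<le> i" "i < 2 * N" "i \<notin> snd ` T" by (auto simp: subset_iff)
    then have "i \<in> fst ` T" using nc_cover[OF T, of i] by auto
    then obtain b where b: "(i, b) \<in> T" by auto
    from nc_adjacent[OF T b] nc_less[OF T b] no i show False by auto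
  qed
  then have "{N..<2 * N} = snd ` T"
    by (rule card_subset_eq[rotated]) (use card_closers[OF T] nc_finite[OF T] in auto)
  moreover have "fst ` T = (fst ` T \<union> snd ` T) - snd ` T" using fst_snd_disjoint[OF T] by blast
  ultimately have "fst ` T = {..<2 * N} - {N..<2 * N}" using fst_un_snd[OF T] by simp
  then have "fst ` T = {..<N}" by auto
  then have "T = id_arcs N"
    by (intro nc_openers_inj[OF T id_arcs_nc]) (simp add: fst_id_arcs)
  then show False using assms by simp
qed

subsection \<open>Inserting and capping off neighbouring points\<close>

definition skip :: "nat \<Rightarrow> nat \<Rightarrow> nat" where
  "skip j i = (if i < j then i else i + 2)"

lemma skip_less_iff [simp]: "skip j a < skip j b \<longleftrightarrow> a < b"
  by (auto simp: skip_def)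

lemma skip_eq_iff [simp]: "skip j a = skip j b \<longleftrightarrow> a = b"
  by (auto simp: skip_def)

lemma skip_neq [simp]: "skip j a \<noteq> j" "skip j a \<noteq> Suc j" "j \<noteq> skip j a" "Suc j \<noteq> skip j a"
  by (auto simp: skip_def)

lemma skip_cases:
  assumes "i \<noteq> j" "i \<noteq> Suc j"
  obtains i' where "i = skip j i'"
proof (cases "i < j")
  case True
  then show ?thesis using that[of i] by (simp add: skip_def)
next
  case False
  then have "i = skip j (i - 2)" using assms by (auto simp: skip_def)
  then show ?thesis by (rule that)
qed

definition shift_arcs :: "nat \<Rightarrow> (nat \<times> nat) set \<Rightarrow> (nat \<times> nat) set" where
  "shift_arcs j T = map_prod (skip j) (skip j) ` T"

lemma inj_shift: "inj (map_prod (skip j) (skip j))"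
  by (auto intro!: injI)

lemma shift_arcs_mem [simp]: "(skip j a, skip j b) \<in> shift_arcs j T \<longleftrightarrow> (a, b) \<in> T"
  by (auto simp: shift_arcs_def)

lemma shift_arcs_notin [simp]:
  "(j, a) \<notin> shift_arcs j T" "(a, j) \<notin> shift_arcs j T" "(Suc j, a) \<notin> shift_arcs j T" "(a, Suc j) \<notin> shift_arcs j T"
  by (auto simp: shift_arcs_def)

definition ins :: "nat \<Rightarrow> (nat \<times> nat) set \<Rightarrow> (nat \<times> nat) set" where
  "ins j T = insert (j, Suc j) (shift_arcs j T)"

text \<open>The effect of joining the points \<open>j\<close> and \<open>Suc j\<close> by an outside
  arc: the last two alternatives splice the strands that end there. If the two points are already
  linked, a circle closes and leaves no trace here; its value is supplied in
  \<open>capf_wt\<close>.\<close>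

definition cap :: "nat \<Rightarrow> (nat \<times> nat) set \<Rightarrow> (nat \<times> nat) set" where
  "cap j T = {(a, b). a < b \<and> (linked T (skip j a) (skip j b) \<or>
     linked T j (skip j a) \<and> linked T (Suc j) (skip j b) \<or>
     linked T j (skip j b) \<and> linked T (Suc j) (skip j a))}"

lemma compat_skip [simp]: "compat (skip j a, skip j b) (skip j c, skip j d) \<longleftrightarrow> compat (a, b) (c, d)"
  by simp

lemma ins_nc:
  assumes T: "T \<in> nc N" and j: "j \<le> N"
  shows "ins j T \<in> nc (N + 2)"
proof -
  have "\<exists>a b. (a, b) \<in> ins j T \<and> (i = a \<or> i = b)" if i: "i < N + 2" for i
  proof (cases "i = j \<or> i = Suc j")
    case True
    then show ?thesis by (auto simp: ins_def)
  next
    case False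
    then obtain k where k: "i = skip j k" using skip_cases[of i j] by auto
    then have "k < N" using i j by (auto simp: skip_def split: if_splits)
    then obtain l where "linked T k l" using nc_linked[OF T] by blast
    then have "(i, skip j l) \<in> ins j T \<or> (skip j l, i) \<in> ins j T"
      by (auto simp: linked_def ins_def k)
    then show ?thesis by blast
  qed
  moreover have "a < b \<and> b < N + 2" if "(a, b) \<in> ins j T" for a b
    using that j nc_less[OF T] unfolding ins_def shift_arcs_def
    by (auto simp: skip_def dest!: nc_less[OF T])
  moreover have "compat e f" if e: "e \<in> ins j T" and f: "f \<in> ins j T" and "e \<noteq> f" for e f
  proof -
    have 1: "compat (j, Suc j) (skip j a, skip j b)" "compat (skip j a, skip j b) (j, Suc j)"
      if "(a, b) \<in> T" for a b
      using nc_less[OF T that] by (auto simp: skip_def)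
    have 2: "compat (skip j a, skip j b) (skip j c, skip j d)"
      if "(a, b) \<in> T" "(c, d) \<in> T" "\<not> (a = c \<and> b = d)" for a b c d
      using nc_compat[OF T that(1,2)] that(3) by auto
    from e consider "e = (j, Suc j)" | a b where "(a, b) \<in> T" "e = (skip j a, skip j b)"
      by (auto simp: ins_def shift_arcs_def)
    then show ?thesis
    proof cases
      case 1
      then show ?thesis using f \<open>e \<noteq> f\<close> \<open>\<And>a b. (a, b) \<in> T \<Longrightarrow> compat (j, Suc j) (skip j a, skip j b)\<close>
        by (auto simp: ins_def shift_arcs_def simp del: compat.simps)
    next
      case (2 a b)
      from f consider "f = (j, Suc j)" | c d where "(c, d) \<in> T" "f = (skip j c, skip j d)"
        by (auto simp: ins_def shift_arcs_def)
      then show ?thesis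
        using 1(2)[OF 2(1)] \<open>e \<noteq> f\<close> \<open>e = _\<close>
          \<open>\<And>a b c d. (a, b) \<in> T \<Longrightarrow> (c, d) \<in> T \<Longrightarrow> \<not> (a = c \<and> b = d) \<Longrightarrow> compat (skip j a, skip j b) (skip j c, skip j d)\<close>[OF 2(1)]
        by cases (auto simp del: compat.simps compat_skip)
    qed
  qed
  ultimately show ?thesis by (auto simp: nc_def)
qed

lemma inj_ins: "inj (ins j)"
proof (rule injI)
  fix T U assume "ins j T = ins j U"
  then have "shift_arcs j T = shift_arcs j U"
    unfolding ins_def by (metis insert_ident shift_arcs_notin(1))
  then show "T = U" unfolding shift_arcs_def by (metis inj_image_eq_iff inj_shift)
qed

text \<open>The strands at \<open>j\<close> and \<open>Suc j\<close> either coincide, or their far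
  ends lie on opposite sides, both left or both right. Absence of crossings fixes the nesting in the
  last two cases and excludes that \<open>j\<close> runs to the right while \<open>Suc j\<close>
  runs to the left. The clauses \<open>(a, b) \<notin> U\<close> allow the factor of the spliced arc
  to be split off from a weight.\<close>

lemma cap_cases:
  assumes T: "T \<in> nc (N + 2)" and j: "j \<le> N"
  obtains (loop) U where "U \<in> nc N" "T = ins j U" "cap j T = U"
  | (zigzag) U a b where "a < j" "j \<le> b"
      "T = insert (a, j) (insert (Suc j, skip j b) (shift_arcs j U))"
      "(a, b) \<notin> U" "cap j T = insert (a, b) U"
  | (left) U a b where "a < b" "b < j"
      "T = insert (a, Suc j) (insert (b, j) (shift_arcs j U))"
      "(a, b) \<notin> U" "cap j T = insert (a, b) U"
  | (right) U a b where "j \<le> a" "a < b"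
      "T = insert (Suc j, skip j a) (insert (j, skip j b) (shift_arcs j U))"
      "(a, b) \<notin> U" "cap j T = insert (a, b) U"
proof -
  define U where "U = {(a, b). (skip j a, skip j b) \<in> T}"
  have U: "shift_arcs j U = {e \<in> T. fst e \<notin> {j, Suc j} \<and> snd e \<notin> {j, Suc j}}"
  proof (intro equalityI subsetI)
    fix e assume e: "e \<in> {e \<in> T. fst e \<notin> {j, Suc j} \<and> snd e \<notin> {j, Suc j}}"
    obtain a where a: "fst e = skip j a" using e skip_cases[of "fst e" j] by auto
    obtain b where b: "snd e = skip j b" using e skip_cases[of "snd e" j] by auto
    have "e = (skip j a, skip j b)" using a b by (simp add: prod_eq_iff)
    then show "e \<in> shift_arcs j U" using e by (simp add: U_def)
  qed (auto simp: shift_arcs_def U_def)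
  obtain k l where k: "linked T j k" and l: "linked T (Suc j) l"
    using nc_linked[OF T, of j] nc_linked[OF T, of "Suc j"] j by auto
  have kj: "m = k" if "linked T j m" for m using linked_unique[OF T that k] .
  have lj: "m = l" if "linked T (Suc j) m" for m using linked_unique[OF T that l] .
  note kn = linked_less[OF T k] and ln = linked_less[OF T l]
  show ?thesis
  proof (cases "k = Suc j")
    case True
    then have l_eq: "l = j" using lj[of j] k by (simp add: linked_sym)
    have arc: "(j, Suc j) \<in> T" using linked_arc[OF T k] True by simp
    have T_eq: "T = ins j U"
    proof -
      have "e = (j, Suc j)" if "e \<in> T" "fst e \<in> {j, Suc j} \<or> snd e \<in> {j, Suc j}" for e
      proof -
        obtain a b where e: "e = (a, b)" by force
        have "a < b" using nc_less[OF T] that e by auto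
        moreover have "a = j \<and> b = k \<or> a = Suc j \<and> b = l \<or> b = j \<and> a = k \<or> b = Suc j \<and> a = l"
          using kj[of a] kj[of b] lj[of a] lj[of b] that e by (auto simp: linked_def)
        ultimately show ?thesis using True l_eq e by auto
      qed
      then show ?thesis unfolding ins_def U using arc by blast
    qed
    have nl: "\<not> linked T j (skip j a)" "\<not> linked T (Suc j) (skip j a)" for a
      using kj[of "skip j a"] lj[of "skip j a"] True l_eq by auto
    have U_less: "a < b \<and> b < N" if "(a, b) \<in> U" for a b
      using nc_less[OF T, of "skip j a" "skip j b"] that j by (auto simp: U_def) (auto simp: skip_def split: if_splits)
    have lU: "linked T (skip j a) (skip j b) \<longleftrightarrow> (a, b) \<in> U" if "a < b" for a b
      using linked_arc[OF T, of "skip j a" "skip j b"] that by (auto simp: U_def linked_def)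
    have "cap j T = U"
      unfolding cap_def using nl lU U_less by (auto cong: conj_cong)
    moreover have "U \<in> nc N"
    proof -
      have "\<exists>a b. (a, b) \<in> U \<and> (i = a \<or> i = b)" if i: "i < N" for i
      proof -
        have "skip j i < N + 2" using i by (simp add: skip_def)
        then obtain m where m: "linked T (skip j i) m" using nc_linked[OF T] by blast
        then have "m \<noteq> j" "m \<noteq> Suc j" using nl[of i] by (auto simp: linked_sym)
        then obtain m' where "m = skip j m'" using skip_cases by blast
        then show ?thesis using m by (auto simp: linked_def U_def)
      qed
      moreover have "compat e f" if "e \<in> U" "f \<in> U" "e \<noteq> f" for e f
        using nc_compat[OF T, of "skip j (fst e)" "skip j (snd e)" "skip j (fst f)" "skip j (snd f)"] that
        by (cases e; cases f) (auto simp: U_def)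
      ultimately show ?thesis using U_less by (auto simp: nc_def)
    qed
    ultimately show ?thesis using loop T_eq by blast
  next
    case False
    then have "l \<noteq> j" using kj[of "Suc j"] l by (auto simp: linked_sym)
    obtain a where a: "k = skip j a" using skip_cases[of k j] kn False by auto
    obtain b where b: "l = skip j b" using skip_cases[of l j] ln \<open>l \<noteq> j\<close> by auto
    have "a \<noteq> b" using k l a b linked_unique[OF T, of k j "Suc j"] by (auto simp: linked_sym)
    define E where "E = (min j k, max j k)"
    define F where "F = (min (Suc j) l, max (Suc j) l)"
    have E: "E \<in> T" using k kn linked_arc[OF T, of j k] linked_arc[OF T, of k j]
      by (auto simp: E_def linked_sym min_def max_def)
    have F: "F \<in> T" using l ln linked_arc[OF T, of "Suc j" l] linked_arc[OF T, of l "Suc j"]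
      by (auto simp: F_def linked_sym min_def max_def)
    have T_eq: "T = insert E (insert F (shift_arcs j U))"
    proof -
      have "e = E \<or> e = F" if "e \<in> T" "fst e \<in> {j, Suc j} \<or> snd e \<in> {j, Suc j}" for e
      proof -
        obtain c d where e: "e = (c, d)" by force
        have "c < d" using nc_less[OF T] that e by auto
        moreover have "c = j \<and> d = k \<or> c = Suc j \<and> d = l \<or> d = j \<and> c = k \<or> d = Suc j \<and> c = l"
          using kj[of c] kj[of d] lj[of c] lj[of d] that e by (auto simp: linked_def)
        ultimately show ?thesis using e by (auto simp: E_def F_def)
      qed
      then show ?thesis unfolding U using E F by blast
    qed
    have lk: "linked T j (skip j c) \<longleftrightarrow> c = a" "linked T (Suc j) (skip j c) \<longleftrightarrow> c = b" for c
      using kj[of "skip j c"] lj[of "skip j c"] k l a b by auto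
    have cap_eq: "cap j T = insert (min a b, max a b) U"
    proof -
      have U_less: "c < d" if "(c, d) \<in> U" for c d
        using nc_less[OF T, of "skip j c" "skip j d"] that by (auto simp: U_def)
      have lU: "linked T (skip j c) (skip j d) \<longleftrightarrow> (c, d) \<in> U" if "c < d" for c d
        using linked_arc[OF T, of "skip j c" "skip j d"] that by (auto simp: U_def linked_def)
      show ?thesis unfolding cap_def lk using \<open>a \<noteq> b\<close> U_less lU
        by (auto simp: min_def max_def cong: conj_cong)
    qed
    have notin: "(a, c) \<notin> U" "(c, a) \<notin> U" "(b, c) \<notin> U" "(c, b) \<notin> U" for c
      using linked_unique[OF T, of "skip j a" "skip j c" j] linked_unique[OF T, of "skip j b" "skip j c" "Suc j"]
        k l a b by (auto simp: U_def linked_def)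
    have c: "E = F \<or> compat E F" using E F T by (auto simp: nc_def)
    consider "a < j" "j \<le> b" | "b < a" "a < j" | "j \<le> b" "b < a"
      using c \<open>a \<noteq> b\<close> kn ln unfolding E_def F_def a b
      by (auto simp: skip_def min_def max_def split: if_splits)
    then show ?thesis
    proof cases
      case 1
      show ?thesis
        by (rule zigzag[of a b U]) (use 1 T_eq cap_eq notin in
            \<open>auto simp: E_def F_def a b skip_def min_def max_def\<close>)
    next
      case 2
      show ?thesis
        by (rule left[of b a U]) (use 2 T_eq cap_eq notin in
            \<open>auto simp: E_def F_def a b skip_def min_def max_def\<close>)
    next
      case 3
      show ?thesis
        by (rule right[of b a U]) (use 3 T_eq cap_eq notin in
            \<open>auto simp: E_def F_def a b skip_def min_def max_def\<close>)
    qed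
  qed
qed

lemma cap_nc:
  assumes T: "T \<in> nc (N + 2)" and j: "j \<le> N"
  shows "cap j T \<in> nc N"
proof -
  \<comment> \<open>One argument for the three splicing cases: \<open>a'\<close> and
    \<open>b'\<close> are the partners of \<open>j\<close> and \<open>Suc j\<close> after
    compression, in either order.\<close>
  have main: "insert (a, b) U \<in> nc N"
    if ab: "a < b" and E: "E = (min j (skip j a'), max j (skip j a'))"
      and F: "F = (min (Suc j) (skip j b'), max (Suc j) (skip j b'))"
      and ab': "a = a' \<and> b = b' \<or> a = b' \<and> b = a'"
      and T_eq: "T = insert E (insert F (shift_arcs j U))"
      and notin: "(a, b) \<notin> U" for a b a' b' U E F
  proof -
    have EF: "E \<in> T" "F \<in> T" using T_eq by auto
    have lnk: "linked T j (skip j a')" "linked T (Suc j) (skip j b')"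
      using EF by (auto simp: E F linked_def min_def max_def split: if_splits)
    have less: "c < d \<and> d < N" if "(c, d) \<in> U" for c d
    proof -
      have "(skip j c, skip j d) \<in> T" using that T_eq by simp
      from nc_less[OF T this] j show ?thesis by (auto simp: skip_def split: if_splits)
    qed
    have ab_less: "a < N" "b < N" using linked_less[OF T lnk(1)] linked_less[OF T lnk(2)] ab' j
      by (auto simp: skip_def split: if_splits)
    have "\<exists>c d. (c, d) \<in> insert (a, b) U \<and> (i = c \<or> i = d)" if i: "i < N" for i
    proof -
      have "skip j i < N + 2" using i by (simp add: skip_def)
      then obtain m where m: "linked T (skip j i) m" using nc_linked[OF T] by blast
      then show ?thesis using ab' unfolding T_eq linked_def
        by (auto simp: E F min_def max_def shift_arcs_def split: if_splits) blast+
    qed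
    moreover have c: "compat (c, d) (a, b)" "compat (a, b) (c, d)" if "(c, d) \<in> U" for c d
    proof -
      have "(skip j c, skip j d) \<in> T" using that T_eq by simp
      note 1 = nc_compat[OF T this EF(1)[unfolded E]] nc_compat[OF T this EF(2)[unfolded F]]
        nc_compat[OF T EF(1)[unfolded E] EF(2)[unfolded F]]
      have "c < d" using less[OF that] by simp
      then have "d < a \<or> b < c \<or> c < a \<and> b < d \<or> a < c \<and> d < b"
        using ab' ab 1 by (auto simp: skip_def min_def max_def split: if_splits)
      then show "compat (c, d) (a, b)" "compat (a, b) (c, d)" by auto
    qed
    moreover have "compat e f" if "e \<in> U" "f \<in> U" "e \<noteq> f" for e f
      using nc_compat[OF T, of "skip j (fst e)" "skip j (snd e)" "skip j (fst f)" "skip j (snd f)"] that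
      by (cases e; cases f) (auto simp: T_eq)
    ultimately show ?thesis using less ab ab_less by (auto simp: nc_def simp del: compat.simps)
  qed
  from T j show ?thesis
  proof (cases rule: cap_cases)
    case (loop U)
    then show ?thesis by simp
  next
    case (zigzag U a b)
    have "insert (a, b) U \<in> nc N"
      by (rule main[of a b _ a _ b U]) (use zigzag in \<open>auto simp: skip_def min_def max_def\<close>)
    then show ?thesis using zigzag by simp
  next
    case (left U a b)
    have "insert (a, b) U \<in> nc N"
      by (rule main[of a b _ b _ a U]) (use left in \<open>auto simp: insert_commute skip_def min_def max_def\<close>)
    then show ?thesis using left by simp
  next
    case (right U a b)
    have "insert (a, b) U \<in> nc N"
      by (rule main[of a b _ b _ a U]) (use right in \<open>auto simp: insert_commute skip_def min_def max_def\<close>)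
    then show ?thesis using right by simp
  qed
qed

section \<open>The action on spin states\<close>

text \<open>
  A matching is sent to a function on the sign sequences of its end points, \<open>True\<close> being the
  negative sign. This needs a square root \<open>q\<close> of the loop parameter in the sense \<open>\<delta> = q + q'\<close>,
  \<open>q * q' = 1\<close>; such a \<open>q\<close> lives in an extension \<open>'r\<close> of the ground ring. Since \<open>'r\<close> must not
  depend on \<open>\<delta>\<close> as a type, the ground ring is only a direct factor of a subring of \<open>'r\<close>: the embedding
  \<open>\<iota>\<close> need not preserve 1.
\<close>

locale spin =
  fixes \<delta> :: "'k::comm_ring_1" and q q' :: "'r::comm_ring_1" and \<iota> :: "'k \<Rightarrow> 'r" and \<rho> :: "'r \<Rightarrow> 'k"
  assumes qq': "q * q' = 1"
    and \<iota>_add: "\<iota> (a + b) = \<iota> a + \<iota> b"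
    and \<iota>_mult: "\<iota> (a * b) = \<iota> a * \<iota> b"
    and \<iota>_delta: "\<iota> (a * \<delta>) = \<iota> a * (q + q')"
    and \<rho>_mult: "\<rho> (\<iota> a * r) = a * \<rho> r"
    and \<rho>_\<iota>: "\<rho> (\<iota> a) = a"
begin

lemma qq'_cancel [simp]: "q * (q' * r) = r" "q' * (q * r) = r"
  using qq' by (simp_all flip: mult.assoc) (simp add: mult.commute)

lemma \<iota>_0 [simp]: "\<iota> 0 = 0"
  using \<iota>_add[of 0 0] by simp

lemma \<iota>_uminus: "\<iota> (- a) = - \<iota> a"
  using \<iota>_add[of a "- a"] by (simp add: eq_neg_iff_add_eq_0 add.commute)

lemma \<iota>_eq_iff: "\<iota> a = \<iota> b \<longleftrightarrow> a = b"
  using \<rho>_\<iota> by metis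

lemma \<iota>_one_mult [simp]: "\<iota> 1 * \<iota> a = \<iota> a"
  using \<iota>_mult[of 1 a] by simp

lemma \<iota>_sum: "\<iota> (sum f A) = (\<Sum>x\<in>A. \<iota> (f x))"
  by (induction A rule: infinite_finite_induct) (auto simp: \<iota>_add)

text \<open>The cup vector in the tensor square of the sign space. Paired with the functional in
  \<open>capf\<close> it gives \<open>- (q + q')\<close> for a circle and 1 for both
  zigzags.\<close>

definition kap :: "bool \<Rightarrow> bool \<Rightarrow> 'r" where
  "kap x y = (if x = y then 0 else if x then - q else 1)"

lemma kap_simps [simp]: "kap x x = 0" "kap True False = - q" "kap False True = 1"
  by (auto simp: kap_def)

definition wt :: "(nat \<times> nat) set \<Rightarrow> (nat \<Rightarrow> bool) \<Rightarrow> 'r" where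
  "wt T s = (\<Prod>(a, b)\<in>T. kap (s a) (s b))"

definition fill :: "nat \<Rightarrow> bool \<Rightarrow> bool \<Rightarrow> (nat \<Rightarrow> bool) \<Rightarrow> nat \<Rightarrow> bool" where
  "fill j x y s i = (if i < j then s i else if i = j then x else if i = Suc j then y else s (i - 2))"

lemma fill_simps [simp]: "fill j x y s (skip j i) = s i" "fill j x y s j = x" "fill j x y s (Suc j) = y"
  by (auto simp: fill_def skip_def)

lemma fill_less [simp]: "i < j \<Longrightarrow> fill j x y s i = s i"
  by (simp add: fill_def)

text \<open>Contraction of the tensor factors \<open>j\<close> and \<open>Suc j\<close> with the cap
  functional; \<open>fill\<close> puts the two contracted indices back.\<close>

definition capf :: "nat \<Rightarrow> ((nat \<Rightarrow> bool) \<Rightarrow> 'r) \<Rightarrow> (nat \<Rightarrow> bool) \<Rightarrow> 'r" where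
  "capf j \<xi> s = \<xi> (fill j True False s) - q' * \<xi> (fill j False True s)"

definition insf :: "nat \<Rightarrow> ((nat \<Rightarrow> bool) \<Rightarrow> 'r) \<Rightarrow> (nat \<Rightarrow> bool) \<Rightarrow> 'r" where
  "insf j \<xi> s = kap (s j) (s (Suc j)) * \<xi> (\<lambda>i. s (skip j i))"

lemma wt_image:
  assumes "inj g"
  shows "wt (map_prod g g ` T) s = wt T (\<lambda>i. s (g i))"
proof -
  have "inj_on (map_prod g g) T" using assms by (metis inj_on_subset prod.inj_map subset_UNIV)
  then show ?thesis unfolding wt_def by (simp add: prod.reindex case_prod_beta)
qed

lemma wt_shift: "wt (shift_arcs j T) s = wt T (\<lambda>i. s (skip j i))"
  unfolding shift_arcs_def by (rule wt_image) (auto intro: injI)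

lemma wt_insert: "finite T \<Longrightarrow> (a, b) \<notin> T \<Longrightarrow> wt (insert (a, b) T) s = kap (s a) (s b) * wt T s"
  by (simp add: wt_def)

lemma finite_shift_arcs: "finite T \<Longrightarrow> finite (shift_arcs j T)"
  by (simp add: shift_arcs_def)

lemma wt_ins: "finite T \<Longrightarrow> wt (ins j T) = insf j (wt T)"
  by (auto simp: ins_def wt_insert wt_shift insf_def finite_shift_arcs)

lemma capf_insf_same: "capf j (insf j \<xi>) s = - (q + q') * \<xi> s"
  by (simp add: capf_def insf_def algebra_simps)

text \<open>The factor \<open>- (q + q')\<close> is the circle that \<open>cap\<close> forgets.
  Otherwise only the two arcs at \<open>j\<close> and \<open>Suc j\<close> see the contracted
  indices, which leaves a check over the signs at their far ends.\<close>

lemma capf_wt: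
  assumes T: "T \<in> nc (N + 2)" and j: "j \<le> N"
  shows "capf j (wt T) s = (if (j, Suc j) \<in> T then - (q + q') else 1) * wt (cap j T) s"
  using assms
proof (cases rule: cap_cases)
  case (loop U)
  then show ?thesis using nc_finite[OF loop(1)] by (simp add: wt_ins capf_insf_same) (simp add: ins_def)
next
  case (zigzag U a b)
  then have fin: "finite U" using nc_finite[OF cap_nc[OF T j]] by auto
  have "wt T (fill j x y s) = kap (s a) x * kap y (s b) * wt U s" for x y
    using zigzag(1) unfolding zigzag(3)
    by (simp add: wt_insert wt_shift fin finite_shift_arcs)
  moreover have "(j, Suc j) \<notin> T" using zigzag by auto
  ultimately show ?thesis using fin zigzag(4) qq'
    by (simp add: capf_def zigzag(5) wt_insert kap_def algebra_simps)
next
  case (left U a b)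
  then have fin: "finite U" using nc_finite[OF cap_nc[OF T j]] by auto
  have "wt T (fill j x y s) = kap (s a) y * kap (s b) x * wt U s" for x y
    using left(1,2) unfolding left(3)
    by (simp add: wt_insert wt_shift fin finite_shift_arcs)
  moreover have "(j, Suc j) \<notin> T" using left by auto
  ultimately show ?thesis using fin left(4) qq'
    by (simp add: capf_def left(5) wt_insert kap_def algebra_simps)
next
  case (right U a b)
  then have fin: "finite U" using nc_finite[OF cap_nc[OF T j]] by auto
  have "wt T (fill j x y s) = kap y (s a) * kap x (s b) * wt U s" for x y
    using right(1,2) unfolding right(3)
    by (simp add: wt_insert wt_shift fin finite_shift_arcs)
  moreover have "(j, Suc j) \<notin> T" using right by auto
  ultimately show ?thesis using fin right(4) qq'
    by (simp add: capf_def right(5) wt_insert kap_def algebra_simps)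
qed

text \<open>This is the leading state of a matching; the value provides the diagonal of the
  unitriangular system.\<close>

lemma wt_closers:
  assumes "T \<in> nc N"
  shows "wt T (\<lambda>i. i \<in> snd ` T) = 1"
proof -
  have "kap (a \<in> snd ` T) (b \<in> snd ` T) = 1" if "(a, b) \<in> T" for a b
  proof -
    have "a \<in> fst ` T" "b \<in> snd ` T" using that by force+
    then have "a \<notin> snd ` T" using fst_snd_disjoint[OF assms] by blast
    then show ?thesis using \<open>b \<in> snd ` T\<close> by simp
  qed
  then show ?thesis unfolding wt_def by (intro prod.neutral) auto
qed

lemma wt_nonzero:
  assumes "finite T" "wt T s \<noteq> 0" "(a, b) \<in> T"
  shows "s a \<noteq> s b"
proof
  assume "s a = s b"
  then have "wt T s = 0" unfolding wt_def using assms
    by (intro prod_zero) (auto intro!: bexI[of _ "(a, b)"])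
  then show False using assms by simp
qed

text \<open>A nonzero weight means that every arc of \<open>T\<close> contains exactly one opener of
  \<open>U\<close>, which is at least the left end of that arc. Summing over arcs compares the
  opener sums, and equality forces equal sets of openers.\<close>

lemma wt_closers_nonzero:
  assumes T: "T \<in> nc N" and U: "U \<in> nc N" and nz: "wt T (\<lambda>i. i \<in> snd ` U) \<noteq> 0"
  shows "T = U \<or> \<Sum>(fst ` T) < \<Sum>(fst ` U)"
proof -
  define g where "g i = (if i \<in> fst ` U then i else 0)" for i
  have one: "(a \<in> fst ` U) \<noteq> (b \<in> fst ` U)" if ab: "(a, b) \<in> T" for a b
  proof -
    have "(a \<in> snd ` U) \<noteq> (b \<in> snd ` U)" using wt_nonzero[OF nc_finite[OF T] nz ab] .
    moreover have "i \<in> snd ` U \<longleftrightarrow> i \<notin> fst ` U" if "i < N" for i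
      using nc_cover[OF U that] fst_snd_disjoint[OF U] by blast
    ultimately show ?thesis using nc_less[OF T ab] by auto
  qed
  have "\<Sum>(fst ` U) = (\<Sum>i<N. g i)"
    unfolding g_def using fst_un_snd[OF U]
    by (intro sum.mono_neutral_cong_left) auto
  also have "\<dots> = (\<Sum>e\<in>T. g (fst e) + g (snd e))"
    by (simp add: sum_arcs[OF T] case_prod_beta)
  finally have U_sum: "\<Sum>(fst ` U) = (\<Sum>e\<in>T. g (fst e) + g (snd e))" .
  have T_sum: "\<Sum>(fst ` T) = (\<Sum>e\<in>T. fst e)"
    by (simp add: sum.reindex inj_fst_nc[OF T])
  have le: "fst e \<le> g (fst e) + g (snd e)" if "e \<in> T" for e
    using one[of "fst e" "snd e"] nc_less[OF T, of "fst e" "snd e"] that by (auto simp: g_def)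
  show ?thesis
  proof (cases "fst ` T \<subseteq> fst ` U")
    case True
    then have sub: "g (fst e) + g (snd e) = fst e" if "e \<in> T" for e
      using one[of "fst e" "snd e"] that by (auto simp: g_def)
    have "card (fst ` T) = card (fst ` U)"
      using card_nc[OF T] card_nc[OF U] by (simp add: card_image inj_fst_nc[OF T] inj_fst_nc[OF U])
    then have "fst ` T = fst ` U" using True nc_finite[OF U]
      by (intro card_subset_eq) auto
    then show ?thesis using nc_openers_inj[OF T U] by simp
  next
    case False
    then obtain e where e: "e \<in> T" "fst e \<notin> fst ` U" by auto
    have "snd e \<in> fst ` U" using one[of "fst e" "snd e"] e by auto
    then have "fst e < g (fst e) + g (snd e)"
      using nc_less[OF T, of "fst e" "snd e"] e by (simp add: g_def)
    then have "(\<Sum>e\<in>T. fst e) < (\<Sum>e\<in>T. g (fst e) + g (snd e))"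
      by (intro sum_strict_mono_ex1) (use le e nc_finite[OF T] in auto)
    then show ?thesis by (simp add: U_sum T_sum)
  qed
qed

text \<open>
  The weights are unitriangular with respect to the sum of the opening points, so coefficients are
  integral combinations of values.
\<close>

lemma wt_coefficients:
  assumes fin: "finite A" and A: "\<And>x. x \<in> A \<Longrightarrow> t x \<in> nc N" and inj: "inj_on t A"
    and I0: "0 \<in> I" and I_minus: "\<And>r s. r \<in> I \<Longrightarrow> s \<in> I \<Longrightarrow> r - s \<in> I"
    and I_mult: "\<And>r s. r \<in> I \<Longrightarrow> r * s \<in> I"
    and val: "\<And>s. (\<Sum>x\<in>A. c x * wt (t x) s) \<in> I"
    and x: "x \<in> A"
  shows "c x \<in> I"
  using x
proof (induction "\<Sum>(fst ` t x)" arbitrary: x rule: less_induct)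
  case less
  have I_sum: "sum f B \<in> I" if "\<And>y. y \<in> B \<Longrightarrow> f y \<in> I" for f :: "'b \<Rightarrow> 'r" and B
  proof -
    have I_add: "r + s \<in> I" if "r \<in> I" "s \<in> I" for r s
      using I_minus[OF that(1) I_minus[OF I0 that(2)]] by simp
    show ?thesis using that
      by (induction B rule: infinite_finite_induct) (auto intro: I0 I_add)
  qed
  \<comment> \<open>The leading state of \<open>t x\<close>: any other matching with nonzero weight
    there has a smaller opener sum, so its coefficient is in \<open>I\<close> by induction.\<close>
  define s where "s i \<longleftrightarrow> i \<in> snd ` t x" for i
  have "c y * wt (t y) s \<in> I" if y: "y \<in> A - {x}" for y
  proof (cases "wt (t y) s = 0")
    case False
    have "t y \<noteq> t x" using y less.prems inj by (auto simp: inj_on_def)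
    then have "\<Sum>(fst ` t y) < \<Sum>(fst ` t x)"
      using wt_closers_nonzero[OF A A] False y less.prems unfolding s_def by blast
    then show ?thesis using less.hyps y I_mult by simp
  qed (use I0 in simp)
  then have "(\<Sum>y\<in>A - {x}. c y * wt (t y) s) \<in> I" by (rule I_sum)
  then have "(\<Sum>y\<in>A. c y * wt (t y) s) - (\<Sum>y\<in>A - {x}. c y * wt (t y) s) \<in> I"
    using val I_minus by blast
  moreover have "(\<Sum>y\<in>A. c y * wt (t y) s) = c x * wt (t x) s + (\<Sum>y\<in>A - {x}. c y * wt (t y) s)"
    using fin less.prems by (rule sum.remove)
  moreover have "wt (t x) s = 1" unfolding s_def by (rule wt_closers[OF A[OF less.prems]])
  ultimately show ?case by simp
qed

end

text \<open>Moving \<open>j\<close> to \<open>Suc j\<close> is a bijection from the sets that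
  contain only \<open>j\<close> to those that contain only \<open>Suc j\<close>, and it reverses the
  sign of \<open>h\<close>.\<close>

lemma sum_swap_zero:
  fixes h :: "nat set \<Rightarrow> 'a::ab_group_add"
  assumes fin: "finite \<A>"
    and zero: "\<And>A. A \<in> \<A> \<Longrightarrow> j \<in> A \<longleftrightarrow> Suc j \<in> A \<Longrightarrow> h A = 0"
    and up: "\<And>A. A \<in> \<A> \<Longrightarrow> j \<in> A \<Longrightarrow> Suc j \<notin> A \<Longrightarrow>
      insert (Suc j) (A - {j}) \<in> \<A> \<and> h (insert (Suc j) (A - {j})) = - h A"
    and down: "\<And>A. A \<in> \<A> \<Longrightarrow> j \<notin> A \<Longrightarrow> Suc j \<in> A \<Longrightarrow> insert j (A - {Suc j}) \<in> \<A>"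
  shows "sum h \<A> = 0"
proof -
  define P where "P = {A \<in> \<A>. j \<in> A \<and> Suc j \<notin> A}"
  define Q where "Q = {A \<in> \<A>. j \<notin> A \<and> Suc j \<in> A}"
  have "sum h \<A> = sum h (P \<union> Q)"
    by (rule sum.mono_neutral_right) (use fin zero in \<open>auto simp: P_def Q_def\<close>)
  also have "\<dots> = sum h P + sum h Q"
    by (rule sum.union_disjoint) (use fin in \<open>auto simp: P_def Q_def\<close>)
  also have "sum h Q = (\<Sum>A\<in>P. h (insert (Suc j) (A - {j})))"
    by (rule sum.reindex_bij_witness[of _ "\<lambda>A. insert (Suc j) (A - {j})" "\<lambda>A. insert j (A - {Suc j})"])
      (use up down in \<open>auto simp: P_def Q_def insert_absorb intro!: arg_cong[of _ _ h]\<close>)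
  also have "\<dots> = (\<Sum>A\<in>P. - h A)"
    by (rule sum.cong) (use up in \<open>auto simp: P_def\<close>)
  finally show ?thesis by (simp add: sum_negf)
qed

text \<open>
  \<open>A\<close> and \<open>B\<close> are the sets of negative points on the bottom and on the top line; signs on the top
  line are reversed, so that the identity becomes a diagonal matrix.
\<close>

definition st :: "nat \<Rightarrow> nat set \<Rightarrow> nat set \<Rightarrow> nat \<Rightarrow> bool" where
  "st N A B i = (if i < N then i \<in> A else 2 * N - 1 - i \<notin> B)"

section \<open>Orthogonality of killed elements to diagrams with arcs on the bottom line; symmetry
  and uniqueness\<close>

context spin
begin

definition comb :: "'x set \<Rightarrow> ('x \<Rightarrow> (nat \<times> nat) set) \<Rightarrow> ('x \<Rightarrow> 'k) \<Rightarrow> (nat \<Rightarrow> bool) \<Rightarrow> 'r" where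
  "comb X t c s = (\<Sum>x\<in>X. \<iota> (c x) * wt (t x) s)"

definition killed :: "nat \<Rightarrow> nat set \<Rightarrow> ((nat \<Rightarrow> bool) \<Rightarrow> 'r) \<Rightarrow> bool" where
  "killed N J \<xi> \<longleftrightarrow> (\<forall>j\<in>J. Suc j < N \<longrightarrow> (\<forall>s. capf j \<xi> s = 0))"

lemma fill_st:
  assumes "Suc j < N" "j \<in> A" "Suc j \<notin> A"
  shows "st N A B = fill j True False (\<lambda>i. st N A B (skip j i))"
    "st N (insert (Suc j) (A - {j})) B = fill j False True (\<lambda>i. st N A B (skip j i))"
proof -
  show "st N A B = fill j True False (\<lambda>i. st N A B (skip j i))"
  proof
    fix i
    show "st N A B i = fill j True False (\<lambda>i. st N A B (skip j i)) i"
    proof (cases "i = j \<or> i = Suc j")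
      case False
      then obtain k where "i = skip j k" using skip_cases[of i j] by blast
      then show ?thesis by (simp add: st_def)
    qed (use assms in \<open>auto simp: st_def\<close>)
  qed
  show "st N (insert (Suc j) (A - {j})) B = fill j False True (\<lambda>i. st N A B (skip j i))"
  proof
    fix i
    show "st N (insert (Suc j) (A - {j})) B i = fill j False True (\<lambda>i. st N A B (skip j i)) i"
    proof (cases "i = j \<or> i = Suc j")
      case False
      then obtain k where "i = skip j k" using skip_cases[of i j] by blast
      then show ?thesis by (simp add: st_def)
    qed (use assms in \<open>auto simp: st_def\<close>)
  qed
qed

lemma killed_swap:
  assumes "killed N J \<xi>" "j \<in> J" "Suc j < N" "j \<in> A" "Suc j \<notin> A"
  shows "\<xi> (st N A B) = q' * \<xi> (st N (insert (Suc j) (A - {j})) B)"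
proof -
  have "capf j \<xi> (\<lambda>i. st N A B (skip j i)) = 0" using assms by (auto simp: killed_def)
  then show ?thesis unfolding capf_def by (simp flip: fill_st[OF assms(3-5)])
qed

text \<open>All other arcs see the same signs. Stated by cross multiplication because the factor of
  the arc may vanish.\<close>

lemma wt_arc:
  assumes T: "T \<in> nc M" and j: "(j, Suc j) \<in> T"
    and s: "\<And>i. i < M \<Longrightarrow> i \<noteq> j \<Longrightarrow> i \<noteq> Suc j \<Longrightarrow> s i = s' i"
  shows "kap (s' j) (s' (Suc j)) * wt T s = kap (s j) (s (Suc j)) * wt T s'"
proof -
  define U where "U = T - {(j, Suc j)}"
  have T_eq: "T = insert (j, Suc j) U" "(j, Suc j) \<notin> U" using j by (auto simp: U_def)
  have fin: "finite U" using nc_finite[OF T] by (simp add: U_def)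
  have ne: "a \<noteq> j" "a \<noteq> Suc j" "b \<noteq> j" "b \<noteq> Suc j" "a < M" "b < M" if "(a, b) \<in> U" for a b
    using nc_compat[OF T, of a b j "Suc j"] nc_less[OF T, of a b] j that by (auto simp: U_def)
  have "wt U s = wt U s'" unfolding wt_def
  proof (rule prod.cong)
    fix e assume "e \<in> U"
    then show "(case e of (a, b) \<Rightarrow> kap (s a) (s b)) = (case e of (a, b) \<Rightarrow> kap (s' a) (s' b))"
      using ne s by (cases e) auto
  qed simp
  then show ?thesis unfolding T_eq(1) wt_insert[OF fin T_eq(2)] by simp
qed

text \<open>The ratio \<open>- q\<close> here, against \<open>q'\<close> in
  \<open>killed_swap\<close>, makes the terms of \<open>pairing\<close> cancel in pairs.\<close>

lemma wt_bottom:
  assumes T: "T \<in> nc M" and j: "(j, Suc j) \<in> T" "Suc j < N"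
  shows "(j \<in> A \<longleftrightarrow> Suc j \<in> A) \<Longrightarrow> wt T (st N A B) = 0"
    and "j \<in> A \<Longrightarrow> Suc j \<notin> A \<Longrightarrow> wt T (st N A B) = - q * wt T (st N (insert (Suc j) (A - {j})) B)"
proof -
  show "wt T (st N A B) = 0" if "j \<in> A \<longleftrightarrow> Suc j \<in> A"
    using wt_nonzero[OF nc_finite[OF T] _ j(1), of "st N A B"] that j(2) by (auto simp: st_def)
  show "wt T (st N A B) = - q * wt T (st N (insert (Suc j) (A - {j})) B)" if "j \<in> A" "Suc j \<notin> A"
    using wt_arc[OF T j(1), of "st N A B" "st N (insert (Suc j) (A - {j})) B"] j(2) that
    by (auto simp: st_def)
qed

text \<open>On the top line the positions run backwards and the signs are reversed; the two
  reversals compensate, so the ratio is \<open>- q\<close> as on the bottom line.\<close>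

lemma wt_top:
  assumes T: "T \<in> nc (2 * N)" and j: "(2 * N - 2 - j, 2 * N - 1 - j) \<in> T" "Suc j < N"
  shows "(j \<in> B \<longleftrightarrow> Suc j \<in> B) \<Longrightarrow> wt T (st N A B) = 0"
    and "j \<in> B \<Longrightarrow> Suc j \<notin> B \<Longrightarrow> wt T (st N A B) = - q * wt T (st N A (insert (Suc j) (B - {j})))"
proof -
  define p where "p = 2 * N - 2 - j"
  have p: "2 * N - 1 - j = Suc p" "2 * N - 2 - j = p" using j(2) by (auto simp: p_def)
  have val: "st N A B p \<longleftrightarrow> Suc j \<notin> B" "st N A B (Suc p) \<longleftrightarrow> j \<notin> B" for B
  proof -
    have "\<not> p < N" "\<not> Suc p < N" "2 * N - 1 - p = Suc j" "2 * N - 1 - Suc p = j"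
      using j(2) by (auto simp: p_def)
    then show "st N A B p \<longleftrightarrow> Suc j \<notin> B" "st N A B (Suc p) \<longleftrightarrow> j \<notin> B"
      unfolding st_def by simp_all
  qed
  note j' = j(1)[unfolded p]
  show "wt T (st N A B) = 0" if "j \<in> B \<longleftrightarrow> Suc j \<in> B"
    using wt_nonzero[OF nc_finite[OF T] _ j', of "st N A B"] that unfolding val by blast
  show "wt T (st N A B) = - q * wt T (st N A (insert (Suc j) (B - {j})))" if B: "j \<in> B" "Suc j \<notin> B"
  proof -
    have "st N A B i = st N A (insert (Suc j) (B - {j})) i" if "i < 2 * N" "i \<noteq> p" "i \<noteq> Suc p" for i
      using that B j(2) by (auto simp: st_def p_def)
    from wt_arc[OF T j', of "st N A B" "st N A (insert (Suc j) (B - {j}))", OF this]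
    show ?thesis using B unfolding val by simp
  qed
qed

lemma wt_id:
  assumes A: "A \<subseteq> {..<N}" and B: "B \<subseteq> {..<N}"
  shows "wt (id_arcs N) (st N A B) = (if A = B then (- q) ^ card B else 0)"
proof -
  have "inj_on (\<lambda>i. (i, 2 * N - 1 - i)) {..<N}" by (auto simp: inj_on_def)
  then have "wt (id_arcs N) (st N A B) = (\<Prod>i<N. kap (st N A B i) (st N A B (2 * N - 1 - i)))"
    unfolding wt_def id_arcs_def by (simp add: prod.reindex)
  also have "\<dots> = (\<Prod>i<N. kap (i \<in> A) (i \<notin> B))"
    by (intro prod.cong) (auto simp: st_def)
  also have "\<dots> = (if A = B then (- q) ^ card B else 0)"
  proof (cases "A = B")
    case True
    have "(\<Prod>i<N. kap (i \<in> A) (i \<notin> B)) = (\<Prod>i<N. if i \<in> B then - q else 1)"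
      by (intro prod.cong) (auto simp: True)
    also have "\<dots> = (- q) ^ card B"
      using B by (simp add: prod.If_cases Int_absorb1)
    finally show ?thesis using True by simp
  next
    case False
    then obtain i where "i < N" "i \<in> A \<longleftrightarrow> i \<notin> B" using A B by blast
    then have "(\<Prod>i<N. kap (i \<in> A) (i \<notin> B)) = 0"
      by (intro prod_zero) (auto intro!: bexI[of _ i])
    then show ?thesis using False by simp
  qed
  finally show ?thesis .
qed

text \<open>The top point above the bottom point \<open>j\<close> has position \<open>2 * N - 1 - j\<close>.\<close>

definition tame :: "nat \<Rightarrow> nat set \<Rightarrow> 'x set \<Rightarrow> ('x \<Rightarrow> (nat \<times> nat) set) \<Rightarrow> bool" where
  "tame N J X t \<longleftrightarrow> finite X \<and> inj_on t X \<and> (\<forall>x\<in>X. t x \<in> nc (2 * N) \<and> (t x \<noteq> id_arcs N \<longrightarrow>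
     (\<exists>j\<in>J. Suc j < N \<and> (j, Suc j) \<in> t x) \<and>
     (\<exists>j\<in>J. Suc j < N \<and> (2 * N - 2 - j, 2 * N - 1 - j) \<in> t x)))"

lemma sum_tame:
  assumes t: "tame N J X t" and i: "i \<in> X" "t i = id_arcs N"
    and z: "\<And>x. x \<in> X \<Longrightarrow> t x \<noteq> id_arcs N \<Longrightarrow> f x = 0"
  shows "sum f X = (f i :: 'r)"
proof -
  have fin: "finite X" and inj: "inj_on t X" using t by (simp_all add: tame_def)
  have "f x = 0" if "x \<in> X - {i}" for x
  proof -
    have "t x \<noteq> t i" using that i(1) inj_onD[OF inj, of x i] by blast
    then show ?thesis using z[of x] that i(2) by simp
  qed
  then show ?thesis using sum.remove[OF fin i(1), of f] by simp
qed

text \<open>Expand the right factor over diagrams. One that is not the identity has a bottom arc at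
  some \<open>j\<close> in \<open>J\<close>, and its terms cancel under moving \<open>j\<close> to
  \<open>Suc j\<close>; the identity is diagonal and picks out \<open>A = B'\<close>.\<close>

lemma pairing:
  assumes t: "tame N J X t" and i: "i \<in> X" "t i = id_arcs N" and \<xi>: "killed N J \<xi>"
    and B': "B' \<subseteq> {..<N}"
  shows "(\<Sum>A\<in>Pow {..<N}. \<xi> (st N A B) * comb X t c (st N A B')) =
    \<iota> (c i) * (- q) ^ card B' * \<xi> (st N B' B)"
proof -
  have zero: "(\<Sum>A\<in>Pow {..<N}. \<xi> (st N A B) * wt (t x) (st N A B')) = 0"
    if x: "x \<in> X" "t x \<noteq> id_arcs N" for x
  proof -
    have T: "t x \<in> nc (2 * N)" using t x by (auto simp: tame_def)
    obtain j where j: "j \<in> J" "Suc j < N" "(j, Suc j) \<in> t x" using t x by (auto simp: tame_def)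
    show ?thesis
    proof (rule sum_swap_zero[of _ j])
      fix A assume A: "A \<in> Pow {..<N}" "j \<in> A" "Suc j \<notin> A"
      show "insert (Suc j) (A - {j}) \<in> Pow {..<N} \<and>
        \<xi> (st N (insert (Suc j) (A - {j})) B) * wt (t x) (st N (insert (Suc j) (A - {j})) B') =
        - (\<xi> (st N A B) * wt (t x) (st N A B'))"
        using A j(2) killed_swap[OF \<xi> j(1,2) A(2,3)] wt_bottom(2)[OF T j(3,2) A(2,3)]
        by (auto simp: mult_ac)
    qed (use j wt_bottom(1)[OF T j(3,2)] in auto)
  qed
  have "(\<Sum>A\<in>Pow {..<N}. \<xi> (st N A B) * comb X t c (st N A B')) =
    (\<Sum>x\<in>X. \<iota> (c x) * (\<Sum>A\<in>Pow {..<N}. \<xi> (st N A B) * wt (t x) (st N A B')))"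
    unfolding comb_def sum_distrib_left by (subst sum.swap) (simp add: mult_ac)
  also have "\<dots> = \<iota> (c i) * (\<Sum>A\<in>Pow {..<N}. \<xi> (st N A B) * wt (t i) (st N A B'))"
    by (rule sum_tame[OF t i]) (simp add: zero)
  also have "(\<Sum>A\<in>Pow {..<N}. \<xi> (st N A B) * wt (t i) (st N A B')) =
      (\<Sum>A\<in>Pow {..<N}. if A = B' then \<xi> (st N B' B) * (- q) ^ card B' else 0)"
    by (rule sum.cong) (use B' in \<open>auto simp: i(2) wt_id\<close>)
  also have "\<dots> = \<xi> (st N B' B) * (- q) ^ card B'"
    using B' by (simp add: sum.delta')
  finally show ?thesis by (simp add: mult_ac)
qed

text \<open>Both sides evaluate the same sum, whose two factors may be exchanged. The choice
  \<open>c = d\<close> gives symmetry up to powers of \<open>- q\<close> and the factor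
  \<open>\<iota> (c i)\<close>; distinct \<open>c\<close> and \<open>d\<close> occur in the
  uniqueness proof.\<close>

lemma comb_symmetric:
  assumes t: "tame N J X t" and i: "i \<in> X" "t i = id_arcs N"
    and kc: "killed N J (comb X t c)" and kd: "killed N J (comb X t d)"
    and B: "B \<subseteq> {..<N}" "B' \<subseteq> {..<N}"
  shows "\<iota> (d i) * (- q) ^ card B' * comb X t c (st N B' B) =
    \<iota> (c i) * (- q) ^ card B * comb X t d (st N B B')"
  using pairing[OF t i kc B(2), of B d] pairing[OF t i kd B(1), of B' c]
  by (simp add: mult.commute)

lemma minus_q_power_cancel: "(- q) ^ k * r = (- q) ^ k * s \<longleftrightarrow> r = s"
proof
  assume "(- q) ^ k * r = (- q) ^ k * s"
  then have "(- q') ^ k * ((- q) ^ k * r) = (- q') ^ k * ((- q) ^ k * s)" by simp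
  moreover have "(- q') ^ k * (- q) ^ k = 1"
    by (simp flip: power_mult_distrib add: mult.commute qq')
  ultimately show "r = s" by (simp flip: mult.assoc)
qed simp

lemma wt_cong:
  assumes "T \<in> nc M" "\<And>i. i < M \<Longrightarrow> s i = s' i"
  shows "wt T s = wt T s'"
  unfolding wt_def
proof (rule prod.cong)
  fix e assume e: "e \<in> T"
  obtain a b where ab: "e = (a, b)" by force
  then have "a < M" "b < M" using nc_less[OF assms(1), of a b] e by auto
  then show "(case e of (a, b) \<Rightarrow> kap (s a) (s b)) = (case e of (a, b) \<Rightarrow> kap (s' a) (s' b))"
    by (simp add: ab assms(2))
qed simp

lemma wt_st:
  assumes "T \<in> nc (2 * N)"
  obtains A B where "A \<subseteq> {..<N}" "B \<subseteq> {..<N}" "\<And>T. T \<in> nc (2 * N) \<Longrightarrow> wt T s = wt T (st N A B)"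
proof -
  define A where "A = {i. i < N \<and> s i}"
  define B where "B = {i. i < N \<and> \<not> s (2 * N - 1 - i)}"
  have "wt T s = wt T (st N A B)" if "T \<in> nc (2 * N)" for T
    by (rule wt_cong[OF that]) (auto simp: st_def A_def B_def)
  then show ?thesis using that[of A B] by (auto simp: A_def B_def)
qed

lemma comb_unique:
  assumes t: "tame N J X t" and i: "i \<in> X" "t i = id_arcs N"
    and kc: "killed N J (comb X t c)" and kd: "killed N J (comb X t d)"
    and one: "c i = 1" "d i = 1" and x: "x \<in> X"
  shows "c x = d x"
proof -
  have nc: "t x \<in> nc (2 * N)" if "x \<in> X" for x using t that by (auto simp: tame_def)
  \<comment> \<open>\<open>\<iota> 1\<close> need not be 1, but it acts as 1 on combinations whose
    coefficients come from the ground ring.\<close>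
  have \<iota>1: "\<iota> 1 * (r * comb X t c s) = r * comb X t c s" for r c s
    unfolding comb_def sum_distrib_left
    by (intro sum.cong refl) (metis (no_types, lifting) \<iota>_one_mult mult.assoc mult.left_commute)
  have st: "comb X t c (st N A B) = comb X t d (st N A B)" if "A \<subseteq> {..<N}" "B \<subseteq> {..<N}" for A B
  proof -
    have "(- q) ^ card A * comb X t c (st N A B) = (- q) ^ card B * comb X t d (st N B A)"
      using comb_symmetric[OF t i kc kd that(2,1)] by (simp add: one \<iota>1 mult.assoc)
    also have "\<dots> = (- q) ^ card A * comb X t d (st N A B)"
      using comb_symmetric[OF t i kd kd that(2,1)] by (simp add: one \<iota>1 mult.assoc)
    finally show ?thesis by (simp only: minus_q_power_cancel)
  qed
  have eq: "comb X t c s = comb X t d s" for s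
  proof -
    obtain A B where "A \<subseteq> {..<N}" "B \<subseteq> {..<N}" "\<And>T. T \<in> nc (2 * N) \<Longrightarrow> wt T s = wt T (st N A B)"
      using wt_st[OF nc[OF i(1)]] by blast
    then show ?thesis using st[of A B] nc by (simp add: comb_def)
  qed
  \<comment> \<open>Unitriangularity with the zero ideal turns equality of values into equality of
    coefficients.\<close>
  have "\<iota> (c x) - \<iota> (d x) \<in> {0}"
  proof (rule wt_coefficients[of X t "2 * N" "{0}" "\<lambda>x. \<iota> (c x) - \<iota> (d x)"])
    show "(\<Sum>x\<in>X. (\<iota> (c x) - \<iota> (d x)) * wt (t x) s) \<in> {0}" for s
      using eq[of s] by (simp add: comb_def left_diff_distrib sum_subtractf)
  qed (use t x in \<open>auto simp: tame_def\<close>)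
  then show ?thesis by (simp add: \<iota>_eq_iff)
qed

end

section \<open>Quantum binomial coefficients as state sums\<close>

definition ev :: "'k::comm_ring_1 \<Rightarrow> int poly \<Rightarrow> 'k" where
  "ev \<delta> p = poly (map_poly of_int p) \<delta>"

lemma ev_pCons [simp]: "ev \<delta> (pCons a p) = of_int a + \<delta> * ev \<delta> p"
  by (cases "a = 0 \<and> p = 0") (auto simp: ev_def map_poly_pCons)

lemma ev_0 [simp]: "ev \<delta> 0 = 0"
  by (simp add: ev_def)

lemma ev_1 [simp]: "ev \<delta> 1 = 1"
  by (simp add: one_pCons)

lemma ev_add: "ev \<delta> (p + r) = ev \<delta> p + ev \<delta> r"
  by (induction p r rule: poly_induct2) (auto simp: algebra_simps)

lemma ev_uminus: "ev \<delta> (- p) = - ev \<delta> p"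
  by (induction p) (auto simp: algebra_simps)

lemma ev_diff: "ev \<delta> (p - r) = ev \<delta> p - ev \<delta> r"
  using ev_add[of \<delta> p "- r"] by (simp add: ev_uminus)

lemma ev_smult: "ev \<delta> (smult a p) = of_int a * ev \<delta> p"
  by (induction p) (auto simp: algebra_simps)

lemma ev_mult: "ev \<delta> (p * r) = ev \<delta> p * ev \<delta> r"
  by (induction p) (auto simp: algebra_simps ev_add ev_smult)

lemma ev_sum: "ev \<delta> (sum f A) = (\<Sum>x\<in>A. ev \<delta> (f x))"
  by (induction A rule: infinite_finite_induct) (auto simp: ev_add)

lemma ev_prod: "ev \<delta> (prod f A) = (\<Prod>x\<in>A. ev \<delta> (f x))"
  by (induction A rule: infinite_finite_induct) (auto simp: ev_mult)

lemma ev_power: "ev \<delta> (p ^ n) = ev \<delta> p ^ n"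
  by (induction n) (auto simp: ev_mult)

lemma ev_var: "ev [:0, 1:] p = p"
proof (induction p)
  case (pCons a p)
  have "of_int a = ([:a:] :: int poly)" by (simp add: of_int_poly)
  then show ?case using pCons by simp
qed simp

lemma qbinom_in_ev: "qbinom_in \<delta> k m = ev \<delta> (qbinom k m)"
  by (simp add: qbinom_in_def ev_def)

text \<open>At \<delta> = 2 the recursion is that of the natural numbers; this is how quantum
  numbers of positive index are seen to be nonzero polynomials, which may be cancelled.\<close>

lemma poly_qnum_2: "poly (qnum m) 2 = int m"
  by (induction m rule: qnum.induct) auto

lemma qnum_nonzero: "m > 0 \<Longrightarrow> qnum m \<noteq> 0"
  using poly_qnum_2[of m] by force

lemma qfact_nonzero: "qfact m \<noteq> 0"
  by (auto simp: qfact_def qnum_nonzero)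

lemma qbinom_0 [simp]: "qbinom n 0 = 1"
  using qfact_nonzero[of n] by (simp add: qbinom_def) (simp add: qfact_def)

lemma qbinom_self [simp]: "qbinom n n = 1"
  using qbinom_0[of n] by (simp add: qbinom_def mult.commute)

lemma qbinom_absorb:
  assumes "k < n"
  shows "qnum (Suc k) * qbinom n (Suc k) = qnum (n - k) * qbinom n k"
proof -
  have nk: "n - k = Suc (n - Suc k)" using assms by simp
  have "(qfact k * qfact (n - k)) * (qnum (Suc k) * qbinom n (Suc k)) =
      qnum (n - k) * (qbinom n (Suc k) * (qfact (Suc k) * qfact (n - Suc k)))"
    unfolding qfact_Suc nk by (simp only: mult_ac)
  also have "\<dots> = qnum (n - k) * (qbinom n k * (qfact k * qfact (n - k)))"
    using qbinom_mult[of "Suc k" n] qbinom_mult[of k n] assms by simp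
  finally show ?thesis using qfact_nonzero by (simp add: mult_ac)
qed

text \<open>Pascal's rule without powers of \<open>q\<close>: over the common denominator
  \<open>M\<close> it becomes the addition formula \<open>qnum_add\<close>.\<close>

lemma qbinom_pascal:
  assumes "k < n"
  shows "qbinom (Suc n) (Suc k) = qnum (Suc (n - k)) * qbinom n k - qnum k * qbinom n (Suc k)"
proof -
  have nk: "n - k = Suc (n - Suc k)" using assms by simp
  define M where "M = qfact (Suc k) * qfact (n - k)"
  have "M * qbinom (Suc n) (Suc k) = qfact (Suc n)"
    using qbinom_mult[of "Suc k" "Suc n"] assms by (simp add: M_def mult.commute)
  moreover have "M * (qnum (Suc (n - k)) * qbinom n k) = qnum (Suc (n - k)) * qnum (Suc k) * qfact n"
    using qbinom_mult[of k n] assms by (simp add: M_def qfact_Suc mult_ac)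
  moreover have "M * (qnum k * qbinom n (Suc k)) = qnum k * qnum (n - k) * qfact n"
  proof -
    have "M = qnum (n - k) * (qfact (Suc k) * qfact (n - Suc k))"
      unfolding M_def nk qfact_Suc by (simp only: mult_ac)
    then show ?thesis using qbinom_mult[of "Suc k" n] assms by (simp add: mult_ac)
  qed
  moreover have "qnum (Suc n) = qnum (Suc k) * qnum (Suc (n - k)) - qnum k * qnum (n - k)"
    using qnum_add[of k "n - k"] assms by simp
  ultimately have "M * qbinom (Suc n) (Suc k) =
      M * (qnum (Suc (n - k)) * qbinom n k - qnum k * qbinom n (Suc k))"
    unfolding qfact_Suc by (simp only: right_diff_distrib left_diff_distrib mult_ac)
  moreover have "M \<noteq> 0" by (simp add: M_def qfact_nonzero)
  ultimately show ?thesis by simp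
qed

section \<open>Sets of negative points of fixed size in a block of consecutive points\<close>

definition subsets_of :: "nat \<Rightarrow> nat \<Rightarrow> nat \<Rightarrow> nat set set" where
  "subsets_of p n k = {B. B \<subseteq> {p..<p + n} \<and> card B = k}"

lemma finite_subsets_of: "finite (subsets_of p n k)"
  by (rule finite_subset[of _ "Pow {p..<p + n}"]) (auto simp: subsets_of_def)

lemma subsets_of_0 [simp]: "subsets_of p n 0 = {{}}"
  by (auto simp: subsets_of_def dest: finite_subset)

lemma subsets_of_Suc:
  "subsets_of p (Suc n) (Suc k) = subsets_of p n (Suc k) \<union> insert (p + n) ` subsets_of p n k"
proof (intro equalityI subsetI)
  fix B assume "B \<in> subsets_of p (Suc n) (Suc k)"
  then have B: "B \<subseteq> {p..<Suc (p + n)}" "card B = Suc k" by (auto simp: subsets_of_def)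
  show "B \<in> subsets_of p n (Suc k) \<union> insert (p + n) ` subsets_of p n k"
  proof (cases "p + n \<in> B")
    case True
    have "B - {p + n} \<subseteq> {p..<p + n}" using B(1) by (auto simp: less_Suc_eq)
    moreover have "card (B - {p + n}) = k" using B(2) True by simp
    moreover have "B = insert (p + n) (B - {p + n})" using True by auto
    ultimately show ?thesis unfolding subsets_of_def by blast
  next
    case False
    then have "B \<subseteq> {p..<p + n}" using B(1) by (auto simp: less_Suc_eq subset_iff)
    then show ?thesis using B by (simp add: subsets_of_def)
  qed
next
  fix B assume "B \<in> subsets_of p n (Suc k) \<union> insert (p + n) ` subsets_of p n k"
  then show "B \<in> subsets_of p (Suc n) (Suc k)"
  proof
    assume "B \<in> insert (p + n) ` subsets_of p n k"
    then obtain C where C: "B = insert (p + n) C" "C \<subseteq> {p..<p + n}" "card C = k"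
      by (auto simp: subsets_of_def)
    then have "finite C" "p + n \<notin> C" using finite_subset by auto
    then show ?thesis using C by (auto simp: subsets_of_def)
  qed (auto simp: subsets_of_def)
qed

text \<open>Used contrapositively for sorting: unless the negative points already form the initial
  run of the block, one of them has a positive left neighbour in the block.\<close>

lemma downward_closed:
  assumes A: "A \<subseteq> {p..<m}" and down: "\<And>j. p \<le> j \<Longrightarrow> Suc j \<in> A \<Longrightarrow> j \<in> A"
  shows "A = {p..<p + card A}"
proof (cases "A = {}")
  case False
  have fin: "finite A" using A finite_subset by blast
  have M: "Max A \<in> A" using fin False by simp
  have "p + i \<in> A" if "p + i \<le> Max A" for i
    using that
  proof (induction "Max A - (p + i)" arbitrary: i)
    case 0
    then show ?case using M by simp
  next
    case (Suc d)
    then have "Suc (p + i) \<in> A" using Suc.hyps(1)[of "Suc i"] by simp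
    then show ?case using down by simp
  qed
  then have "x \<in> A" if "x \<in> {p..<Suc (Max A)}" for x using that le_Suc_ex[of p x] by auto
  moreover have "A \<subseteq> {p..<Suc (Max A)}" using A Max_ge[OF fin] by (auto simp: less_Suc_eq_le)
  ultimately have eq: "A = {p..<Suc (Max A)}" by blast
  have "p \<le> Max A" using M A by auto
  then have "card A = Suc (Max A) - p" "p + (Suc (Max A) - p) = Suc (Max A)" using arg_cong[OF eq, of card] by simp_all
  then show ?thesis using eq by simp
qed simp

section \<open>Gaussian state sums and the entries of a killed element on a block\<close>

context spin
begin

text \<open>The factor \<open>\<iota> a\<close> matters: \<open>q + q'\<close> is assumed to act as
  \<delta> only on the image of \<iota>, which need not contain 1.\<close>

lemma \<iota>_ev: "\<iota> a * ev (q + q') p = \<iota> (a * ev \<delta> p)"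
proof (induction p arbitrary: a)
  case (pCons b p)
  have of_int: "\<iota> a * of_int b = \<iota> (a * of_int b)" for a
  proof (induction b rule: int_induct[of _ 0])
    case (step1 i)
    then show ?case by (simp add: algebra_simps \<iota>_add)
  next
    case (step2 i)
    then show ?case using \<iota>_add[of "a * of_int i" "- a"] by (simp add: algebra_simps \<iota>_uminus)
  qed simp
  have "\<iota> a * ev (q + q') (pCons b p) = \<iota> (a * of_int b) + \<iota> (a * \<delta>) * ev (q + q') p"
    by (simp add: of_int ring_distribs \<iota>_delta mult.assoc)
  also have "\<dots> = \<iota> (a * of_int b) + \<iota> (a * \<delta> * ev \<delta> p)"
    using pCons.IH[of "a * \<delta>"] by simp
  finally show ?case by (simp add: distrib_left mult.assoc flip: \<iota>_add)
qed simp

abbreviation qn :: "nat \<Rightarrow> 'r" where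
  "qn m \<equiv> ev (q + q') (qnum m)"

lemma qn_rec: "qn (Suc (Suc m)) = (q + q') * qn (Suc m) - qn m"
  by (simp add: ev_diff ev_mult)

lemma qn_Suc: "qn (Suc m) = q * qn m + q' ^ m" "qn (Suc m) = q' * qn m + q ^ m"
proof -
  show "qn (Suc m) = q * qn m + q' ^ m"
  proof (induction m)
    case (Suc m)
    have "qn (Suc (Suc m)) = q * qn (Suc m) + (q' * qn (Suc m) - qn m)"
      by (simp add: qn_rec algebra_simps del: qnum.simps)
    also have "q' * qn (Suc m) - qn m = q' ^ Suc m"
      unfolding Suc by (simp add: algebra_simps)
    finally show ?case .
  qed simp
  show "qn (Suc m) = q' * qn m + q ^ m"
  proof (induction m)
    case (Suc m)
    have "qn (Suc (Suc m)) = q' * qn (Suc m) + (q * qn (Suc m) - qn m)"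
      by (simp add: qn_rec algebra_simps del: qnum.simps)
    also have "q * qn (Suc m) - qn m = q ^ Suc m"
      unfolding Suc by (simp add: algebra_simps)
    finally show ?case .
  qed simp
qed

lemma q_power_cancel: "q ^ k * q' ^ k = 1"
  by (simp flip: power_mult_distrib add: qq')

text \<open>The q-Pascal rule for balanced binomials, cleared of negative powers. It follows from
  \<open>qbinom_pascal\<close> by expanding \<open>qn (Suc (n - k))\<close> and trading the
  remaining product by absorption.\<close>

lemma qbinom_pascal_q:
  assumes "k < n"
  shows "q ^ Suc k * ev (q + q') (qbinom (Suc n) (Suc k)) =
    ev (q + q') (qbinom n (Suc k)) + q ^ Suc n * ev (q + q') (qbinom n k)"
proof -
  define a where "a = ev (q + q') (qbinom n k)"
  define b where "b = ev (q + q') (qbinom n (Suc k))"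
  have ab: "qn (Suc k) * b = qn (n - k) * a"
    unfolding a_def b_def by (simp only: qbinom_absorb[OF assms] flip: ev_mult)
  have "q ^ Suc k * ev (q + q') (qbinom (Suc n) (Suc k)) =
      q ^ Suc k * (qn (Suc (n - k)) * a - qn k * b)"
    by (simp only: qbinom_pascal[OF assms] ev_diff ev_mult a_def b_def)
  also have "\<dots> = q ^ k * (qn (n - k) * a) + q ^ Suc k * q ^ (n - k) * a - q ^ k * (q * qn k * b)"
    unfolding qn_Suc(2)[of "n - k"] by (simp add: algebra_simps)
  also have "q ^ Suc k * q ^ (n - k) = q ^ Suc n"
    using assms by (simp only: power_add[symmetric]) simp
  also have "q ^ k * (qn (n - k) * a) = q ^ k * (q * qn k * b) + b"
    unfolding ab[symmetric] qn_Suc(1)[of k]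
    using q_power_cancel[of k] by (simp add: ring_distribs mult.assoc[symmetric])
  finally show ?thesis by (simp add: a_def b_def)
qed

text \<open>Induction according to whether the last point belongs to \<open>B\<close>. The exponents
  \<open>2 * \<Sum>B\<close> are centred at \<open>k * (2 * p + n - 1)\<close>, while the balanced
  binomial is centred at 0; the factor \<open>q ^ k\<close> on the left avoids the
  subtraction.\<close>

lemma qbinom_state_sum:
  assumes "k \<le> n"
  shows "q ^ k * (\<Sum>B\<in>subsets_of p n k. q ^ (2 * \<Sum>B)) =
    q ^ (k * (2 * p + n)) * ev (q + q') (qbinom n k)"
  using assms
proof (induction n arbitrary: k)
  case (Suc n)
  show ?case
  proof (cases k)
    case (Suc l)
    have notin: "finite C \<and> p + n \<notin> C" if "C \<in> subsets_of p n l" for C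
      using that finite_subset by (auto simp: subsets_of_def)
    have inj: "inj_on (insert (p + n)) (subsets_of p n l)"
      by (rule inj_onI) (metis notin insert_ident)
    have "(\<Sum>B\<in>subsets_of p (Suc n) k. q ^ (2 * \<Sum>B)) =
      (\<Sum>B\<in>subsets_of p n (Suc l). q ^ (2 * \<Sum>B)) + (\<Sum>B\<in>insert (p + n) ` subsets_of p n l. q ^ (2 * \<Sum>B))"
      unfolding Suc subsets_of_Suc
      by (rule sum.union_disjoint) (auto simp: finite_subsets_of subsets_of_def)
    also have "(\<Sum>B\<in>insert (p + n) ` subsets_of p n l. q ^ (2 * \<Sum>B)) =
        (\<Sum>B\<in>subsets_of p n l. q ^ (2 * (p + n)) * q ^ (2 * \<Sum>B))"
      unfolding sum.reindex[OF inj] o_def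
      by (intro sum.cong refl) (use notin in \<open>simp add: power_add distrib_left\<close>)
    finally have rec: "(\<Sum>B\<in>subsets_of p (Suc n) k. q ^ (2 * \<Sum>B)) =
      (\<Sum>B\<in>subsets_of p n (Suc l). q ^ (2 * \<Sum>B)) + q ^ (2 * (p + n)) * (\<Sum>B\<in>subsets_of p n l. q ^ (2 * \<Sum>B))"
      by (simp add: sum_distrib_left)
    define s where "s k = (\<Sum>B\<in>subsets_of p n k. q ^ (2 * \<Sum>B))" for k
    have IH: "q ^ j * s j = q ^ (j * (2 * p + n)) * ev (q + q') (qbinom n j)" if "j \<le> n" for j
      using Suc.IH[OF that] by (simp add: s_def)
    have "q ^ k * (\<Sum>B\<in>subsets_of p (Suc n) k. q ^ (2 * \<Sum>B)) =
      q ^ Suc l * s (Suc l) + q ^ Suc (2 * (p + n)) * (q ^ l * s l)"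
      unfolding rec s_def[symmetric] by (simp add: Suc algebra_simps)
    also have "q ^ l * s l = q ^ (l * (2 * p + n)) * ev (q + q') (qbinom n l)"
      using IH[of l] Suc.prems Suc by simp
    also have "q ^ Suc (2 * (p + n)) * (q ^ (l * (2 * p + n)) * ev (q + q') (qbinom n l)) =
      q ^ (Suc l * (2 * p + n)) * (q ^ Suc n * ev (q + q') (qbinom n l))"
    proof -
      have "Suc (2 * (p + n)) + l * (2 * p + n) = Suc l * (2 * p + n) + Suc n" by (simp add: algebra_simps)
      then show ?thesis by (simp only: mult.assoc[symmetric] power_add[symmetric])
    qed
    also have "q ^ Suc l * s (Suc l) + \<dots> = q ^ (k * (2 * p + Suc n)) * ev (q + q') (qbinom (Suc n) k)"
    proof (cases "l = n")
      case True
      have "subsets_of p n (Suc n) = {}"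
      proof -
        have "card B \<le> n" if "B \<subseteq> {p..<p + n}" for B
          using card_mono[OF _ that] by simp
        then show ?thesis by (auto simp: subsets_of_def) (metis not_less_eq_eq order_refl)
      qed
      then have "s (Suc n) = 0" by (simp add: s_def)
      moreover have "Suc n * (2 * p + n) + Suc n = Suc n * (2 * p + Suc n)" by (simp add: algebra_simps)
      ultimately show ?thesis
        by (simp only: True Suc qbinom_self ev_1 mult_1_right mult_zero_right add_0 power_add[symmetric])
    next
      case False
      then have l: "l < n" using Suc.prems Suc by simp
      have "q ^ Suc l * s (Suc l) + q ^ (Suc l * (2 * p + n)) * (q ^ Suc n * ev (q + q') (qbinom n l)) =
        q ^ (Suc l * (2 * p + n)) * (q ^ Suc l * ev (q + q') (qbinom (Suc n) (Suc l)))"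
        unfolding qbinom_pascal_q[OF l] using IH[of "Suc l"] l by (simp add: distrib_left)
      also have "\<dots> = q ^ (k * (2 * p + Suc n)) * ev (q + q') (qbinom (Suc n) k)"
      proof -
        have "Suc l * (2 * p + n) + Suc l = Suc l * (2 * p + Suc n)" by (simp add: algebra_simps)
        then show ?thesis by (simp only: Suc mult.assoc[symmetric] power_add[symmetric])
      qed
      finally show ?thesis .
    qed
    finally show ?thesis .
  qed simp
qed simp

text \<open>Moving one negative sign a step to the left multiplies the value by \<open>q'\<close>,
  so each value is a power of \<open>q\<close> times that at the sorted set. The exponent
  \<open>\<Sum>A - \<Sum>{p..<p + k}\<close> is split between \<open>q\<close> and \<open>q'\<close>
  to avoid a subtraction of naturals.\<close>

lemma killed_sort:
  assumes k: "killed N J \<xi>" and pn: "p + n \<le> N" and J: "\<And>j. p \<le> j \<Longrightarrow> Suc j < p + n \<Longrightarrow> j \<in> J"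
    and A: "A \<in> subsets_of p n k"
  shows "\<xi> (st N A B) = q ^ \<Sum>A * (q' ^ \<Sum>{p..<p + k} * \<xi> (st N {p..<p + k} B))"
  using A
proof (induction "\<Sum>A" arbitrary: A rule: less_induct)
  case less
  have A: "A \<subseteq> {p..<p + n}" "card A = k" using less.prems by (auto simp: subsets_of_def)
  have fin: "finite A" using A(1) finite_subset by blast
  show ?case
  proof (cases "A = {p..<p + k}")
    case True
    then show ?thesis using q_power_cancel by (simp flip: mult.assoc)
  next
    case False
    then obtain j where j: "p \<le> j" "Suc j \<in> A" "j \<notin> A" using downward_closed[OF A(1)] A(2) by blast
    then have j': "Suc j < p + n" using A(1) by auto
    define A' where "A' = insert j (A - {Suc j})"
    have "A = insert (Suc j) (A' - {j})" using j by (auto simp: A'_def)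
    moreover have A': "j \<in> A'" "Suc j \<notin> A'" by (auto simp: A'_def)
    ultimately have step: "\<xi> (st N A' B) = q' * \<xi> (st N A B)"
      using killed_swap[OF k J[OF j(1) j'] _ A'] j' pn by simp
    have "\<Sum>A = \<Sum>(A - {Suc j}) + Suc j" using sum.remove[OF fin j(2), of "\<lambda>x. x"] by simp
    moreover have "\<Sum>A' = \<Sum>(A - {Suc j}) + j" unfolding A'_def using fin j(3) by simp
    ultimately have sum: "\<Sum>A = Suc (\<Sum>A')" by simp
    have "A' \<in> subsets_of p n k"
      using A fin j j' unfolding A'_def subsets_of_def
      by (auto simp: card_insert_if) (metis Suc_pred card_gt_0_iff empty_iff)
    from less.hyps[OF _ this] sum have "\<xi> (st N A' B) = q ^ \<Sum>A' * (q' ^ \<Sum>{p..<p + k} * \<xi> (st N {p..<p + k} B))"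
      by simp
    then have "q * (q' * \<xi> (st N A B)) = q * (q ^ \<Sum>A' * (q' ^ \<Sum>{p..<p + k} * \<xi> (st N {p..<p + k} B)))"
      unfolding step by simp
    then show ?thesis by (simp add: sum mult.assoc)
  qed
qed

text \<open>The functional \<open>B \<mapsto> q ^ \<Sum>B\<close> vanishes on the image of every cup.\<close>

lemma comb_top_functional:
  assumes t: "tame N J X t" and i: "i \<in> X" "t i = id_arcs N" and pn: "p + n \<le> N"
    and J: "\<And>j. j \<in> J \<Longrightarrow> Suc j < N \<Longrightarrow> j \<in> {p..<p + n} \<longleftrightarrow> Suc j \<in> {p..<p + n}"
    and A: "A \<in> subsets_of p n k"
  shows "(\<Sum>B\<in>subsets_of p n k. q ^ \<Sum>B * comb X t c (st N A B)) = \<iota> (c i) * (q ^ \<Sum>A * (- q) ^ k)"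
proof -
  have sub: "B \<subseteq> {..<N}" if "B \<in> subsets_of p n k" for B
    using that pn by (auto simp: subsets_of_def subset_iff)
  have zero: "(\<Sum>B\<in>subsets_of p n k. q ^ \<Sum>B * wt (t x) (st N A B)) = 0"
    if x: "x \<in> X" "t x \<noteq> id_arcs N" for x
  proof -
    have T: "t x \<in> nc (2 * N)" using t x by (auto simp: tame_def)
    obtain j where j: "j \<in> J" "Suc j < N" "(2 * N - 2 - j, 2 * N - 1 - j) \<in> t x"
      using t x by (auto simp: tame_def)
    note z = wt_top[OF T j(3,2)]
    show ?thesis
    proof (rule sum_swap_zero[of _ j])
      fix B assume B: "B \<in> subsets_of p n k" "j \<in> B" "Suc j \<notin> B"
      have "Suc j \<in> {p..<p + n}" using B J[OF j(1,2)] by (auto simp: subsets_of_def)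
      moreover have fin: "finite B" using B finite_subset by (auto simp: subsets_of_def)
      ultimately have "insert (Suc j) (B - {j}) \<in> subsets_of p n k"
        using B by (auto simp: subsets_of_def card_insert_if) (metis Suc_pred card_gt_0_iff empty_iff)
      moreover have "\<Sum>(insert (Suc j) (B - {j})) = Suc (\<Sum>B)"
        using fin B sum.remove[OF fin B(2), of "\<lambda>x. x"] by simp
      ultimately show "insert (Suc j) (B - {j}) \<in> subsets_of p n k \<and>
        q ^ \<Sum>(insert (Suc j) (B - {j})) * wt (t x) (st N A (insert (Suc j) (B - {j}))) =
        - (q ^ \<Sum>B * wt (t x) (st N A B))"
        using z(2)[OF B(2,3), of A] by (simp add: mult_ac)
    next
      fix B assume B: "B \<in> subsets_of p n k" "j \<notin> B" "Suc j \<in> B"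
      have "j \<in> {p..<p + n}" using B J[OF j(1,2)] by (auto simp: subsets_of_def)
      moreover have fin: "finite B" using B finite_subset by (auto simp: subsets_of_def)
      ultimately show "insert j (B - {Suc j}) \<in> subsets_of p n k"
        using B by (auto simp: subsets_of_def card_insert_if) (metis Suc_pred card_gt_0_iff empty_iff)
    qed (use z(1) in \<open>auto simp: finite_subsets_of\<close>)
  qed
  have "(\<Sum>B\<in>subsets_of p n k. q ^ \<Sum>B * comb X t c (st N A B)) =
    (\<Sum>x\<in>X. \<iota> (c x) * (\<Sum>B\<in>subsets_of p n k. q ^ \<Sum>B * wt (t x) (st N A B)))"
    unfolding comb_def sum_distrib_left by (subst sum.swap) (simp add: mult_ac)
  also have "\<dots> = \<iota> (c i) * (\<Sum>B\<in>subsets_of p n k. q ^ \<Sum>B * wt (t i) (st N A B))"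
    by (rule sum_tame[OF t i]) (simp add: zero)
  also have "(\<Sum>B\<in>subsets_of p n k. q ^ \<Sum>B * wt (t i) (st N A B)) =
      (\<Sum>B\<in>subsets_of p n k. if A = B then q ^ \<Sum>A * (- q) ^ k else 0)"
    by (rule sum.cong) (use sub[OF A] sub in \<open>auto simp: i(2) wt_id subsets_of_def\<close>)
  also have "\<dots> = q ^ \<Sum>A * (- q) ^ k"
    using A finite_subsets_of by (simp add: sum.delta)
  finally show ?thesis .
qed

text \<open>Sorting acts on the bottom index, and symmetry transfers it to the top index: this is
  the first equation. The functional of \<open>comb_top_functional\<close>, applied to the sorted
  row and summed by \<open>qbinom_state_sum\<close>, gives the second. The factor
  \<open>\<iota> (c i)\<close> remains because symmetry holds only after multiplication by
  it.\<close>

lemma killed_block: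
  assumes t: "tame N J X t" and i: "i \<in> X" "t i = id_arcs N" and kc: "killed N J (comb X t c)"
    and pn: "p + n \<le> N" and J1: "\<And>j. p \<le> j \<Longrightarrow> Suc j < p + n \<Longrightarrow> j \<in> J"
    and J2: "\<And>j. j \<in> J \<Longrightarrow> Suc j < N \<Longrightarrow> j \<in> {p..<p + n} \<longleftrightarrow> Suc j \<in> {p..<p + n}"
    and k: "k \<le> n"
  obtains r m where "\<And>A B. A \<in> subsets_of p n k \<Longrightarrow> B \<in> subsets_of p n k \<Longrightarrow>
      \<iota> (c i) * comb X t c (st N A B) = \<iota> (c i) * (q ^ (\<Sum>A + \<Sum>B) * r)"
    "\<iota> (c i * qbinom_in \<delta> n k) * (q ^ m * r) = \<iota> (c i * c i) * (- q) ^ k"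
proof -
  define Z where "Z = {p..<p + k}"
  define \<xi> where "\<xi> = comb X t c"
  \<comment> \<open>The corner entry, stripped of one power of \<open>q\<close> for its row and one
    for its column.\<close>
  define r where "r = q' ^ \<Sum>Z * (q' ^ \<Sum>Z * \<xi> (st N Z Z))"
  have Z: "Z \<in> subsets_of p n k" using k by (auto simp: subsets_of_def Z_def)
  have sub: "B \<subseteq> {..<N}" if "B \<in> subsets_of p n k" for B
    using that pn by (auto simp: subsets_of_def subset_iff)
  have sort: "\<xi> (st N A B) = q ^ \<Sum>A * (q' ^ \<Sum>Z * \<xi> (st N Z B))" if "A \<in> subsets_of p n k" for A B
    using killed_sort[OF kc pn J1 that] by (simp add: \<xi>_def Z_def)
  have sym: "\<iota> (c i) * \<xi> (st N A B) = \<iota> (c i) * \<xi> (st N B A)"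
    if "A \<in> subsets_of p n k" "B \<in> subsets_of p n k" for A B
  proof -
    have "card A = k" "card B = k" using that by (auto simp: subsets_of_def)
    then have "(- q) ^ k * (\<iota> (c i) * \<xi> (st N A B)) = (- q) ^ k * (\<iota> (c i) * \<xi> (st N B A))"
      using comb_symmetric[OF t i kc kc sub[OF that(2)] sub[OF that(1)]] by (simp add: \<xi>_def mult_ac)
    then show ?thesis by (simp only: minus_q_power_cancel)
  qed
  have form: "\<iota> (c i) * \<xi> (st N A B) = \<iota> (c i) * (q ^ (\<Sum>A + \<Sum>B) * r)"
    if A: "A \<in> subsets_of p n k" and B: "B \<in> subsets_of p n k" for A B
  proof -
    have "\<iota> (c i) * \<xi> (st N A B) = q ^ \<Sum>A * (q' ^ \<Sum>Z * (\<iota> (c i) * \<xi> (st N B Z)))"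
      unfolding sym[OF B Z] unfolding sort[OF A, of B] by (simp add: mult_ac)
    then show ?thesis unfolding sort[OF B, of Z] r_def by (simp add: mult_ac power_add)
  qed
  have "\<iota> (c i) * (\<iota> (c i) * (q ^ \<Sum>Z * (- q) ^ k)) =
      (\<Sum>B\<in>subsets_of p n k. q ^ \<Sum>B * (\<iota> (c i) * \<xi> (st N Z B)))"
  proof -
    have "(\<Sum>B\<in>subsets_of p n k. q ^ \<Sum>B * \<xi> (st N Z B)) = \<iota> (c i) * (q ^ \<Sum>Z * (- q) ^ k)"
      unfolding \<xi>_def by (rule comb_top_functional[OF t i pn J2 Z])
    then have "\<iota> (c i) * (\<iota> (c i) * (q ^ \<Sum>Z * (- q) ^ k)) = \<iota> (c i) * (\<Sum>B\<in>subsets_of p n k. q ^ \<Sum>B * \<xi> (st N Z B))"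
      by (simp only:)
    also have "\<dots> = (\<Sum>B\<in>subsets_of p n k. q ^ \<Sum>B * (\<iota> (c i) * \<xi> (st N Z B)))"
      unfolding sum_distrib_left by (intro sum.cong refl) (simp only: mult_ac)
    finally show ?thesis .
  qed
  also have "\<dots> = (\<Sum>B\<in>subsets_of p n k. \<iota> (c i) * q ^ \<Sum>Z * r * q ^ (2 * \<Sum>B))"
    by (intro sum.cong refl) (simp add: form[OF Z] power_add mult_2 mult_ac)
  also have "\<dots> = \<iota> (c i) * q ^ \<Sum>Z * r * (\<Sum>B\<in>subsets_of p n k. q ^ (2 * \<Sum>B))"
    by (simp add: sum_distrib_left)
  finally have "q' ^ \<Sum>Z * (q ^ k * (\<iota> (c i) * (\<iota> (c i) * (q ^ \<Sum>Z * (- q) ^ k)))) =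
    q' ^ \<Sum>Z * (\<iota> (c i) * q ^ \<Sum>Z * r * (q ^ k * (\<Sum>B\<in>subsets_of p n k. q ^ (2 * \<Sum>B))))"
    by (simp add: mult_ac)
  then have "q ^ k * (\<iota> (c i * c i) * (- q) ^ k) =
      \<iota> (c i) * r * (q ^ (k * (2 * p + n)) * ev (q + q') (qbinom n k))"
    unfolding qbinom_state_sum[OF k] using q_power_cancel[of "\<Sum>Z"]
    by (simp add: \<iota>_mult mult_ac) (simp flip: mult.assoc)
  also have "\<dots> = \<iota> (c i * qbinom_in \<delta> n k) * (q ^ (k * (2 * p + n)) * r)"
    unfolding qbinom_in_ev \<iota>_ev[symmetric] by (simp add: mult_ac)
  finally have final: "q ^ k * (\<iota> (c i * c i) * (- q) ^ k) = \<iota> (c i * qbinom_in \<delta> n k) * (q ^ (k * (2 * p + n)) * r)" .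
  \<comment> \<open>By \<open>k \<le> n\<close> the exponent is large enough to cancel
    \<open>q ^ k\<close>; what is left over is the \<open>m\<close> of the statement.\<close>
  have le: "k \<le> k * (2 * p + n)" using k by (cases k) auto
  then have "q ^ (k * (2 * p + n)) = q ^ k * q ^ (k * (2 * p + n) - k)"
    by (simp flip: power_add)
  then have "q' ^ k * (q ^ k * (\<iota> (c i * c i) * (- q) ^ k)) =
     q' ^ k * (q ^ k * (\<iota> (c i * qbinom_in \<delta> n k) * (q ^ (k * (2 * p + n) - k) * r)))"
    unfolding final by (simp add: mult_ac)
  then have "\<iota> (c i * qbinom_in \<delta> n k) * (q ^ (k * (2 * p + n) - k) * r) = \<iota> (c i * c i) * (- q) ^ k"
    using q_power_cancel[of k] by (simp add: mult.assoc[symmetric] mult.commute[of "q' ^ k"])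
  with form show ?thesis using that[of r] by (simp add: \<xi>_def)
qed

end

section \<open>A generic killed element\<close>

lemma id_arcs_Suc: "id_arcs (Suc n) = ins n (id_arcs n)"
proof -
  have "(\<lambda>i. (i, 2 * Suc n - 1 - i)) ` {..<n} = map_prod (skip n) (skip n) ` (\<lambda>i. (i, 2 * n - 1 - i)) ` {..<n}"
    unfolding image_image by (intro image_cong) (auto simp: skip_def)
  then show ?thesis
    by (simp add: id_arcs_def ins_def shift_arcs_def lessThan_Suc)
qed

text \<open>In the clasp recursion the identity arises only from the insertion at the middle
  position \<open>n\<close>, which therefore determines the new leading coefficient.\<close>

lemma ins_eq_id_arcs: "ins i U = id_arcs (Suc n) \<longleftrightarrow> i = n \<and> U = id_arcs n"
proof
  assume eq: "ins i U = id_arcs (Suc n)"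
  have "(i, Suc i) \<in> ins i U" by (simp add: ins_def)
  then have "Suc i = 2 * Suc n - 1 - i" "i < Suc n" unfolding eq by (auto simp: id_arcs_def)
  then have "i = n" by simp
  then show "i = n \<and> U = id_arcs n" using eq unfolding id_arcs_Suc by (simp add: inj_eq[OF inj_ins])
qed (simp add: id_arcs_Suc)

lemma Suc_Suc_minus_2: "2 \<le> k \<Longrightarrow> Suc (Suc (k - 2)) = k"
  by simp

context spin
begin

text \<open>A zigzag: the cap at \<open>j\<close> and the cup at \<open>Suc j\<close> form one
  strand, which straightens.\<close>

lemma capf_insf_right: "capf j (insf (Suc j) \<xi>) s = \<xi> s"
proof -
  have "(\<lambda>i. fill j x y s (skip (Suc j) i)) = s(j := x)" for x y
    by (auto simp: fill_def skip_def fun_eq_iff)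
  moreover have "fill j x y s (Suc (Suc j)) = s j" for x y by (simp add: fill_def)
  ultimately show ?thesis
    by (cases "s j") (auto simp: capf_def insf_def fun_upd_idem)
qed

lemma capf_insf_left: "capf (Suc j) (insf j \<xi>) s = \<xi> s"
proof -
  have "(\<lambda>i. fill (Suc j) x y s (skip j i)) = s(j := y)" for x y
    by (auto simp: fill_def skip_def fun_eq_iff)
  then show ?thesis
    by (cases "s j") (auto simp: capf_def insf_def fun_upd_idem)
qed

text \<open>A cap and a cup without common points commute; the shift by 2 accounts for the points
  that the cap removes.\<close>

lemma capf_insf_above:
  assumes "j \<le> i"
  shows "capf j (insf (i + 2) \<xi>) s = insf i (capf j \<xi>) s"
proof -
  have "(\<lambda>k. fill j x y s (skip (i + 2) k)) = fill j x y (\<lambda>k. s (skip i k))" for x y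
    using assms by (auto simp: fill_def skip_def fun_eq_iff Suc_Suc_minus_2)
  moreover have "fill j x y s (i + 2) = s i" "fill j x y s (Suc (i + 2)) = s (Suc i)" for x y
    using assms by (auto simp: fill_def)
  ultimately show ?thesis by (simp add: capf_def insf_def algebra_simps)
qed

lemma capf_insf_below:
  assumes "i \<le> j"
  shows "capf (j + 2) (insf i \<xi>) s = insf i (capf j \<xi>) s"
proof -
  have "(\<lambda>k. fill (j + 2) x y s (skip i k)) = fill j x y (\<lambda>k. s (skip i k))" for x y
  proof
    fix k
    show "fill (j + 2) x y s (skip i k) = fill j x y (\<lambda>k. s (skip i k)) k"
      using assms by (cases "k < i"; cases "k < j"; cases "k = j"; cases "k = Suc j") (auto simp: fill_def skip_def Suc_Suc_minus_2)
  qed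
  moreover have "fill (j + 2) x y s i = s i" "fill (j + 2) x y s (Suc i) = s (Suc i)" for x y
    using assms by (auto simp: fill_def)
  ultimately show ?thesis by (simp add: capf_def insf_def algebra_simps)
qed

text \<open>If cap and cup are apart, they commute and the cap kills \<xi>; the bounds on
  \<open>i\<close> and \<open>j\<close> ensure that it still meets two bottom points of \<xi>. Only
  the circle and the two zigzags survive.\<close>

lemma capf_insf:
  assumes k: "killed n UNIV \<xi>" and i: "i \<le> n" and j: "j < n"
  shows "capf j (insf i \<xi>) s =
    ((if i = j then - (q + q') else 0) + (if i = Suc j then 1 else 0) + (if Suc i = j then 1 else 0)) * \<xi> s"
proof -
  consider "i = j" | "i = Suc j" | "Suc i = j" | i' where "i = i' + 2" "j \<le> i'" | j' where "j = j' + 2" "i \<le> j'"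
    by (metis Suc_leI add_2_eq_Suc' le_Suc_ex less_antisym nat_neq_iff not_less_eq Suc_le_D Suc_le_mono)
  then show ?thesis
  proof cases
    case (4 i')
    then have "capf j \<xi> = (\<lambda>_. 0)" using k i by (auto simp: killed_def fun_eq_iff)
    then show ?thesis using 4 capf_insf_above[OF 4(2), of \<xi> s] by (simp add: insf_def)
  next
    case (5 j')
    then have "capf j' \<xi> = (\<lambda>_. 0)" using k j by (auto simp: killed_def fun_eq_iff)
    then show ?thesis using 5 capf_insf_below[OF 5(2), of \<xi> s] by (simp add: insf_def)
  qed (auto simp: capf_insf_same capf_insf_left capf_insf_right)
qed

lemma capf_sum: "capf j (\<lambda>s. \<Sum>i\<in>A. a i * \<xi> i s) s = (\<Sum>i\<in>A. a i * capf j (\<xi> i) s)"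
  unfolding capf_def right_diff_distrib sum_subtractf sum_distrib_left by (simp add: mult_ac)

text \<open>
  The recursion expresses the single clasp expansion of the Jones--Wenzl projector, scaled by a
  quantum factorial to be integral.
\<close>

lemma generic_killed:
  "\<exists>c. killed n UNIV (comb (nc (2 * n)) (\<lambda>T. T) c) \<and> c (id_arcs n) = ev \<delta> (qfact n)"
proof (induction n)
  case 0
  show ?case by (rule exI[of _ "\<lambda>_. 1"]) (simp add: killed_def qfact_def)
next
  case (Suc n)
  then obtain c where c: "killed n UNIV (comb (nc (2 * n)) (\<lambda>T. T) c)" "c (id_arcs n) = ev \<delta> (qfact n)"
    by blast
  define \<xi> where "\<xi> = comb (nc (2 * n)) (\<lambda>T. T) c"
  \<comment> \<open>Insertion at \<open>i < n\<close> adds an arc on the bottom line, at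
    \<open>i = n\<close> a through strand. The weights \<open>qnum (Suc i)\<close> are chosen so
    that the three surviving terms of a cap at \<open>j\<close> add up to the recursion of quantum
    numbers.\<close>
  define d where "d T = (\<Sum>i<Suc n. \<Sum>U\<in>nc (2 * n). if ins i U = T then ev \<delta> (qnum (Suc i)) * c U else 0)" for T
  have ins: "ins i U \<in> nc (2 * Suc n)" if "U \<in> nc (2 * n)" "i < Suc n" for i U
    using ins_nc[OF that(1), of i] that(2) by simp
  have comb_d: "comb (nc (2 * Suc n)) (\<lambda>T. T) d = (\<lambda>s. \<Sum>i<Suc n. qn (Suc i) * insf i \<xi> s)"
  proof
    fix s
    have "comb (nc (2 * Suc n)) (\<lambda>T. T) d s =
      (\<Sum>T\<in>nc (2 * Suc n). \<Sum>i<Suc n. \<Sum>U\<in>nc (2 * n). if ins i U = T then \<iota> (ev \<delta> (qnum (Suc i)) * c U) * wt T s else 0)"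
      unfolding comb_def d_def \<iota>_sum sum_distrib_right
      by (intro sum.cong refl) auto
    also have "\<dots> = (\<Sum>i<Suc n. \<Sum>U\<in>nc (2 * n). \<Sum>T\<in>nc (2 * Suc n). if ins i U = T then \<iota> (ev \<delta> (qnum (Suc i)) * c U) * wt T s else 0)"
      by (subst sum.swap, rule sum.cong[OF refl], subst sum.swap) simp
    also have "\<dots> = (\<Sum>i<Suc n. \<Sum>U\<in>nc (2 * n). \<iota> (ev \<delta> (qnum (Suc i)) * c U) * wt (ins i U) s)"
      by (intro sum.cong refl) (use ins in \<open>simp add: sum.delta finite_nc\<close>)
    also have "\<dots> = (\<Sum>i<Suc n. \<Sum>U\<in>nc (2 * n). qn (Suc i) * (\<iota> (c U) * (kap (s i) (s (Suc i)) * wt U (\<lambda>k. s (skip i k)))))"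
      by (intro sum.cong refl)
        (simp add: wt_ins nc_finite insf_def mult.commute[of _ "c _"] mult_ac flip: \<iota>_ev)
    also have "\<dots> = (\<Sum>i<Suc n. qn (Suc i) * insf i \<xi> s)"
      unfolding insf_def \<xi>_def comb_def sum_distrib_left by (simp add: mult_ac)
    finally show "comb (nc (2 * Suc n)) (\<lambda>T. T) d s = (\<Sum>i<Suc n. qn (Suc i) * insf i \<xi> s)" .
  qed
  have "capf j (comb (nc (2 * Suc n)) (\<lambda>T. T) d) s = 0" if j: "j < n" for j s
  proof -
    have "capf j (comb (nc (2 * Suc n)) (\<lambda>T. T) d) s = (\<Sum>i<Suc n. qn (Suc i) * capf j (insf i \<xi>) s)"
      unfolding comb_d by (rule capf_sum)
    also have "\<dots> = (\<Sum>i<Suc n. (if i = j then - (q + q') * qn (Suc j) * \<xi> s else 0) +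
      ((if i = Suc j then qn (Suc (Suc j)) * \<xi> s else 0) + (if Suc i = j then qn j * \<xi> s else 0)))"
      by (intro sum.cong refl) (use capf_insf[OF c(1)[folded \<xi>_def] _ j] in \<open>auto simp: mult_ac simp del: qnum.simps\<close>)
    also have "\<dots> = - (q + q') * qn (Suc j) * \<xi> s + (qn (Suc (Suc j)) * \<xi> s + qn j * \<xi> s)"
    proof -
      \<comment> \<open>For \<open>j = 0\<close> there is no such term, in agreement with
        \<open>qn 0 = 0\<close>.\<close>
      have "(\<Sum>i<Suc n. if Suc i = j then qn j * \<xi> s else 0) = qn j * \<xi> s"
        using j by (cases j) (auto simp: sum.delta)
      then show ?thesis using j by (simp only: sum.distrib) (simp add: sum.delta del: qnum.simps)
    qed
    also have "\<dots> = 0" unfolding qn_rec by (simp add: algebra_simps)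
    finally show ?thesis .
  qed
  then have "killed (Suc n) UNIV (comb (nc (2 * Suc n)) (\<lambda>T. T) d)" by (simp add: killed_def)
  moreover have "d (id_arcs (Suc n)) = ev \<delta> (qfact (Suc n))"
  proof -
    have "d (id_arcs (Suc n)) = (\<Sum>i<Suc n. if i = n then ev \<delta> (qnum (Suc i)) * c (id_arcs n) else 0)"
      unfolding d_def ins_eq_id_arcs using id_arcs_nc[of n]
      by (intro sum.cong refl) (auto simp: sum.delta' finite_nc)
    also have "\<dots> = ev \<delta> (qfact (Suc n))"
      by (simp add: c(2) qfact_Suc ev_mult del: qnum.simps)
    finally show ?thesis .
  qed
  ultimately show ?case by blast
qed

section \<open>Divisibility of the coefficients of a killed element on an uncoloured strip\<close>

lemma tame_nc: "tame N UNIV (nc (2 * N)) (\<lambda>T. T)"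
proof -
  have "\<exists>j. Suc j < N \<and> (2 * N - 2 - j, 2 * N - 1 - j) \<in> T"
    if T: "T \<in> nc (2 * N)" "T \<noteq> id_arcs N" for T
  proof -
    obtain i where i: "N \<le> i" "Suc i < 2 * N" "(i, Suc i) \<in> T" using nc_top_arc[OF T] by blast
    have "2 * N - 2 - (2 * N - 2 - i) = i" "2 * N - 1 - (2 * N - 2 - i) = Suc i" "Suc (2 * N - 2 - i) < N"
      using i by auto
    then show ?thesis using i(3) by metis
  qed
  then show ?thesis using nc_bottom_arc by (auto simp: tame_def finite_nc)
qed

text \<open>Every arc has exactly one negative end, so \<open>N\<close> of the \<open>2 * N\<close>
  signs are negative; on the top line, by the reversal, these are the points outside
  \<open>B\<close>.\<close>

lemma wt_balanced:
  assumes T: "T \<in> nc (2 * N)" and A: "A \<subseteq> {..<N}" and B: "B \<subseteq> {..<N}" and "wt T (st N A B) \<noteq> 0"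
  shows "card A = card B"
proof -
  define g :: "nat \<Rightarrow> nat" where "g i = (if st N A B i then 1 else 0)" for i
  have fin: "finite A" "finite B" using A B finite_subset by auto
  have "(\<Sum>i<2 * N. g i) = (\<Sum>(a, b)\<in>T. g a + g b)" by (rule sum_arcs[OF T])
  also have "\<dots> = (\<Sum>(a, b)\<in>T. 1)"
    using wt_nonzero[OF nc_finite[OF T] assms(4)] by (intro sum.cong) (auto simp: g_def)
  finally have "(\<Sum>i<2 * N. g i) = N" using card_nc[OF T] by (simp add: case_prod_beta)
  moreover have "(\<Sum>i<2 * N. g i) = (\<Sum>i<N. g i) + (\<Sum>i<N. g (2 * N - 1 - i))"
  proof -
    have "{..<2 * N} = {..<N} \<union> {N..<2 * N}" by auto
    then have "(\<Sum>i<2 * N. g i) = (\<Sum>i<N. g i) + sum g {N..<2 * N}"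
      by (simp add: sum.union_disjoint ivl_disj_int)
    also have "sum g {N..<2 * N} = (\<Sum>i<N. g (2 * N - 1 - i))"
      by (rule sum.reindex_bij_witness[of _ "\<lambda>i. 2 * N - 1 - i" "\<lambda>i. 2 * N - 1 - i"]) auto
    finally show ?thesis .
  qed
  moreover have "(\<Sum>i<N. g i) = card A"
  proof -
    have "(\<Sum>i<N. g i) = (\<Sum>i<N. if i \<in> A then 1 else 0)"
      by (intro sum.cong) (auto simp: g_def st_def)
    also have "\<dots> = card A" using A by (simp add: sum.If_cases Int_absorb1)
    finally show ?thesis .
  qed
  moreover have "(\<Sum>i<N. g (2 * N - 1 - i)) + card B = N"
  proof -
    have "(\<Sum>i<N. g (2 * N - 1 - i)) = (\<Sum>i<N. if i \<in> B then 0 else 1)"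
      by (intro sum.cong) (auto simp: g_def st_def)
    also have "\<dots> = card ({..<N} - B)" by (simp add: sum.If_cases Diff_eq)
    finally show ?thesis using B fin card_mono[OF _ B] by (simp add: card_Diff_subset)
  qed
  ultimately show ?thesis by simp
qed

text \<open>The values of weight \<open>l\<close> are controlled by the binomial of that weight
  through \<open>killed_block\<close>; the product of all binomials serves every weight at once, and
  unitriangularity passes from values to coefficients. The extra factor \<open>a\<close> on both
  sides stays, as it need not be cancellable here.\<close>

lemma generic_denominators:
  assumes k: "killed N UNIV (comb (nc (2 * N)) (\<lambda>T. T) c)" and T: "T \<in> nc (2 * N)"
  defines "a \<equiv> c (id_arcs N)"
  shows "\<exists>b. (\<Prod>k\<le>N. qbinom_in \<delta> N k) * a * c T = a * a * b"
proof -
  define L where "L = (\<Prod>k\<le>N. qbinom_in \<delta> N k)"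
  \<comment> \<open>The elements that \<open>\<iota> (L * a)\<close> multiplies into the ideal
    generated by \<open>\<iota> (a * a)\<close>; an ideal of the extension, as
    \<open>wt_coefficients\<close> requires.\<close>
  define I where "I = {r. \<exists>r'. \<iota> (L * a) * r = \<iota> (a * a) * r'}"
  have I0: "0 \<in> I" by (auto simp: I_def intro: exI[of _ 0])
  have val: "comb (nc (2 * N)) (\<lambda>T. T) c (st N A B) \<in> I" if A: "A \<subseteq> {..<N}" and B: "B \<subseteq> {..<N}" for A B
  proof (cases "card A = card B")
    case False
    then have "wt T (st N A B) = 0" if "T \<in> nc (2 * N)" for T
      using wt_balanced[OF that A B] by blast
    then have "comb (nc (2 * N)) (\<lambda>T. T) c (st N A B) = 0"
      by (simp add: comb_def)
    then show ?thesis using I0 by simp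
  next
    case True
    define l where "l = card A"
    have l: "l \<le> N" using card_mono[OF _ A] by (simp add: l_def)
    have AB: "A \<in> subsets_of 0 N l" "B \<in> subsets_of 0 N l"
      using A B True by (auto simp: subsets_of_def l_def)
    define \<xi> where "\<xi> = comb (nc (2 * N)) (\<lambda>T. T) c"
    obtain r m where r: "\<iota> a * \<xi> (st N A B) = \<iota> a * (q ^ (\<Sum>A + \<Sum>B) * r)"
      "\<iota> (a * qbinom_in \<delta> N l) * (q ^ m * r) = \<iota> (a * a) * (- q) ^ l"
      by (rule killed_block[OF tame_nc id_arcs_nc refl k, of 0 N l]) (use AB l in \<open>auto simp: a_def \<xi>_def\<close>)
    define L' where "L' = (\<Prod>k\<in>{..N} - {l}. qbinom_in \<delta> N k)"
    have L: "L = qbinom_in \<delta> N l * L'" unfolding L_def L'_def using l by (intro prod.remove) auto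
    have "\<iota> (L * a) * \<xi> (st N A B) = \<iota> (L * a) * (q ^ (\<Sum>A + \<Sum>B) * r)"
      unfolding \<iota>_mult mult.assoc r(1) ..
    also have "\<dots> = \<iota> (L * a) * (q ^ (\<Sum>A + \<Sum>B) * (q ^ m * q' ^ m * r))"
      by (simp add: q_power_cancel)
    also have "\<dots> = \<iota> L' * (\<iota> (a * qbinom_in \<delta> N l) * (q ^ m * r)) * (q ^ (\<Sum>A + \<Sum>B) * q' ^ m)"
      by (simp add: L \<iota>_mult mult_ac)
    also have "\<dots> = \<iota> (a * a) * (\<iota> L' * (- q) ^ l * (q ^ (\<Sum>A + \<Sum>B) * q' ^ m))"
      unfolding r(2) by (simp only: mult_ac)
    finally show ?thesis unfolding I_def \<xi>_def by blast
  qed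
  have "\<iota> (c T) \<in> I"
  proof (rule wt_coefficients[OF finite_nc, of "2 * N" "\<lambda>T. T" "2 * N" I "\<lambda>T. \<iota> (c T)"])
    show "(\<Sum>T\<in>nc (2 * N). \<iota> (c T) * wt T s) \<in> I" for s
    proof -
      obtain A B where AB: "A \<subseteq> {..<N}" "B \<subseteq> {..<N}" "\<And>T. T \<in> nc (2 * N) \<Longrightarrow> wt T s = wt T (st N A B)"
        using wt_st[OF T] by blast
      then have "(\<Sum>T\<in>nc (2 * N). \<iota> (c T) * wt T s) = comb (nc (2 * N)) (\<lambda>T. T) c (st N A B)"
        by (simp add: comb_def)
      then show ?thesis using val[OF AB(1,2)] by simp
    qed
    show "r - s \<in> I" if "r \<in> I" "s \<in> I" for r s
      using that unfolding I_def by (auto simp: right_diff_distrib) (metis right_diff_distrib)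
    show "r * s \<in> I" if "r \<in> I" for r s
      using that unfolding I_def by (auto simp: mult.assoc[symmetric]) (metis mult.assoc)
  qed (use I0 T in auto)
  then obtain r where "\<iota> (L * a) * \<iota> (c T) = \<iota> (a * a) * r" by (auto simp: I_def)
  \<comment> \<open>The cofactor \<open>r\<close> lies in the extension; \<rho> is linear over the
    ground ring and brings it back.\<close>
  then have "\<rho> (\<iota> (L * a) * \<iota> (c T)) = \<rho> (\<iota> (a * a) * r)" by simp
  then have "L * a * c T = a * a * \<rho> r" by (simp only: \<rho>_mult \<rho>_\<iota>)
  then show ?thesis unfolding L_def by blast
qed

end

section \<open>Diagrams as matchings of the boundary points\<close>

text \<open>The inverse of \<open>position\<close> for a strip with \<open>m\<close> bottom and
  \<open>k\<close> top points.\<close>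

definition pt :: "nat \<Rightarrow> nat \<Rightarrow> nat \<Rightarrow> point" where
  "pt m k a = (if a < m then Bot a else Top (m + k - 1 - a))"

definition diag_of :: "'c list \<Rightarrow> 'c list \<Rightarrow> (nat \<times> nat) set \<Rightarrow> 'c diagram" where
  "diag_of x y T = Diagram x y
     ((\<lambda>(a, b). {pt (length x - 1) (length y - 1) a, pt (length x - 1) (length y - 1) b}) ` T)"

definition arcs :: "'c diagram \<Rightarrow> (nat \<times> nat) set" where
  "arcs D = {(position D p, position D r) |p r. {p, r} \<in> strands D \<and> position D p < position D r}"

abbreviation npoints :: "'c diagram \<Rightarrow> nat" where
  "npoints D \<equiv> (length (lower D) - 1) + (length (upper D) - 1)"

lemma lower_diag_of [simp]: "lower (diag_of x y T) = x"
  and upper_diag_of [simp]: "upper (diag_of x y T) = y"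
  by (simp_all add: diag_of_def)

lemma pt_position: "p \<in> points D \<Longrightarrow> pt (length (lower D) - 1) (length (upper D) - 1) (position D p) = p"
  by (cases p) (auto simp: points_def pt_def)

lemma position_pt: "a < npoints D \<Longrightarrow> position D (pt (length (lower D) - 1) (length (upper D) - 1) a) = a"
  by (auto simp: pt_def)

lemma position_less: "p \<in> points D \<Longrightarrow> position D p < npoints D"
  by (cases p) (auto simp: points_def)

lemma pt_in_points: "a < npoints D \<Longrightarrow> pt (length (lower D) - 1) (length (upper D) - 1) a \<in> points D"
  by (auto simp: pt_def points_def)

lemma position_eq_iff: "p \<in> points D \<Longrightarrow> r \<in> points D \<Longrightarrow> position D p = position D r \<longleftrightarrow> p = r"
  by (metis pt_position)

lemma matching_strand:
  assumes "matching D" "e \<in> strands D"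
  obtains p r where "e = {p, r}" "p \<in> points D" "r \<in> points D" "position D p < position D r"
proof -
  have "e \<subseteq> points D" "card e = 2" using assms by (auto simp: matching_def)
  then obtain p r where e: "e = {p, r}" "p \<noteq> r" by (auto simp: card_2_iff)
  then have pr: "p \<in> points D" "r \<in> points D" using \<open>e \<subseteq> points D\<close> by auto
  then have "position D p \<noteq> position D r" using e by (simp add: position_eq_iff)
  then consider "position D p < position D r" | "position D r < position D p" by linarith
  then show ?thesis
    by cases (use that[of p r] that[of r p] e pr in \<open>auto simp: insert_commute\<close>)
qed

lemma diag_of_arcs:
  assumes "matching D"
  shows "diag_of (lower D) (upper D) (arcs D) = D"
proof -
  define f where "f = pt (length (lower D) - 1) (length (upper D) - 1)"
  have f: "f (position D p) = p" if "p \<in> points D" for p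
    unfolding f_def by (rule pt_position[OF that])
  have "(\<lambda>(a, b). {f a, f b}) ` arcs D = strands D"
  proof (intro equalityI subsetI)
    fix e assume "e \<in> (\<lambda>(a, b). {f a, f b}) ` arcs D"
    then obtain p r where e: "e = {f (position D p), f (position D r)}" "{p, r} \<in> strands D"
      by (auto simp: arcs_def)
    then have "p \<in> points D" "r \<in> points D" using assms unfolding matching_def by blast+
    then show "e \<in> strands D" using e by (simp add: f)
  next
    fix e assume "e \<in> strands D"
    then obtain p r where e: "e = {p, r}" "p \<in> points D" "r \<in> points D" "position D p < position D r"
      using matching_strand[OF assms] by metis
    then have "(position D p, position D r) \<in> arcs D" using \<open>e \<in> strands D\<close> by (auto simp: arcs_def)
    moreover have "e = {f (position D p), f (position D r)}" using e by (simp add: f)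
    ultimately show "e \<in> (\<lambda>(a, b). {f a, f b}) ` arcs D" by force
  qed
  then show ?thesis by (cases D) (simp add: diag_of_def f_def)
qed

lemma arcs_nc:
  assumes D: "matching D" "crossingless D"
  shows "arcs D \<in> nc (npoints D)"
proof -
  have less: "a < b \<and> b < npoints D" if "(a, b) \<in> arcs D" for a b
    using that D(1) position_less[of _ D] by (fastforce simp: arcs_def matching_def)
  moreover have "compat e f" if "e \<in> arcs D" "f \<in> arcs D" "e \<noteq> f" for e f
  proof -
    from that obtain p r s t where e: "e = (position D p, position D r)" "{p, r} \<in> strands D"
      "position D p < position D r"
      and f: "f = (position D s, position D t)" "{s, t} \<in> strands D" "position D s < position D t"
      by (auto simp: arcs_def)
    have pts: "p \<in> points D" "r \<in> points D" "s \<in> points D" "t \<in> points D"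
      using D e f by (auto simp: matching_def)
    have "{p, r} \<noteq> {s, t}"
      using that e f by (auto simp: doubleton_eq_iff)
    then have "{p, r} \<inter> {s, t} = {}" using D(1) e(2) f(2) pts unfolding matching_def by blast
    then have "position D p \<noteq> position D s" "position D p \<noteq> position D t"
      "position D r \<noteq> position D s" "position D r \<noteq> position D t"
      using pts by (auto simp: position_eq_iff)
    moreover have "\<not> (position D p < position D s \<and> position D s < position D r \<and> position D r < position D t)"
      "\<not> (position D s < position D p \<and> position D p < position D t \<and> position D t < position D r)"
      using D(2) e(2) f(2) unfolding crossingless_def by blast+
    ultimately show ?thesis using e f by auto
  qed
  moreover have "\<exists>a b. (a, b) \<in> arcs D \<and> (i = a \<or> i = b)" if i: "i < npoints D" for i
  proof -
    define p where "p = pt (length (lower D) - 1) (length (upper D) - 1) i"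
    have "p \<in> points D" unfolding p_def by (rule pt_in_points[OF i])
    then obtain e where e: "e \<in> strands D" "p \<in> e" using D(1) by (auto simp: matching_def)
    then obtain s t where st: "e = {s, t}" "position D s < position D t"
      using matching_strand[OF D(1) e(1)] by metis
    then have "(position D s, position D t) \<in> arcs D" using e by (auto simp: arcs_def)
    moreover have "i = position D p" unfolding p_def by (rule position_pt[OF i, symmetric])
    ultimately show ?thesis using e st by auto
  qed
  ultimately show ?thesis by (auto simp: nc_def)
qed

section \<open>Diagrams rebuilt from noncrossing matchings of positions\<close>

context
  fixes x y :: "'c list" and T M m k
  assumes T: "T \<in> nc M" and m: "m = length x - 1" and k: "k = length y - 1" and M: "M = m + k"
begin

private abbreviation "D \<equiv> diag_of x y T"

private lemma pos_pt: "a < M \<Longrightarrow> position D (pt m k a) = a"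
  using position_pt[of a D] by (simp add: m k M)

private lemma strands_D: "strands D = (\<lambda>(a, b). {pt m k a, pt m k b}) ` T"
  by (simp add: diag_of_def m k)

lemma strands_diag_of_iff:
  assumes "p \<in> points D" "r \<in> points D"
  shows "{p, r} \<in> strands D \<longleftrightarrow> linked T (position D p) (position D r)"
proof
  assume "{p, r} \<in> strands D"
  then obtain a b where ab: "(a, b) \<in> T" "{p, r} = {pt m k a, pt m k b}" by (auto simp: strands_D)
  then have "a < M" "b < M" using nc_less[OF T ab(1)] by auto
  then have "position D p = a \<and> position D r = b \<or> position D p = b \<and> position D r = a"
    using ab(2) pos_pt by (auto simp: doubleton_eq_iff)
  then show "linked T (position D p) (position D r)" using ab by (auto simp: linked_def)
next
  assume "linked T (position D p) (position D r)"
  moreover have arc: "{pt m k a, pt m k b} \<in> strands D" if "(a, b) \<in> T" for a b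
    unfolding strands_D using that by (rule rev_image_eqI) simp
  moreover have "pt m k (position D p) = p" "pt m k (position D r) = r"
    using pt_position[of _ D] assms by (simp_all add: m k)
  ultimately show "{p, r} \<in> strands D"
    using arc[of "position D p" "position D r"] arc[of "position D r" "position D p"]
    unfolding linked_def by (simp only: insert_commute) blast
qed

lemma arcs_diag_of: "arcs D = T"
proof (intro equalityI subsetI)
  fix e assume "e \<in> arcs D"
  then obtain p r where e: "e = (position D p, position D r)" "{p, r} \<in> strands D" "position D p < position D r"
    by (auto simp: arcs_def)
  from e(2) obtain a b where ab: "(a, b) \<in> T" "{p, r} = {pt m k a, pt m k b}" by (auto simp: strands_D)
  then have "a < b" "b < M" using nc_less[OF T ab(1)] by auto
  then show "e \<in> T" using e ab pos_pt by (auto simp: doubleton_eq_iff)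
next
  fix e assume e: "e \<in> T"
  obtain a b where ab: "e = (a, b)" by force
  have "a < b" "b < M" using nc_less[OF T] e ab by auto
  then have "position D (pt m k a) = a" "position D (pt m k b) = b" using pos_pt by auto
  moreover have "{pt m k a, pt m k b} \<in> strands D"
    unfolding strands_D using e ab by (auto intro: rev_image_eqI)
  ultimately show "e \<in> arcs D" using \<open>a < b\<close> unfolding arcs_def ab by force
qed

lemma matching_diag_of: "matching D"
proof -
  have pts: "pt m k a \<in> points D" if "a < M" for a
    using pt_in_points[of a D] that by (simp add: m k M)
  have inj: "pt m k a = pt m k b \<longleftrightarrow> a = b" if "a < M" "b < M" for a b
    using pos_pt that by metis
  have "e \<subseteq> points D \<and> card e = 2" if e: "e \<in> strands D" for e
  proof -
    obtain a b where ab: "(a, b) \<in> T" "e = {pt m k a, pt m k b}" using e by (auto simp: strands_D)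
    have "a < b" "a < M" "b < M" using nc_less[OF T ab(1)] by auto
    then show ?thesis using pts inj[of a b] ab by auto
  qed
  moreover have "\<exists>!e. e \<in> strands D \<and> p \<in> e" if p: "p \<in> points D" for p
  proof -
    have p': "p = pt m k (position D p)" "position D p < M"
      using pt_position[OF p] position_less[OF p] by (simp_all add: m k M)
    define i where "i = position D p"
    obtain l where l: "linked T i l" using nc_linked[OF T p'(2)] unfolding i_def by blast
    have arc: "{pt m k a, pt m k b} \<in> strands D" if "(a, b) \<in> T" for a b
      unfolding strands_D using that by (rule rev_image_eqI) simp
    have "{pt m k i, pt m k l} \<in> strands D"
      using l arc[of i l] arc[of l i] by (auto simp: linked_def insert_commute)
    moreover have "e = {pt m k i, pt m k l}" if e: "e \<in> strands D" "p \<in> e" for e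
    proof -
      obtain a b where ab: "(a, b) \<in> T" "e = {pt m k a, pt m k b}" using e by (auto simp: strands_D)
      have "a < M" "b < M" using nc_less[OF T ab(1)] by auto
      then have "i = a \<or> i = b" using e(2) ab(2) p' inj by (auto simp: i_def)
      then show ?thesis
      proof
        assume "i = a"
        then have "b = l" using linked_unique[OF T l, of b] ab(1) by (auto simp: linked_def)
        then show ?thesis using ab \<open>i = a\<close> by simp
      next
        assume "i = b"
        then have "a = l" using linked_unique[OF T l, of a] ab(1) by (auto simp: linked_def)
        then show ?thesis using ab \<open>i = b\<close> by (simp add: insert_commute)
      qed
    qed
    ultimately show ?thesis using p'(1) unfolding i_def by blast
  qed
  ultimately show ?thesis by (auto simp: matching_def)
qed

lemma crossingless_diag_of: "crossingless D"
  unfolding crossingless_def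
proof (safe, goal_cases)
  case (1 a b c d)
  have "(position D a, position D b) \<in> arcs D" "(position D c, position D d) \<in> arcs D"
    using 1 unfolding arcs_def by force+
  then show ?case unfolding arcs_diag_of using nc_compat[OF T, of "position D a" "position D b" "position D c" "position D d"] 1 by auto
qed

end

lemma id_diagram_eq: "id_diagram x = diag_of x x (id_arcs (length x - 1))"
proof -
  define n where "n = length x - 1"
  have "{{Bot i, Top i} |i. i < n} = (\<lambda>i. {pt n n i, pt n n (2 * n - 1 - i)}) ` {..<n}"
  proof -
    have "pt n n i = Bot i" "pt n n (2 * n - 1 - i) = Top i" if "i < n" for i
      using that by (auto simp: pt_def)
    then show ?thesis by (auto simp: image_iff Bex_def)
  qed
  then show ?thesis
    unfolding id_diagram_def diag_of_def id_arcs_def image_image n_def by simp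
qed

subsection \<open>Colours\<close>

text \<open>The intervals \<open>a\<close> and \<open>Suc b\<close> touch the arc from outside,
  \<open>Suc a\<close> and \<open>b\<close> from inside. This is a condition on single arcs that can
  replace the condition on regions in \<open>colored_matching\<close>.\<close>

definition arcs_colored :: "'c list \<Rightarrow> (nat \<times> nat) set \<Rightarrow> bool" where
  "arcs_colored bc T \<longleftrightarrow> (\<forall>(a, b)\<in>T. bc ! a = bc ! Suc b \<and> bc ! Suc a = bc ! b)"

lemma same_region_arcs:
  "same_region D p r \<longleftrightarrow> (\<forall>(a, b)\<in>arcs D. p \<in> {a<..b} \<longleftrightarrow> r \<in> {a<..b})"
  unfolding same_region_def arcs_def by blast

text \<open>Walk from \<open>p\<close> to the right. If point \<open>p\<close> opens an arc, jump
  over it to the interval \<open>Suc b\<close>, which has the same colour and lies in the same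
  region; if it closes an arc, that arc would separate \<open>p\<close> from
  \<open>r\<close>.\<close>

lemma same_region_colored:
  assumes D: "arcs D \<in> nc M" and col: "arcs_colored bc (arcs D)"
    and "same_region D p r" "p \<le> r" "r \<le> M"
  shows "bc ! p = bc ! r"
  using assms(3-5)
proof (induction "r - p" arbitrary: p rule: less_induct)
  case less
  show ?case
  proof (cases "p = r")
    case False
    then have p: "p < r" "p < M" using less.prems by auto
    then obtain b where b: "linked (arcs D) p b" using nc_linked[OF D] by blast
    show ?thesis
    proof (cases "(p, b) \<in> arcs D")
      case True
      have "p < b" using nc_less[OF D True] by simp
      have "p \<notin> {p<..b}" by simp
      then have "r \<notin> {p<..b}" using less.prems(1) True unfolding same_region_arcs by blast
      then have "Suc b \<le> r" using p by simp
      have "same_region D (Suc b) r" unfolding same_region_arcs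
      proof safe
        fix c d i assume cd: "(c, d) \<in> arcs D"
        have "p \<in> {c<..d} \<longleftrightarrow> Suc b \<in> {c<..d}"
          using nc_compat[OF D True cd] nc_less[OF D cd] \<open>p < b\<close> by auto
        moreover have "p \<in> {c<..d} \<longleftrightarrow> r \<in> {c<..d}" using less.prems(1) cd unfolding same_region_arcs by blast
        ultimately show "Suc b \<in> {c<..d} \<Longrightarrow> r \<in> {c<..d}" "r \<in> {c<..d} \<Longrightarrow> Suc b \<in> {c<..d}" by blast+
      qed
      then have "bc ! Suc b = bc ! r"
        using less.hyps[of "Suc b"] \<open>Suc b \<le> r\<close> \<open>p < b\<close> less.prems by simp
      then show ?thesis using col True by (auto simp: arcs_colored_def)
    next
      case False
      then have b: "(b, p) \<in> arcs D" using b by (auto simp: linked_def)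
      then have "p \<in> {b<..p}" using nc_less[OF D b] by simp
      then have "r \<in> {b<..p}" using less.prems(1) b unfolding same_region_arcs by blast
      then show ?thesis using p by simp
    qed
  qed simp
qed

lemma same_region_sym: "same_region D p r \<longleftrightarrow> same_region D r p"
  unfolding same_region_def by blast

lemma length_boundary_colors:
  "lower D \<noteq> [] \<Longrightarrow> length (boundary_colors D) = Suc (npoints D)"
  by (simp add: boundary_colors_def)

lemma colored_matching_iff:
  "colored_matching S D \<longleftrightarrow> one_morphism S (lower D) \<and> one_morphism S (upper D) \<and>
     hd (lower D) = hd (upper D) \<and> last (lower D) = last (upper D) \<and>
     matching D \<and> crossingless D \<and> arcs_colored (boundary_colors D) (arcs D)"
proof -
  have "(\<forall>p < length (boundary_colors D). \<forall>q < length (boundary_colors D).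
        same_region D p q \<longrightarrow> boundary_colors D ! p = boundary_colors D ! q) \<longleftrightarrow>
      arcs_colored (boundary_colors D) (arcs D)" (is "?L \<longleftrightarrow> ?R")
    if D: "matching D" "crossingless D" and "one_morphism S (lower D)"
  proof
    have len: "length (boundary_colors D) = Suc (npoints D)"
      using that by (intro length_boundary_colors) (simp add: one_morphism_def)
    have nc: "arcs D \<in> nc (npoints D)" by (rule arcs_nc[OF D])
    show ?R if L: ?L
      unfolding arcs_colored_def
    proof safe
      fix a b assume ab: "(a, b) \<in> arcs D"
      have less: "a < b" "b < npoints D" using nc_less[OF nc ab] by auto
      have "same_region D a (Suc b)" unfolding same_region_arcs
        using nc_compat[OF nc ab] nc_less[OF nc] less by fastforce
      then show "boundary_colors D ! a = boundary_colors D ! Suc b" using L less len by simp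
      have "same_region D (Suc a) b" unfolding same_region_arcs
        using nc_compat[OF nc ab] nc_less[OF nc] less by fastforce
      then show "boundary_colors D ! Suc a = boundary_colors D ! b" using L less len by simp
    qed
    show ?L if R: ?R
      using same_region_colored[OF nc R] same_region_sym[of D] unfolding len
      by (metis less_Suc_eq_le nat_le_linear)
  qed
  then show ?thesis unfolding colored_matching_def by blast
qed

lemma boundary_colors_lower: "i < length (lower D) \<Longrightarrow> boundary_colors D ! i = lower D ! i"
  by (simp add: boundary_colors_def nth_append)

lemma boundary_colors_upper:
  assumes "lower D \<noteq> []" "upper D \<noteq> []" "last (lower D) = last (upper D)" "i < length (upper D)"
  shows "boundary_colors D ! (npoints D - i) = upper D ! i"
proof (cases "i = length (upper D) - 1")
  \<comment> \<open>The rightmost region is listed only once in \<open>boundary_colors\<close>, as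
    the last entry of \<open>lower D\<close>; here the equality of the last colours enters.\<close>
  case True
  then show ?thesis using assms by (simp add: boundary_colors_def nth_append last_conv_nth)
next
  case False
  define l where "l = length (upper D) - 2 - i"
  have "npoints D - i = length (lower D) + l" using False assms by (cases "lower D") (auto simp: l_def)
  moreover have "tl (rev (upper D)) ! l = upper D ! i"
    using assms False by (simp add: nth_tl rev_nth l_def Suc_diff_Suc)
  ultimately show ?thesis by (simp add: boundary_colors_def nth_append)
qed

section \<open>Composition with a cup\<close>

text \<open>Normal form of the diagrams in \<open>cups_into\<close>: the cup ends at the top points
  \<open>j\<close> and \<open>Suc j\<close>, and the source word lacks the colours with indices
  \<open>j + 1\<close> and \<open>j + 2\<close>.\<close>

definition cup_at :: "'c list \<Rightarrow> nat \<Rightarrow> 'c diagram" where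
  "cup_at x j = Diagram (take (Suc j) x @ drop (j + 3) x) x
     (insert {Top j, Top (Suc j)} ((\<lambda>i. {Bot i, Top (skip j i)}) ` {..<length x - 3}))"

lemma cups_into_eq:
  "cups_into x = {cup_at x j |j. j + 2 < length x \<and> x ! j = x ! (j + 2)}"
proof -
  have cup: "hcomp_diagram (id_diagram (u @ [b])) (hcomp_diagram (cup b r) (id_diagram (b # v))) =
      cup_at (u @ [b, r, b] @ v) (length u)" for u b r and v :: "'c list"
  proof -
    have img: "{f i |i. i < n} = f ` {..<n}" for f :: "nat \<Rightarrow> point set" and n by auto
    have "(\<lambda>i. {Bot i, Top i}) ` {..<length u} \<union>
      insert {Top (length u), Top (Suc (length u))} ((\<lambda>i. {Bot (length u + i), Top (length u + (2 + i))}) ` {..<length v}) =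
      insert {Top (length u), Top (Suc (length u))} ((\<lambda>i. {Bot i, Top (skip (length u) i)}) ` {..<length u + length v})"
      (is "?A \<union> insert ?e ?B = insert ?e (?f ` ?C)")
    proof -
      have "?C = {..<length u} \<union> (\<lambda>i. length u + i) ` {..<length v}"
      proof -
        have "i \<in> (\<lambda>i. length u + i) ` {..<length v}" if "length u \<le> i" "i < length u + length v" for i
          using that by (intro image_eqI[of _ _ "i - length u"]) auto
        then have "?C \<subseteq> {..<length u} \<union> (\<lambda>i. length u + i) ` {..<length v}"
          by (meson UnI1 UnI2 lessThan_iff not_less subsetI)
        then show ?thesis by auto
      qed
      then have "?f ` ?C = ?f ` {..<length u} \<union> (\<lambda>i. ?f (length u + i)) ` {..<length v}"
        by (simp only: image_Un image_image)
      moreover have "?f ` {..<length u} = ?A" by (auto simp: skip_def)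
      moreover have "(\<lambda>i. ?f (length u + i)) ` {..<length v} = ?B" by (auto simp: skip_def)
      ultimately show ?thesis by (simp only: Un_insert_right)
    qed
    moreover have "strands (hcomp_diagram (id_diagram (u @ [b])) (hcomp_diagram (cup b r) (id_diagram (b # v)))) =
      ?A \<union> insert ?e ?B"
      unfolding hcomp_diagram_def id_diagram_def cup_def img
      by (simp add: image_Un image_image)
    ultimately show ?thesis
      by (simp add: hcomp_diagram_def id_diagram_def cup_def comp1_def cup_at_def)
  qed
  show ?thesis
  proof (intro equalityI subsetI)
    fix c assume "c \<in> cups_into x"
    then obtain u b r v where "x = u @ [b, r, b] @ v"
      "c = hcomp_diagram (id_diagram (u @ [b])) (hcomp_diagram (cup b r) (id_diagram (b # v)))"
      by (auto simp: cups_into_def)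
    then show "c \<in> {cup_at x j |j. j + 2 < length x \<and> x ! j = x ! (j + 2)}"
      unfolding cup by (intro CollectI exI[of _ "length u"]) (simp add: nth_append)
  next
    fix c assume "c \<in> {cup_at x j |j. j + 2 < length x \<and> x ! j = x ! (j + 2)}"
    then obtain j where j: "c = cup_at x j" "j + 2 < length x" "x ! j = x ! (j + 2)" by blast
    have "drop j x = x ! j # x ! Suc j # x ! Suc (Suc j) # drop (j + 3) x"
      using j(2) by (simp add: Cons_nth_drop_Suc eval_nat_numeral)
    then have x: "x = take j x @ [x ! j, x ! Suc j, x ! j] @ drop (j + 3) x"
      using j(3) append_take_drop_id[of j x] by simp
    moreover have "length (take j x) = j" using j(2) by simp
    ultimately show "c \<in> cups_into x" unfolding cups_into_def
      using cup[of "take j x" "x ! j" "x ! Suc j" "drop (j + 3) x"] j(1) by force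
  qed
qed

section \<open>Connected components of the picture in which a diagram is stacked on a cup\<close>

context
  fixes x :: "'c list" and T N j
  assumes T: "T \<in> nc (2 * N)" and N: "N = length x - 1" and j: "Suc j < N"
begin

private definition edge :: "vertex \<Rightarrow> vertex \<Rightarrow> bool" where
  "edge v w \<longleftrightarrow> {v, w} \<in> stacked (diag_of x x T) (cup_at x j)"

private fun valid :: "vertex \<Rightarrow> bool" where
  "valid (Low i) \<longleftrightarrow> i < N - 2"
| "valid (Mid i) \<longleftrightarrow> i < N"
| "valid (High i) \<longleftrightarrow> i < N"

text \<open>Collapses the three lines to the boundary positions of \<open>T\<close>: a point of the
  lowest line is identified with the middle point to which its vertical strand runs.\<close>

private fun proj :: "vertex \<Rightarrow> nat" where
  "proj (Low i) = skip j i"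
| "proj (Mid i) = i"
| "proj (High i) = 2 * N - 1 - i"

private definition vert :: "nat \<Rightarrow> vertex" where
  "vert a = (if a < N then Mid a else High (2 * N - 1 - a))"

text \<open>The component of the cup, seen after \<open>proj\<close>: its two ends and their
  partners in \<open>T\<close>. Every other component projects to a single arc of \<open>T\<close>,
  which is what \<open>conn\<close> records.\<close>

private definition block :: "nat set" where
  "block = {p. p = j \<or> p = Suc j \<or> linked T j p \<or> linked T (Suc j) p}"

private definition conn :: "nat \<Rightarrow> nat \<Rightarrow> bool" where
  "conn p r \<longleftrightarrow> p = r \<or> linked T p r \<or> (p \<in> block \<and> r \<in> block)"

private lemma stacked_eq:
  "stacked (diag_of x x T) (cup_at x j) =
    insert {Mid j, Mid (Suc j)} ((\<lambda>i. {Low i, Mid (skip j i)}) ` {..<N - 2}) \<union>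
    (\<lambda>(a, b). {vert a, vert b}) ` T"
proof -
  have N': "length x - 3 = N - 2" using N by simp
  have "(\<lambda>e. lower_half ` e) ` strands (cup_at x j) =
      insert {Mid j, Mid (Suc j)} ((\<lambda>i. {Low i, Mid (skip j i)}) ` {..<N - 2})"
    by (simp add: cup_at_def image_image N')
  moreover have "(\<lambda>e. upper_half ` e) ` strands (diag_of x x T) = (\<lambda>(a, b). {vert a, vert b}) ` T"
  proof -
    have "upper_half (pt N N a) = vert a" for a by (simp add: pt_def vert_def mult_2)
    then show ?thesis unfolding diag_of_def N[symmetric] by (simp add: image_image case_prod_beta)
  qed
  ultimately show ?thesis by (simp add: stacked_def)
qed

private lemma vert_props: "a < 2 * N \<Longrightarrow> valid (vert a) \<and> proj (vert a) = a"
  using j by (auto simp: vert_def)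

private lemma edgeD:
  assumes "edge v w"
  shows "valid v \<and> valid w \<and> (proj v = proj w \<or> linked T (proj v) (proj w) \<or> {proj v, proj w} = {j, Suc j})"
proof -
  consider "{v, w} = {Mid j, Mid (Suc j)}" | i where "i < N - 2" "{v, w} = {Low i, Mid (skip j i)}"
    | a b where "(a, b) \<in> T" "{v, w} = {vert a, vert b}"
    using assms unfolding edge_def stacked_eq
    by (elim UnE insertE imageE) (auto simp: case_prod_beta)
  then show ?thesis
  proof cases
    case 1
    then show ?thesis using j by (auto simp: doubleton_eq_iff)
  next
    case (2 i)
    have "skip j i < N" using 2(1) j by (auto simp: skip_def)
    then show ?thesis using 2 by (auto simp: doubleton_eq_iff)
  next
    case (3 a b)
    then have "a < 2 * N" "b < 2 * N" using nc_less[OF T 3(1)] by auto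
    then have "valid (vert a) \<and> proj (vert a) = a" "valid (vert b) \<and> proj (vert b) = b"
      using vert_props by blast+
    then show ?thesis using 3 by (auto simp: doubleton_eq_iff linked_def)
  qed
qed

private lemma conn_step:
  assumes "conn p r" "r = s \<or> linked T r s \<or> {r, s} = {j, Suc j}"
  shows "conn p s"
proof -
  note u = linked_unique[OF T]
  show ?thesis using assms(2)
  proof (elim disjE)
    assume rs: "linked T r s"
    consider "p = r" | "linked T p r" | "p \<in> block" "r \<in> block" using assms(1) by (auto simp: conn_def)
    then show ?thesis
    proof cases
      case 2
      then have "linked T r p" by (simp add: linked_def disj_commute)
      then have "p = s" using u[OF _ rs] by blast
      then show ?thesis by (simp add: conn_def)
    next
      case 3
      have "s \<in> block"
      proof (cases "r = j \<or> r = Suc j")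
        case True
        then show ?thesis using rs by (auto simp: block_def)
      next
        case False
        then have "linked T j r \<or> linked T (Suc j) r" using 3 by (simp add: block_def)
        then have "linked T r j \<or> linked T r (Suc j)" unfolding linked_def by blast
        then have "s = j \<or> s = Suc j" using u[OF rs] by blast
        then show ?thesis by (auto simp: block_def)
      qed
      then show ?thesis using 3 by (simp add: conn_def)
    qed (use rs in \<open>simp add: conn_def\<close>)
  next
    assume rs: "{r, s} = {j, Suc j}"
    then have "r \<in> block" "s \<in> block" by (auto simp: block_def doubleton_eq_iff)
    moreover have "p \<in> block"
    proof -
      consider "p = r" | "linked T r p" | "p \<in> block" using assms(1) unfolding conn_def linked_def by blast
      then show ?thesis using rs by cases (auto simp: block_def doubleton_eq_iff)
    qed
    ultimately show ?thesis by (simp add: conn_def)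
  qed (use assms(1) in simp)
qed

private lemma connected_in_iff:
  assumes v: "valid v"
  shows "connected_in (stacked (diag_of x x T) (cup_at x j)) v w \<longleftrightarrow> valid w \<and> conn (proj v) (proj w)"
proof -
  have edge_sym: "edge v w \<Longrightarrow> edge w v" for v w by (simp add: edge_def insert_commute)
  have conn_eq: "connected_in (stacked (diag_of x x T) (cup_at x j)) = edge\<^sup>*\<^sup>*"
    by (simp add: connected_in_def edge_def[abs_def])
  have sym: "edge\<^sup>*\<^sup>* w v" if "edge\<^sup>*\<^sup>* v w" for v w
    using that by (induction rule: rtranclp_induct) (auto intro: converse_rtranclp_into_rtranclp edge_sym)
  have "valid w \<and> conn (proj v) (proj w)" if "edge\<^sup>*\<^sup>* v w"
    using that
  proof (induction rule: rtranclp_induct)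
    case base
    then show ?case using v by (simp add: conn_def)
  next
    case (step y z)
    then show ?case using edgeD[OF step(2)] conn_step by blast
  qed
  moreover have "edge\<^sup>*\<^sup>* v w" if w: "valid w" and c: "conn (proj v) (proj w)"
  proof -
    have to_vert: "edge\<^sup>*\<^sup>* v (vert (proj v))" if "valid v" for v
    proof (cases v)
      case (Low i)
      then have "vert (proj v) = Mid (skip j i)" using that by (auto simp: vert_def skip_def)
      moreover have "edge (Low i) (Mid (skip j i))" using Low that by (auto simp: edge_def stacked_eq)
      ultimately show ?thesis using Low by auto
    next
      case (High i)
      then have "vert (proj v) = v" using that by (auto simp: vert_def)
      then show ?thesis by simp
    qed (use that in \<open>auto simp: vert_def\<close>)
    have lnk: "edge\<^sup>*\<^sup>* (vert a) (vert b)" if "linked T a b" for a b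
    proof -
      have "edge (vert a) (vert b)" using that unfolding edge_def stacked_eq linked_def
        by (auto simp: image_iff insert_commute)
      then show ?thesis by blast
    qed
    have cup: "edge\<^sup>*\<^sup>* (vert j) (vert (Suc j))"
      using j by (auto simp: edge_def stacked_eq vert_def)
    have blk: "edge\<^sup>*\<^sup>* (vert j) (vert a)" if "a \<in> block" for a
      using that lnk cup by (auto simp: block_def intro: rtranclp_trans)
    have "edge\<^sup>*\<^sup>* (vert (proj v)) (vert (proj w))"
      using c lnk blk[of "proj v", THEN sym] blk[of "proj w"] by (auto simp: conn_def intro: rtranclp_trans)
    then show ?thesis using to_vert[OF v] sym[OF to_vert[OF w]] by (meson rtranclp_trans)
  qed
  ultimately show ?thesis unfolding conn_eq by blast
qed

private lemma connected_in_invalid: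
  assumes "connected_in (stacked (diag_of x x T) (cup_at x j)) v w" "v \<noteq> w"
  shows "valid v"
proof -
  have "edge\<^sup>*\<^sup>* v w" using assms(1) by (simp add: connected_in_def edge_def[abs_def])
  then show ?thesis using assms(2) edgeD by (induction rule: converse_rtranclp_induct) blast+
qed

text \<open>Once \<open>j\<close> and \<open>Suc j\<close> are skipped, at most their two partners
  remain of the block, and these are the ends that \<open>cap\<close> splices.\<close>

private lemma conn_cap:
  assumes "a \<noteq> b"
  shows "conn (skip j a) (skip j b) \<longleftrightarrow> linked (cap j T) a b"
proof -
  have u: "linked T j (skip j a) \<Longrightarrow> linked T j (skip j b) \<Longrightarrow> False"
    "linked T (Suc j) (skip j a) \<Longrightarrow> linked T (Suc j) (skip j b) \<Longrightarrow> False"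
    using linked_unique[OF T] assms by (metis skip_eq_iff)+
  have "conn (skip j a) (skip j b) \<longleftrightarrow> linked T (skip j a) (skip j b) \<or>
     linked T j (skip j a) \<and> linked T (Suc j) (skip j b) \<or>
     linked T j (skip j b) \<and> linked T (Suc j) (skip j a)"
    using u assms by (auto simp: conn_def block_def)
  moreover have "linked (cap j T) a b \<longleftrightarrow> \<dots>"
  proof -
    have "(c, d) \<in> cap j T \<longleftrightarrow> c < d \<and> (linked T (skip j c) (skip j d) \<or>
       linked T j (skip j c) \<and> linked T (Suc j) (skip j d) \<or>
       linked T j (skip j d) \<and> linked T (Suc j) (skip j c))" for c d
      by (simp add: cap_def)
    then show ?thesis
      using assms linked_sym[of T "skip j a" "skip j b"] unfolding linked_def[of "cap j T"]
      by (cases "a < b") auto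
  qed
  ultimately show ?thesis by simp
qed

lemma vcomp_diagram_cup_at:
  "vcomp_diagram (diag_of x x T) (cup_at x j) = diag_of (take (Suc j) x @ drop (j + 3) x) x (cap j T)"
proof -
  define x' where "x' = take (Suc j) x @ drop (j + 3) x"
  define D where "D = diag_of x' x (cap j T)"
  have len: "length x' - Suc 0 = N - 2" "length x - Suc 0 = N" using j N by (auto simp: x'_def)
  have M: "2 * N - 2 = (length x' - 1) + (length x - 1)" using len j by simp
  have cap: "cap j T \<in> nc (2 * N - 2)"
  proof (rule cap_nc)
    have "2 * N - 2 + 2 = 2 * N" using j by simp
    then show "T \<in> nc (2 * N - 2 + 2)" by (simp only: T)
  qed (use j in simp)
  have pts: "p \<in> points D \<longleftrightarrow> valid (outer p)" for p
    by (cases p) (auto simp: points_def D_def len)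
  have pos: "skip j (position D p) = proj (outer p)" if "p \<in> points D" for p
    using that j by (cases p) (auto simp: points_def D_def len skip_def)
  have iff: "{p, r} \<in> strands D \<longleftrightarrow> p \<noteq> r \<and>
      connected_in (stacked (diag_of x x T) (cup_at x j)) (outer p) (outer r)" for p r
  proof (cases "p \<in> points D \<and> r \<in> points D")
    case True
    then have v: "valid (outer p)" "valid (outer r)" by (auto simp: pts)
    have "{p, r} \<in> strands D \<longleftrightarrow> linked (cap j T) (position D p) (position D r)"
      using strands_diag_of_iff[OF cap refl refl M, of p r] True by (simp add: D_def)
    also have "\<dots> \<longleftrightarrow> p \<noteq> r \<and> conn (proj (outer p)) (proj (outer r))"
    proof (cases "p = r")
      case True
      then show ?thesis using linked_less[OF cap] by auto
    next
      case False
      then have "position D p \<noteq> position D r" using True position_eq_iff by blast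
      then show ?thesis using conn_cap pos True False by metis
    qed
    finally show ?thesis using connected_in_iff[OF v(1)] v by simp
  next
    case False
    have "{p, r} \<notin> strands D"
      using matching_diag_of[OF cap refl refl M] False unfolding matching_def D_def by blast
    moreover have "\<not> connected_in (stacked (diag_of x x T) (cup_at x j)) (outer p) (outer r)" if "p \<noteq> r"
    proof
      assume c: "connected_in (stacked (diag_of x x T) (cup_at x j)) (outer p) (outer r)"
      have "outer p \<noteq> outer r" using that by (cases p; cases r) auto
      then have "valid (outer p)" using connected_in_invalid[OF c] by simp
      then have "valid (outer r)" using c connected_in_iff by blast
      with \<open>valid (outer p)\<close> show False using False pts by blast
    qed
    ultimately show ?thesis by blast
  qed
  have "strands D = {{p, r} |p r. p \<noteq> r \<and> connected_in (stacked (diag_of x x T) (cup_at x j)) (outer p) (outer r)}"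
  proof (intro equalityI subsetI)
    fix e assume e: "e \<in> strands D"
    then obtain p r where "e = {p, r}"
      using matching_strand[OF matching_diag_of[OF cap refl refl M], of e] by (metis D_def)
    then show "e \<in> {{p, r} |p r. p \<noteq> r \<and> connected_in (stacked (diag_of x x T) (cup_at x j)) (outer p) (outer r)}"
      using e iff by blast
  qed (use iff in blast)
  then show ?thesis
    by (intro diagram.expand) (simp add: vcomp_diagram_def cup_at_def D_def x'_def)
qed

lemma card_circles_cup_at:
  "card (circles (diag_of x x T) (cup_at x j)) = (if (j, Suc j) \<in> T then 1 else 0)"
proof -
  define comp where "comp i = {v. connected_in (stacked (diag_of x x T) (cup_at x j)) (Mid i) v}" for i
  have comp: "comp i = {v. valid v \<and> conn i (proj v)}" if "i < N" for i
    using connected_in_iff[of "Mid i"] that by (simp add: comp_def)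
  have circ: "circles (diag_of x x T) (cup_at x j) = {C. \<exists>i<N. C = comp i \<and> C \<subseteq> range Mid}"
    unfolding circles_def comp_def cup_at_def using N by auto
  \<comment> \<open>A middle point that is not an end of the cup has a vertical strand down to the
    lowest line, so it lies on no circle.\<close>
  have outer: "\<not> comp i \<subseteq> range Mid" if i: "i < N" "i \<noteq> j" "i \<noteq> Suc j" for i
  proof -
    obtain i' where i': "i = skip j i'" using skip_cases[OF i(2,3)] by blast
    then have "Low i' \<in> comp i" unfolding comp[OF i(1)] using i j by (auto simp: conn_def skip_def split: if_splits)
    then show ?thesis by blast
  qed
  show ?thesis
  proof (cases "(j, Suc j) \<in> T")
    case True
    have lnk: "linked T j p \<longleftrightarrow> p = Suc j" "linked T (Suc j) p \<longleftrightarrow> p = j" for p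
      using True linked_unique[OF T, of j "Suc j" p] linked_unique[OF T, of "Suc j" j p]
      by (auto simp: linked_def)
    have c: "conn i p \<longleftrightarrow> p = j \<or> p = Suc j" if "i = j \<or> i = Suc j" for i p
      using that by (auto simp: conn_def block_def lnk)
    have "comp i = {Mid j, Mid (Suc j)}" if "i = j \<or> i = Suc j" for i
    proof -
      have "valid v \<and> (proj v = j \<or> proj v = Suc j) \<longleftrightarrow> v = Mid j \<or> v = Mid (Suc j)" for v
        using j by (cases v) auto
      moreover have "i < N" using that j by auto
      ultimately show ?thesis using c[OF that] by (auto simp: comp)
    qed
    then have "circles (diag_of x x T) (cup_at x j) = {{Mid j, Mid (Suc j)}}"
      unfolding circ using outer j by (auto intro!: exI[of _ j])
    then show ?thesis using True by simp
  next
    case False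
    have "\<not> comp i \<subseteq> range Mid" if i: "i = j \<or> i = Suc j" for i
    proof -
      obtain k where k: "linked T j k" using nc_linked[OF T, of j] j by auto
      have "k \<noteq> Suc j" using False k linked_arc[OF T k] by auto
      moreover have "k \<noteq> j" "k < 2 * N" using linked_less[OF T k] by auto
      ultimately obtain k' where k': "k = skip j k'" using skip_cases by blast
      have c: "conn i k" using i k by (auto simp: conn_def block_def)
      show ?thesis
      proof (cases "k < N")
        case True
        then have "Low k' \<in> comp i" using i j c k' by (auto simp: comp skip_def split: if_splits)
        then show ?thesis by blast
      next
        case False
        then have "High (2 * N - 1 - k) \<in> comp i" using i j c \<open>k < 2 * N\<close> by (auto simp: comp)
        then show ?thesis by blast
      qed
    qed
    then have "circles (diag_of x x T) (cup_at x j) = {}"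
      unfolding circ using outer by blast
    then show ?thesis using False by simp
  qed
qed

end

section \<open>Two-morphisms as functions on spin states\<close>

definition planar :: "'c list \<Rightarrow> 'c list \<Rightarrow> 'c diagram set" where
  "planar x y = diag_of x y ` nc (length x - 1 + (length y - 1))"

definition homset :: "'c set \<Rightarrow> 'c list \<Rightarrow> 'c list \<Rightarrow> 'c diagram set" where
  "homset S x y = {D. colored_matching S D \<and> lower D = x \<and> upper D = y}"

lemma Hom_iff: "f \<in> Hom S x y \<longleftrightarrow> Poly_Mapping.keys f \<subseteq> homset S x y"
  by (auto simp: Hom_def homset_def)

lemma finite_planar: "finite (planar x y)"
  by (simp add: planar_def finite_nc)

lemma planar_arcs:
  assumes "D \<in> planar x y"
  shows "arcs D \<in> nc (length x - 1 + (length y - 1))" "diag_of x y (arcs D) = D"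
  using assms by (auto simp: planar_def arcs_diag_of)

lemma inj_on_arcs: "inj_on arcs (planar x y)"
  by (rule inj_onI) (metis planar_arcs(2))

lemma homset_planar: "homset S x y \<subseteq> planar x y"
proof
  fix D assume "D \<in> homset S x y"
  from this have D: "matching D" "crossingless D" "lower D = x" "upper D = y"
    by (auto simp: homset_def colored_matching_def)
  have "D = diag_of x y (arcs D)" using diag_of_arcs[OF D(1)] D(3,4) by simp
  moreover have "arcs D \<in> nc (length x - 1 + (length y - 1))" using arcs_nc[OF D(1,2)] D(3,4) by simp
  ultimately show "D \<in> planar x y" unfolding planar_def by (rule image_eqI)
qed

lemma finite_homset: "finite (homset S x y)"
  by (rule finite_subset[OF homset_planar finite_planar])

lemma id_diagram_homset:
  assumes "one_morphism S x"
  shows "id_diagram x \<in> homset S x x"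
proof -
  define N where "N = length x - 1"
  define D where "D = diag_of x x (id_arcs N)"
  have x: "x \<noteq> []" using assms by (simp add: one_morphism_def)
  have nc: "id_arcs N \<in> nc (2 * N)" by (rule id_arcs_nc)
  have M: "2 * N = length x - 1 + (length x - 1)" by (simp add: N_def)
  have arcs: "arcs D = id_arcs N" unfolding D_def by (rule arcs_diag_of[OF nc refl refl M])
  have low: "boundary_colors D ! i = x ! i" if "i \<le> N" for i
    using boundary_colors_lower[of i D] that x by (simp add: D_def N_def less_Suc_eq_le[symmetric])
  have up: "boundary_colors D ! (2 * N - i) = x ! i" if "i \<le> N" for i
    using boundary_colors_upper[of D i] that x M by (simp add: D_def N_def less_Suc_eq_le[symmetric])
  have "arcs_colored (boundary_colors D) (arcs D)"
  proof -
    have "boundary_colors D ! i = boundary_colors D ! Suc (2 * N - 1 - i)"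
      "boundary_colors D ! Suc i = boundary_colors D ! (2 * N - 1 - i)" if "i < N" for i
    proof -
      have "Suc (2 * N - 1 - i) = 2 * N - i" "2 * N - 1 - i = 2 * N - Suc i" using that by auto
      then show "boundary_colors D ! i = boundary_colors D ! Suc (2 * N - 1 - i)"
        "boundary_colors D ! Suc i = boundary_colors D ! (2 * N - 1 - i)"
        using low[of i] up[of i] low[of "Suc i"] up[of "Suc i"] that by auto
    qed
    then show ?thesis unfolding arcs by (auto simp: arcs_colored_def id_arcs_def)
  qed
  then have "colored_matching S D"
    using assms matching_diag_of[OF nc refl refl M] crossingless_diag_of[OF nc refl refl M]
    by (simp add: colored_matching_iff D_def)
  moreover have "id_diagram x = D" by (simp add: id_diagram_eq D_def N_def)
  ultimately show ?thesis by (simp add: homset_def D_def)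
qed

text \<open>By \<open>cups_into_eq\<close>, the positions at which the colours admit a cup.\<close>

definition turnbacks :: "'c list \<Rightarrow> nat set" where
  "turnbacks x = {j. j + 2 < length x \<and> x ! j = x ! (j + 2)}"

lemma vcomp_basis:
  "vcomp \<delta> f (basis c) = (\<Sum>E\<in>Poly_Mapping.keys f. Poly_Mapping.single (vcomp_diagram E c)
      (Poly_Mapping.lookup f E * (- \<delta>) ^ card (circles E c)))"
  by (simp add: vcomp_def basis_def)

context spin
begin

definition Xi :: "('c, 'k) two_morphism \<Rightarrow> (nat \<Rightarrow> bool) \<Rightarrow> 'r" where
  "Xi f s = (\<Sum>D\<in>Poly_Mapping.keys f. \<iota> (Poly_Mapping.lookup f D) * wt (arcs D) s)"

lemma Xi_superset:
  assumes "finite A" "Poly_Mapping.keys f \<subseteq> A"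
  shows "Xi f = comb A arcs (Poly_Mapping.lookup f)"
  unfolding Xi_def comb_def fun_eq_iff
  by (intro allI sum.mono_neutral_left assms) (simp add: in_keys_iff)

lemma Xi_0 [simp]: "Xi 0 s = 0"
  by (simp add: Xi_def)

lemma Xi_single: "Xi (Poly_Mapping.single D a) s = \<iota> a * wt (arcs D) s"
  by (cases "a = 0") (simp_all add: Xi_def)

lemma Xi_add: "Xi (f + g) s = Xi f s + Xi g s"
proof -
  define A where "A = Poly_Mapping.keys f \<union> Poly_Mapping.keys g"
  have "finite A" "Poly_Mapping.keys f \<subseteq> A" "Poly_Mapping.keys g \<subseteq> A" "Poly_Mapping.keys (f + g) \<subseteq> A"
    using Poly_Mapping.keys_add[of f g] by (auto simp: A_def)
  then show ?thesis
    by (simp add: Xi_superset comb_def lookup_add \<iota>_add distrib_right sum.distrib)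
qed

lemma Xi_sum: "Xi (sum f A) s = (\<Sum>x\<in>A. Xi (f x) s)"
  by (induction A rule: infinite_finite_induct) (auto simp: Xi_add)

text \<open>With \<open>I = {0}\<close> this is faithfulness of the action; with the annihilator of
  a scalar as \<open>I\<close> it later serves to cancel that scalar.\<close>

lemma Xi_ideal:
  assumes keys: "Poly_Mapping.keys f \<subseteq> planar x y"
    and I: "0 \<in> I" "\<And>r s. r \<in> I \<Longrightarrow> s \<in> I \<Longrightarrow> r - s \<in> I" "\<And>r s. r \<in> I \<Longrightarrow> r * s \<in> I"
    and val: "\<And>s. Xi f s \<in> I"
  shows "\<iota> (Poly_Mapping.lookup f D) \<in> I"
proof (cases "D \<in> Poly_Mapping.keys f")
  case True
  show ?thesis
  proof (rule wt_coefficients[of _ arcs _ I "\<lambda>D. \<iota> (Poly_Mapping.lookup f D)"])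
    show "inj_on arcs (Poly_Mapping.keys f)" using inj_on_subset[OF inj_on_arcs keys] .
    show "arcs D \<in> nc (length x - 1 + (length y - 1))" if "D \<in> Poly_Mapping.keys f" for D
      using planar_arcs(1) keys that by blast
  qed (use True I val in \<open>auto simp: Xi_def\<close>)
next
  case False
  then show ?thesis using I by (simp add: in_keys_iff)
qed

lemma Xi_eq_0:
  assumes "Poly_Mapping.keys f \<subseteq> planar x y" "\<And>s. Xi f s = 0"
  shows "f = 0"
proof (rule poly_mapping_eqI)
  fix D
  have "\<iota> (Poly_Mapping.lookup f D) \<in> {0}" by (rule Xi_ideal[OF assms(1)]) (use assms(2) in auto)
  then show "Poly_Mapping.lookup f D = Poly_Mapping.lookup 0 D" using \<iota>_eq_iff[of _ 0] by simp
qed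

text \<open>Stacking on a cup contracts two neighbouring bottom factors: the arcs change by
  \<open>cap j\<close>, and the value \<open>- \<delta>\<close> of a circle becomes
  \<open>- (q + q')\<close> under \<iota>.\<close>

lemma vcomp_cup_at:
  assumes keys: "Poly_Mapping.keys f \<subseteq> planar x x" and j: "j + 2 < length x"
  shows "Poly_Mapping.keys (vcomp \<delta> f (basis (cup_at x j))) \<subseteq> planar (take (Suc j) x @ drop (j + 3) x) x"
    and "Xi (vcomp \<delta> f (basis (cup_at x j))) s = capf j (Xi f) s"
proof -
  define N where "N = length x - 1"
  define x' where "x' = take (Suc j) x @ drop (j + 3) x"
  have j': "Suc j < N" using j by (simp add: N_def)
  have N2: "2 * N - 2 + 2 = 2 * N" using j' by simp
  have len: "length x' - 1 + (length x - 1) = 2 * N - 2" using j by (simp add: x'_def N_def)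
  have E: "arcs E \<in> nc (2 * N)" "diag_of x x (arcs E) = E" if "E \<in> Poly_Mapping.keys f" for E
    using planar_arcs[of E x x] keys that by (auto simp: N_def mult_2)
  have cap: "cap j (arcs E) \<in> nc (2 * N - 2)" if "E \<in> Poly_Mapping.keys f" for E
    by (rule cap_nc) (use E[OF that] j' N2 in simp_all)
  have comp: "vcomp_diagram E (cup_at x j) = diag_of x' x (cap j (arcs E))"
    "card (circles E (cup_at x j)) = (if (j, Suc j) \<in> arcs E then 1 else 0)" if "E \<in> Poly_Mapping.keys f" for E
    using vcomp_diagram_cup_at[OF E(1)[OF that] N_def j'] card_circles_cup_at[OF E(1)[OF that] N_def j']
    unfolding E(2)[OF that] x'_def by simp_all
  have planar: "vcomp_diagram E (cup_at x j) \<in> planar x' x" if "E \<in> Poly_Mapping.keys f" for E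
    unfolding comp[OF that] planar_def len using cap[OF that] by simp
  show "Poly_Mapping.keys (vcomp \<delta> f (basis (cup_at x j))) \<subseteq> planar x' x"
  proof
    fix D assume "D \<in> Poly_Mapping.keys (vcomp \<delta> f (basis (cup_at x j)))"
    from subsetD[OF Poly_Mapping.keys_sum this[unfolded vcomp_basis]]
    obtain E where "E \<in> Poly_Mapping.keys f" "D = vcomp_diagram E (cup_at x j)"
      by (auto split: if_splits)
    then show "D \<in> planar x' x" using planar by simp
  qed
  have "Xi (vcomp \<delta> f (basis (cup_at x j))) s =
    (\<Sum>E\<in>Poly_Mapping.keys f. \<iota> (Poly_Mapping.lookup f E) * capf j (wt (arcs E)) s)"
    unfolding vcomp_basis Xi_sum Xi_single
  proof (rule sum.cong)
    fix E assume e: "E \<in> Poly_Mapping.keys f"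
    have a: "arcs (vcomp_diagram E (cup_at x j)) = cap j (arcs E)"
      unfolding comp(1)[OF e] by (rule arcs_diag_of[OF cap[OF e] refl refl len[symmetric]])
    have "capf j (wt (arcs E)) s = (if (j, Suc j) \<in> arcs E then - (q + q') else 1) * wt (cap j (arcs E)) s"
      by (rule capf_wt[of _ "2 * N - 2"]) (use E(1)[OF e] j' N2 in simp_all)
    then show "\<iota> (Poly_Mapping.lookup f E * (- \<delta>) ^ card (circles E (cup_at x j))) *
        wt (arcs (vcomp_diagram E (cup_at x j))) s =
      \<iota> (Poly_Mapping.lookup f E) * capf j (wt (arcs E)) s"
      unfolding a comp(2)[OF e] by (auto simp: \<iota>_uminus \<iota>_delta) (simp add: algebra_simps)
  qed simp
  also have "\<dots> = capf j (Xi f) s"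
    unfolding Xi_def capf_sum[symmetric] ..
  finally show "Xi (vcomp \<delta> f (basis (cup_at x j))) s = capf j (Xi f) s" .
qed

lemma cup_killed_iff:
  "f \<in> cup_killed S \<delta> x \<longleftrightarrow> f \<in> Hom S x x \<and> killed (length x - 1) (turnbacks x) (Xi f)"
proof (cases "f \<in> Hom S x x")
  case True
  then have keys: "Poly_Mapping.keys f \<subseteq> planar x x" using homset_planar[of S x x] by (auto simp: Hom_iff)
  have iff: "vcomp \<delta> f (basis (cup_at x j)) = 0 \<longleftrightarrow> (\<forall>s. capf j (Xi f) s = 0)" if "j + 2 < length x" for j
    using Xi_eq_0[OF vcomp_cup_at(1)[OF keys that]] vcomp_cup_at(2)[OF keys that] Xi_0 by metis
  have "f \<in> cup_killed S \<delta> x \<longleftrightarrow> (\<forall>j\<in>turnbacks x. vcomp \<delta> f (basis (cup_at x j)) = 0)"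
    using True by (auto simp: cup_killed_def cups_into_eq turnbacks_def)
  also have "\<dots> \<longleftrightarrow> killed (length x - 1) (turnbacks x) (Xi f)"
    using iff unfolding killed_def turnbacks_def by auto
  finally show ?thesis using True by simp
qed (auto simp: cup_killed_def)

lemma Xi_comb: "f \<in> Hom S x y \<Longrightarrow> Xi f = comb (homset S x y) arcs (Poly_Mapping.lookup f)"
  by (rule Xi_superset) (auto simp: Hom_iff finite_homset)

lemma arcs_id_diagram: "arcs (id_diagram x) = id_arcs (length x - 1)"
  unfolding id_diagram_eq by (rule arcs_diag_of[OF id_arcs_nc refl refl]) simp

text \<open>A matching other than the identity has a short arc on each line. The intervals on both
  sides of such an arc lie in one region, so the colours \<open>x ! j\<close> and
  \<open>x ! (j + 2)\<close> agree and \<open>j\<close> is a turnback.\<close>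

lemma tame_homset:
  assumes "one_morphism S x"
  shows "tame (length x - 1) (turnbacks x) (homset S x x) arcs"
proof -
  define N where "N = length x - 1"
  have x: "x \<noteq> []" "length x = Suc N" using assms by (auto simp: one_morphism_def N_def)
  have ex: "\<exists>j\<in>turnbacks x. Suc j < N \<and> (j, Suc j) \<in> arcs D"
    "\<exists>j\<in>turnbacks x. Suc j < N \<and> (2 * N - 2 - j, 2 * N - 1 - j) \<in> arcs D"
    if D: "D \<in> homset S x x" and ne: "arcs D \<noteq> id_arcs N" for D
  proof -
    have nc: "arcs D \<in> nc (2 * N)" using D homset_planar planar_arcs(1)[of D x x] by (auto simp: N_def mult_2)
    have lu: "lower D = x" "upper D = x" using D by (auto simp: homset_def)
    have col: "boundary_colors D ! i = boundary_colors D ! Suc (Suc i)" if "(i, Suc i) \<in> arcs D" for i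
      using D that by (auto simp: homset_def colored_matching_iff arcs_colored_def)
    obtain i where i: "Suc i < N" "(i, Suc i) \<in> arcs D" using nc_bottom_arc[OF nc ne] by blast
    have "x ! i = x ! (i + 2)"
      using col[OF i(2)] boundary_colors_lower[of i D] boundary_colors_lower[of "i + 2" D] i(1) by (simp add: lu x)
    then show "\<exists>j\<in>turnbacks x. Suc j < N \<and> (j, Suc j) \<in> arcs D"
      using i x by (auto simp: turnbacks_def)
    obtain k where k: "N \<le> k" "Suc k < 2 * N" "(k, Suc k) \<in> arcs D" using nc_top_arc[OF nc ne] by blast
    define j where "j = 2 * N - 2 - k"
    have j: "Suc j < N" "k = 2 * N - (j + 2)" "Suc (Suc k) = 2 * N - j" using k by (auto simp: j_def)
    have "boundary_colors D ! (2 * N - i) = x ! i" if "i \<le> N" for i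
      using boundary_colors_upper[of D i] that x by (simp add: lu mult_2)
    from this[of j] this[of "j + 2"] have "x ! j = x ! (j + 2)"
      using col[OF k(3)] j by simp
    moreover have "2 * N - 2 - j = k" "2 * N - 1 - j = Suc k" using k by (auto simp: j_def)
    ultimately show "\<exists>j\<in>turnbacks x. Suc j < N \<and> (2 * N - 2 - j, 2 * N - 1 - j) \<in> arcs D"
      using j(1) k(3) x by (intro bexI[of _ j]) (auto simp: turnbacks_def)
  qed
  have nc: "arcs D \<in> nc (2 * N)" if "D \<in> homset S x x" for D
    using that homset_planar planar_arcs(1)[of D x x] by (auto simp: N_def mult_2)
  have "tame N (turnbacks x) (homset S x x) arcs"
    unfolding tame_def
  proof (intro conjI ballI impI)
    show "finite (homset S x x)" by (rule finite_homset)
    show "inj_on arcs (homset S x x)" by (rule inj_on_subset[OF inj_on_arcs homset_planar])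
  qed (fact nc ex)+
  then show ?thesis by (simp add: N_def)
qed

lemma cup_killed_comb:
  assumes "f \<in> cup_killed S \<delta> x"
  shows "killed (length x - 1) (turnbacks x) (comb (homset S x x) arcs (Poly_Mapping.lookup f))"
  using assms Xi_comb[of f S x x] unfolding cup_killed_iff by metis

lemma cup_killed_unique:
  assumes x: "one_morphism S x" and f: "f \<in> cup_killed S \<delta> x" "id_coeff x f = 1"
    and g: "g \<in> cup_killed S \<delta> x" "id_coeff x g = 1"
  shows "f = g"
proof (rule poly_mapping_eqI)
  fix D
  have H: "f \<in> Hom S x x" "g \<in> Hom S x x" using f g by (auto simp: cup_killed_def)
  show "Poly_Mapping.lookup f D = Poly_Mapping.lookup g D"
  proof (cases "D \<in> homset S x x")
    case True
    show ?thesis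
      by (rule comb_unique[OF tame_homset[OF x] id_diagram_homset[OF x] arcs_id_diagram
            cup_killed_comb[OF f(1)] cup_killed_comb[OF g(1)] _ _ True])
        (use f g in \<open>auto simp: id_coeff_def\<close>)
  next
    case False
    then have "D \<notin> Poly_Mapping.keys f" "D \<notin> Poly_Mapping.keys g" using H by (auto simp: Hom_iff)
    then show ?thesis by (simp add: in_keys_iff)
  qed
qed

lemma JW_eqI:
  assumes "one_morphism S x" "f \<in> cup_killed S \<delta> x" "id_coeff x f = 1"
  shows "JW S \<delta> x = f"
  unfolding JW_def by (rule the_equality) (use assms cup_killed_unique in blast)+

text \<open>After multiplication by a power of \<open>- q'\<close> and application of \<rho>, the
  second equation of \<open>killed_block\<close> says that the binomial divides
  \<open>a * a\<close>, which is a unit.\<close>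

lemma qbinom_invertible:
  assumes x: "one_morphism S x" and f: "f \<in> cup_killed S \<delta> x" and unit: "id_coeff x f dvd 1"
    and pn: "p + n < length x" and J1: "\<And>j. p \<le> j \<Longrightarrow> Suc j < p + n \<Longrightarrow> j \<in> turnbacks x"
    and J2: "\<And>j. j \<in> turnbacks x \<Longrightarrow> j \<in> {p..<p + n} \<longleftrightarrow> Suc j \<in> {p..<p + n}"
    and k: "k \<le> n"
  shows "qbinom_in \<delta> n k dvd 1"
proof -
  define a where "a = id_coeff x f"
  obtain r m where "\<iota> (a * qbinom_in \<delta> n k) * (q ^ m * r) = \<iota> (a * a) * (- q) ^ k"
    by (rule killed_block[OF tame_homset[OF x] id_diagram_homset[OF x] arcs_id_diagram
          cup_killed_comb[OF f] _ J1 J2 k])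
      (use pn in \<open>auto simp: a_def id_coeff_def\<close>)
  then have "\<iota> (a * qbinom_in \<delta> n k) * (q ^ m * r * (- q') ^ k) = \<iota> (a * a) * ((- q) ^ k * (- q') ^ k)"
    by (simp add: mult.assoc[symmetric])
  also have "(- q) ^ k * (- q') ^ k = 1" by (simp flip: power_mult_distrib add: qq')
  finally have "\<iota> (a * qbinom_in \<delta> n k) * (q ^ m * r * (- q') ^ k) = \<iota> (a * a)" by simp
  then have "\<rho> (\<iota> (a * qbinom_in \<delta> n k) * (q ^ m * r * (- q') ^ k)) = a * a" by (simp add: \<rho>_\<iota>)
  then have "qbinom_in \<delta> n k dvd a * a" unfolding \<rho>_mult by (metis dvd_triv_left mult.assoc mult.left_commute)
  also have "a * a dvd 1" using mult_dvd_mono[OF unit unit] by (simp add: a_def)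
  finally show ?thesis .
qed

end

section \<open>Horizontal composition\<close>

text \<open>With \<open>E\<close> to the right of \<open>D\<close>, the boundary walk follows the
  bottom of \<open>D\<close>, then all of \<open>E\<close>, then the top of \<open>D\<close>. Hence
  the positions of \<open>E\<close> move by \<open>m\<close>, and those on the top of
  \<open>D\<close> by \<open>2 * n\<close>.\<close>

definition outer_pos :: "nat \<Rightarrow> nat \<Rightarrow> nat \<Rightarrow> nat" where
  "outer_pos m n p = (if p < m then p else p + 2 * n)"

definition inner_pos :: "nat \<Rightarrow> nat \<Rightarrow> nat" where
  "inner_pos m p = p + m"

definition join_arcs :: "nat \<Rightarrow> nat \<Rightarrow> (nat \<times> nat) set \<Rightarrow> (nat \<times> nat) set \<Rightarrow> (nat \<times> nat) set" where
  "join_arcs m n T U = map_prod (outer_pos m n) (outer_pos m n) ` T \<union> map_prod (inner_pos m) (inner_pos m) ` U"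

lemma outer_pos_less [simp]: "outer_pos m n p < outer_pos m n r \<longleftrightarrow> p < r"
  by (auto simp: outer_pos_def)

lemma inner_pos_less [simp]: "inner_pos m p < inner_pos m r \<longleftrightarrow> p < r"
  by (auto simp: inner_pos_def)

lemma outer_pos_range: "outer_pos m n p < m \<or> m + 2 * n \<le> outer_pos m n p"
  by (auto simp: outer_pos_def)

lemma inner_pos_range: "p < 2 * n \<Longrightarrow> m \<le> inner_pos m p \<and> inner_pos m p < m + 2 * n"
  by (auto simp: inner_pos_def)

lemma join_arcs_nc:
  assumes T: "T \<in> nc (2 * m)" and U: "U \<in> nc (2 * n)"
  shows "join_arcs m n T U \<in> nc (2 * (m + n))"
proof -
  let ?g = "outer_pos m n" and ?h = "inner_pos m"
  have mem: "e \<in> join_arcs m n T U \<longleftrightarrow>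
      (\<exists>a b. (a, b) \<in> T \<and> e = (?g a, ?g b)) \<or> (\<exists>a b. (a, b) \<in> U \<and> e = (?h a, ?h b))" for e
    by (auto simp: join_arcs_def)
  have "a < b \<and> b < 2 * (m + n)" if "(a, b) \<in> join_arcs m n T U" for a b
    using that nc_less[OF T] nc_less[OF U] unfolding mem
    by (elim disjE exE conjE) (fastforce simp: outer_pos_def inner_pos_def)+
  moreover have "compat e f" if e: "e \<in> join_arcs m n T U" and f: "f \<in> join_arcs m n T U" and ne: "e \<noteq> f" for e f
  proof -
    have TT: "compat (?g a, ?g b) (?g c, ?g d)" if "(a, b) \<in> T" "(c, d) \<in> T" "\<not> (a = c \<and> b = d)" for a b c d
      using nc_compat[OF T that(1,2)] that(3) by auto
    have UU: "compat (?h a, ?h b) (?h c, ?h d)" if "(a, b) \<in> U" "(c, d) \<in> U" "\<not> (a = c \<and> b = d)" for a b c d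
      using nc_compat[OF U that(1,2)] that(3) by auto
    have TU: "compat (?g a, ?g b) (?h c, ?h d)" "compat (?h c, ?h d) (?g a, ?g b)"
      if "(a, b) \<in> T" "(c, d) \<in> U" for a b c d
      using nc_less[OF T that(1)] nc_less[OF U that(2)] by (auto simp: outer_pos_def inner_pos_def)
    from e f ne show ?thesis unfolding mem
    proof (elim disjE exE conjE)
      fix a b c d assume "(a, b) \<in> T" "e = (?g a, ?g b)" "(c, d) \<in> T" "f = (?g c, ?g d)"
      then show ?thesis using TT[of a b c d] ne by blast
    next
      fix a b c d assume "(a, b) \<in> U" "e = (?h a, ?h b)" "(c, d) \<in> U" "f = (?h c, ?h d)"
      then show ?thesis using UU[of a b c d] ne by blast
    qed (use TU in blast)+
  qed
  moreover have "\<exists>a b. (a, b) \<in> join_arcs m n T U \<and> (i = a \<or> i = b)" if i: "i < 2 * (m + n)" for i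
  proof -
    consider p where "p < 2 * m" "i = ?g p" | p where "p < 2 * n" "i = ?h p"
    proof -
      consider "i < m" | "m \<le> i" "i < m + 2 * n" | "m + 2 * n \<le> i" by linarith
      then show ?thesis
      proof cases
        case 1
        then show ?thesis using that(1)[of i] by (simp add: outer_pos_def)
      next
        case 2
        then show ?thesis using that(2)[of "i - m"] by (simp add: inner_pos_def)
      next
        case 3
        then show ?thesis using that(1)[of "i - 2 * n"] i by (simp add: outer_pos_def)
      qed
    qed
    then show ?thesis
    proof cases
      case (1 p)
      then obtain r where "linked T p r" using nc_linked[OF T] by blast
      then have "(?g p, ?g r) \<in> join_arcs m n T U \<or> (?g r, ?g p) \<in> join_arcs m n T U"
        unfolding mem linked_def by blast
      then show ?thesis using 1 by blast
    next
      case (2 p)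
      then obtain r where "linked U p r" using nc_linked[OF U] by blast
      then have "(?h p, ?h r) \<in> join_arcs m n T U \<or> (?h r, ?h p) \<in> join_arcs m n T U"
        unfolding mem linked_def by blast
      then show ?thesis using 2 by blast
    qed
  qed
  ultimately show ?thesis unfolding nc_def by (simp add: case_prod_beta) (metis prod.collapse)
qed

lemma join_arcs_id: "join_arcs m n (id_arcs m) (id_arcs n) = id_arcs (m + n)"
proof -
  have "map_prod (outer_pos m n) (outer_pos m n) ` id_arcs m = (\<lambda>i. (i, 2 * (m + n) - 1 - i)) ` {..<m}"
    unfolding id_arcs_def image_image by (intro image_cong) (auto simp: outer_pos_def)
  moreover have "map_prod (inner_pos m) (inner_pos m) ` id_arcs n = (\<lambda>i. (i, 2 * (m + n) - 1 - i)) ` (\<lambda>i. i + m) ` {..<n}"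
    unfolding id_arcs_def image_image by (intro image_cong) (auto simp: inner_pos_def)
  moreover have "{..<m + n} = {..<m} \<union> (\<lambda>i. i + m) ` {..<n}"
  proof -
    have "i \<in> (\<lambda>i. i + m) ` {..<n}" if "m \<le> i" "i < m + n" for i
      using that by (intro image_eqI[of _ _ "i - m"]) auto
    then have "{..<m + n} \<subseteq> {..<m} \<union> (\<lambda>i. i + m) ` {..<n}"
      by (meson UnI1 UnI2 lessThan_iff not_less subsetI)
    then show ?thesis by auto
  qed
  ultimately show ?thesis by (simp add: join_arcs_def id_arcs_def image_Un)
qed

lemma join_arcs_eq_id:
  assumes T: "T \<in> nc (2 * m)" and U: "U \<in> nc (2 * n)" and eq: "join_arcs m n T U = id_arcs (m + n)"
  shows "T = id_arcs m" "U = id_arcs n"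
proof -
  have "T \<subseteq> id_arcs m"
  proof
    fix e assume e: "e \<in> T"
    obtain a b where ab: "e = (a, b)" by force
    have "(outer_pos m n a, outer_pos m n b) \<in> id_arcs (m + n)" using e ab by (auto simp: join_arcs_def simp flip: eq)
    then show "e \<in> id_arcs m" using nc_less[OF T, of a b] e ab
      by (auto simp: id_arcs_def outer_pos_def image_iff split: if_splits)
  qed
  then show "T = id_arcs m"
    using card_subset_eq[OF nc_finite[OF id_arcs_nc]] card_nc[OF T] card_nc[OF id_arcs_nc[of m]] by simp
  have "U \<subseteq> id_arcs n"
  proof
    fix e assume e: "e \<in> U"
    obtain a b where ab: "e = (a, b)" by force
    have "(inner_pos m a, inner_pos m b) \<in> id_arcs (m + n)" using e ab by (auto simp: join_arcs_def simp flip: eq)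
    then show "e \<in> id_arcs n" using nc_less[OF U, of a b] e ab
      by (auto simp: id_arcs_def inner_pos_def image_iff)
  qed
  then show "U = id_arcs n"
    using card_subset_eq[OF nc_finite[OF id_arcs_nc]] card_nc[OF U] card_nc[OF id_arcs_nc[of n]] by simp
qed

lemma length_comp1: "x \<noteq> [] \<Longrightarrow> y \<noteq> [] \<Longrightarrow> length (comp1 x y) - 1 = (length x - 1) + (length y - 1)"
  by (cases x) (auto simp: comp1_def)

lemma nth_comp1_left: "i < length x \<Longrightarrow> comp1 x y ! i = x ! i"
  by (simp add: comp1_def nth_append)

lemma nth_comp1_right:
  assumes "x \<noteq> []" "y \<noteq> []" "last x = hd y" "i < length y"
  shows "comp1 x y ! (i + (length x - 1)) = y ! i"
proof (cases i)
  case 0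
  then show ?thesis using assms by (simp add: comp1_def nth_append last_conv_nth hd_conv_nth)
next
  case (Suc k)
  have eq: "i + (length x - 1) = length x + k" using Suc assms(1) by (cases x) auto
  show ?thesis unfolding eq using Suc assms by (simp add: comp1_def nth_append nth_tl)
qed

lemma one_morphism_comp1:
  assumes "one_morphism S x" "one_morphism S y" "last x = hd y"
  shows "one_morphism S (comp1 x y)"
proof -
  obtain b v where y: "y = b # v" using assms(2) by (cases y) (auto simp: one_morphism_def)
  show ?thesis using assms unfolding y one_morphism_def comp1_def
    by (cases v) (auto simp: distinct_adj_append_iff)
qed

context
  fixes x y :: "'c list" and m n
  assumes xy: "x \<noteq> []" "y \<noteq> []" "last x = hd y" and m: "m = length x - 1" and n: "n = length y - 1"
begin

lemma hcomp_diagram_diag_of: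
  assumes T: "T \<in> nc (2 * m)" and U: "U \<in> nc (2 * n)"
  shows "hcomp_diagram (diag_of x x T) (diag_of y y U) =
    diag_of (comp1 x y) (comp1 x y) (join_arcs m n T U)"
proof -
  let ?D = "diag_of x x T"
  have len: "length (comp1 x y) - 1 = m + n" using length_comp1[OF xy(1,2)] by (simp add: m n)
  have g: "pt (m + n) (m + n) (outer_pos m n a) = pt m m a" if "a < 2 * m" for a
    using that by (auto simp: pt_def outer_pos_def)
  have h: "pt (m + n) (m + n) (inner_pos m a) = shift ?D (pt n n a)" if "a < 2 * n" for a
    using that m by (auto simp: pt_def inner_pos_def)
  have "strands ?D = (\<lambda>(a, b). {pt (m + n) (m + n) a, pt (m + n) (m + n) b}) ` map_prod (outer_pos m n) (outer_pos m n) ` T"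
    unfolding diag_of_def m[symmetric] image_image diagram.sel
  proof (intro image_cong refl)
    fix e assume e: "e \<in> T"
    obtain a b where ab: "e = (a, b)" by force
    have "a < 2 * m" "b < 2 * m" using nc_less[OF T, of a b] e ab by auto
    then show "(case e of (a, b) \<Rightarrow> {pt m m a, pt m m b}) =
        (case map_prod (outer_pos m n) (outer_pos m n) e of (a, b) \<Rightarrow> {pt (m + n) (m + n) a, pt (m + n) (m + n) b})"
      by (simp add: ab g)
  qed
  moreover have "(\<lambda>e. shift ?D ` e) ` strands (diag_of y y U) =
    (\<lambda>(a, b). {pt (m + n) (m + n) a, pt (m + n) (m + n) b}) ` map_prod (inner_pos m) (inner_pos m) ` U"
    unfolding diag_of_def[of y] n[symmetric] image_image diagram.sel
  proof (intro image_cong refl)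
    fix e assume e: "e \<in> U"
    obtain a b where ab: "e = (a, b)" by force
    have "a < 2 * n" "b < 2 * n" using nc_less[OF U, of a b] e ab by auto
    then show "shift ?D ` (case e of (a, b) \<Rightarrow> {pt n n a, pt n n b}) =
        (case map_prod (inner_pos m) (inner_pos m) e of (a, b) \<Rightarrow> {pt (m + n) (m + n) a, pt (m + n) (m + n) b})"
      by (simp add: ab h)
  qed
  ultimately show ?thesis
    unfolding hcomp_diagram_def diag_of_def[of "comp1 x y"] len join_arcs_def image_Un by simp
qed

end

lemma boundary_colors_same:
  assumes "x \<noteq> []" "i \<le> length x - 1"
  shows "boundary_colors (diag_of x x T) ! i = x ! i"
    and "boundary_colors (diag_of x x T) ! (2 * (length x - 1) - i) = x ! i"
proof -
  have "i < length x" using assms by (cases x) auto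
  then show "boundary_colors (diag_of x x T) ! i = x ! i"
    using boundary_colors_lower[of i "diag_of x x T"] by simp
  show "boundary_colors (diag_of x x T) ! (2 * (length x - 1) - i) = x ! i"
    using boundary_colors_upper[of "diag_of x x T" i] assms \<open>i < length x\<close> by (simp add: mult_2)
qed

lemma diag_of_homset:
  assumes x: "one_morphism S x" and T: "T \<in> nc (2 * (length x - 1))"
    and col: "arcs_colored (boundary_colors (diag_of x x T)) T"
  shows "diag_of x x T \<in> homset S x x"
proof -
  have M: "2 * (length x - 1) = length x - 1 + (length x - 1)" by simp
  show ?thesis using assms matching_diag_of[OF T refl refl M] crossingless_diag_of[OF T refl refl M]
      arcs_diag_of[OF T refl refl M]
    by (simp add: homset_def colored_matching_iff)
qed

lemma homset_diag_of:
  assumes "D \<in> homset S x x"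
  obtains T where "T \<in> nc (2 * (length x - 1))" "D = diag_of x x T" "arcs D = T"
    "arcs_colored (boundary_colors D) T"
proof -
  have "D \<in> planar x x" using assms homset_planar by blast
  then show ?thesis using that[of "arcs D"] planar_arcs[of D x x] assms
    by (simp add: homset_def colored_matching_iff mult_2)
qed

lemma hcomp_diagram_homset:
  assumes x: "one_morphism S x" and y: "one_morphism S y" and xy: "last x = hd y"
    and D: "D \<in> homset S x x" and E: "E \<in> homset S y y"
  shows "hcomp_diagram D E \<in> homset S (comp1 x y) (comp1 x y)"
    and "arcs (hcomp_diagram D E) = join_arcs (length x - 1) (length y - 1) (arcs D) (arcs E)"
proof -
  define m where "m = length x - 1"
  define n where "n = length y - 1"
  define z where "z = comp1 x y"
  have ne: "x \<noteq> []" "y \<noteq> []" using x y by (auto simp: one_morphism_def)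
  have z: "one_morphism S z" "z \<noteq> []" using one_morphism_comp1[OF x y xy] by (auto simp: z_def one_morphism_def)
  have lz: "length z - 1 = m + n" using length_comp1[OF ne] by (simp add: m_def n_def z_def)
  obtain T where T: "T \<in> nc (2 * m)" "D = diag_of x x T" "arcs D = T" "arcs_colored (boundary_colors D) T"
    using homset_diag_of[OF D] unfolding m_def by blast
  obtain U where U: "U \<in> nc (2 * n)" "E = diag_of y y U" "arcs E = U" "arcs_colored (boundary_colors E) U"
    using homset_diag_of[OF E] unfolding n_def by blast
  define W where "W = join_arcs m n T U"
  have W: "W \<in> nc (2 * (m + n))" unfolding W_def by (rule join_arcs_nc[OF T(1) U(1)])
  have eq: "hcomp_diagram D E = diag_of z z W"
    unfolding T(2) U(2) z_def W_def by (rule hcomp_diagram_diag_of[OF ne xy m_def n_def T(1) U(1)])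
  let ?b = "boundary_colors (diag_of z z W)"
  have zl: "z ! i = x ! i" if "i \<le> m" for i
  proof -
    have "i < length x" using that ne(1) by (cases x) (auto simp: m_def)
    then show ?thesis by (simp add: z_def nth_comp1_left)
  qed
  have zr: "z ! (i + m) = y ! i" if "i \<le> n" for i
  proof -
    have "i < length y" using that ne(2) by (cases y) (auto simp: n_def)
    then show ?thesis using nth_comp1_right[OF ne xy] by (simp add: z_def m_def)
  qed
  have bz: "?b ! i = z ! i" "?b ! (2 * (m + n) - i) = z ! i" if "i \<le> m + n" for i
    using boundary_colors_same[OF z(2), of i W] that unfolding lz by simp_all
  have bx: "boundary_colors D ! i = x ! i" "boundary_colors D ! (2 * m - i) = x ! i" if "i \<le> m" for i
    using boundary_colors_same[OF ne(1), of i T] that by (simp_all add: T(2) m_def)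
  have b_y: "boundary_colors E ! i = y ! i" "boundary_colors E ! (2 * n - i) = y ! i" if "i \<le> n" for i
    using boundary_colors_same[OF ne(2), of i U] that by (simp_all add: U(2) n_def)
  \<comment> \<open>The rightmost interval \<open>m\<close> of \<open>D\<close> becomes two
    intervals, \<open>m\<close> on the bottom line and \<open>m + 2 * n\<close> on the top line.
    Both carry the shared colour, so both ranges may include \<open>i = m\<close>.\<close>
  have out1: "?b ! i = boundary_colors D ! i" if "i \<le> m" for i
    using that bz(1)[of i] bx(1)[of i] zl by simp
  have out2: "?b ! (i + 2 * n) = boundary_colors D ! i" if "m \<le> i" "i \<le> 2 * m" for i
  proof -
    have "2 * (m + n) - (2 * m - i) = i + 2 * n" "2 * m - (2 * m - i) = i" using that by auto
    then show ?thesis using that bz(2)[of "2 * m - i"] bx(2)[of "2 * m - i"] zl[of "2 * m - i"] by (simp add: add.commute)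
  qed
  have inn: "?b ! (i + m) = boundary_colors E ! i" if "i \<le> 2 * n" for i
  proof (cases "i \<le> n")
    case True
    then show ?thesis using bz(1)[of "i + m"] b_y(1)[of i] zr by simp
  next
    case False
    then have "2 * (m + n) - (2 * n - i + m) = i + m" "2 * n - (2 * n - i) = i" using that by auto
    moreover have le: "2 * n - i + m \<le> m + n" "2 * n - i \<le> n" using False that by auto
    ultimately show ?thesis using bz(2)[OF le(1)] b_y(2)[OF le(2)] zr[OF le(2)] by metis
  qed
  have "arcs_colored ?b W" unfolding arcs_colored_def
  proof safe
    fix a b assume "(a, b) \<in> W"
    then consider c d where "(c, d) \<in> T" "a = outer_pos m n c" "b = outer_pos m n d"
      | c d where "(c, d) \<in> U" "a = inner_pos m c" "b = inner_pos m d"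
      by (auto simp: W_def join_arcs_def)
    then have "?b ! a = ?b ! Suc b \<and> ?b ! Suc a = ?b ! b"
    proof cases
      case (1 c d)
      have cd: "c < d" "d < 2 * m" using nc_less[OF T(1) 1(1)] by auto
      have pos: "?b ! outer_pos m n i = boundary_colors D ! i"
        "?b ! Suc (outer_pos m n i) = boundary_colors D ! Suc i" if "i < 2 * m" for i
        using that out1[of i] out2[of i] out1[of "Suc i"] out2[of "Suc i"] by (auto simp: outer_pos_def)
      have "boundary_colors D ! c = boundary_colors D ! Suc d \<and> boundary_colors D ! Suc c = boundary_colors D ! d"
        using T(4) 1(1) by (auto simp: arcs_colored_def)
      then show ?thesis using pos[of c] pos[of d] cd unfolding 1(2,3) by simp
    next
      case (2 c d)
      have cd: "c < d" "d < 2 * n" using nc_less[OF U(1) 2(1)] by auto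
      have "boundary_colors E ! c = boundary_colors E ! Suc d \<and> boundary_colors E ! Suc c = boundary_colors E ! d"
        using U(4) 2(1) by (auto simp: arcs_colored_def)
      then show ?thesis using inn[of c] inn[of d] inn[of "Suc c"] inn[of "Suc d"] cd
        unfolding 2(2,3) by (simp add: inner_pos_def)
    qed
    then show "?b ! a = ?b ! Suc b" "?b ! Suc a = ?b ! b" by auto
  qed
  then show "hcomp_diagram D E \<in> homset S (comp1 x y) (comp1 x y)"
    unfolding eq unfolding z_def[symmetric] by (intro diag_of_homset[OF z(1)]) (use W lz in auto)
  have M: "2 * (m + n) = length z - 1 + (length z - 1)" using lz by simp
  show "arcs (hcomp_diagram D E) = join_arcs (length x - 1) (length y - 1) (arcs D) (arcs E)"
    unfolding eq using arcs_diag_of[OF W refl refl M] by (simp add: W_def T(3) U(3) m_def n_def)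
qed

section \<open>Killed elements under horizontal composition\<close>

context spin
begin

lemma wt_join_arcs:
  assumes T: "T \<in> nc (2 * m)" and U: "U \<in> nc (2 * n)"
  shows "wt (join_arcs m n T U) s = wt T (\<lambda>p. s (outer_pos m n p)) * wt U (\<lambda>p. s (inner_pos m p))"
proof -
  have inj: "inj (outer_pos m n)" "inj (inner_pos m)"
    by (auto intro!: injI simp: outer_pos_def inner_pos_def split: if_splits)
  have "wt (join_arcs m n T U) s = wt (map_prod (outer_pos m n) (outer_pos m n) ` T) s *
      wt (map_prod (inner_pos m) (inner_pos m) ` U) s"
    unfolding wt_def join_arcs_def
  proof (rule prod.union_disjoint)
    show "map_prod (outer_pos m n) (outer_pos m n) ` T \<inter> map_prod (inner_pos m) (inner_pos m) ` U = {}"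
    proof -
      have "outer_pos m n a \<noteq> inner_pos m c" if "(c, d) \<in> U" for a c d
        using outer_pos_range[of m n a] inner_pos_range[of c n m] nc_less[OF U that] by auto
      then show ?thesis by fastforce
    qed
  qed (use nc_finite[OF T] nc_finite[OF U] in auto)
  then show ?thesis by (simp add: wt_image inj)
qed

text \<open>The two contracted indices occur only in the argument of \<open>F\<close>, so
  \<open>G\<close> factors out of the contraction. The abstract embeddings \<open>g\<close> and
  \<open>h\<close> let the same argument serve for either factor of a horizontal composite.\<close>

lemma capf_product:
  assumes j: "g j' = j" "g (Suc j') = Suc j" and g: "\<And>p. p \<noteq> j' \<Longrightarrow> p \<noteq> Suc j' \<Longrightarrow> g p \<noteq> j \<and> g p \<noteq> Suc j"
    and h: "\<And>p. h p \<noteq> j \<and> h p \<noteq> Suc j" and F: "\<And>s. capf j' F s = 0"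
  shows "capf j (\<lambda>s. F (\<lambda>p. s (g p)) * G (\<lambda>p. s (h p))) s = 0"
proof -
  define f where "f = fill j True False s"
  have off: "fill j a b s i = f i" if "i \<noteq> j" "i \<noteq> Suc j" for a b i
    using that by (auto simp: f_def fill_def)
  have G: "(\<lambda>p. fill j a b s (h p)) = (\<lambda>p. f (h p))" for a b using off h by auto
  have F': "(\<lambda>p. fill j a b s (g p)) = fill j' a b (\<lambda>p. f (g (skip j' p)))" for a b
  proof
    fix p
    show "fill j a b s (g p) = fill j' a b (\<lambda>p. f (g (skip j' p))) p"
    proof (cases "p = j' \<or> p = Suc j'")
      case True
      then show ?thesis using j by auto
    next
      case False
      then obtain k where k: "p = skip j' k" using skip_cases by blast
      then show ?thesis using off[of "g p"] g[of p] False by simp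
    qed
  qed
  have "capf j (\<lambda>s. F (\<lambda>p. s (g p)) * G (\<lambda>p. s (h p))) s =
      capf j' F (\<lambda>p. f (g (skip j' p))) * G (\<lambda>p. f (h p))"
    unfolding capf_def G F' by (simp add: algebra_simps)
  then show ?thesis using F by simp
qed

lemma hcomp_cup_killed:
  assumes x: "one_morphism S x" and y: "one_morphism S y" and xy: "last x = hd y"
    and nb: "length x - 1 \<notin> Suc ` turnbacks (comp1 x y)"
    and f: "f \<in> cup_killed S \<delta> x" "id_coeff x f = 1" and g: "g \<in> cup_killed S \<delta> y" "id_coeff y g = 1"
  shows "hcomp f g \<in> cup_killed S \<delta> (comp1 x y)" "id_coeff (comp1 x y) (hcomp f g) = 1"
proof -
  define m where "m = length x - 1"
  define n where "n = length y - 1"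
  define z where "z = comp1 x y"
  have ne: "x \<noteq> []" "y \<noteq> []" using x y by (auto simp: one_morphism_def)
  have lz: "length z - 1 = m + n" using length_comp1[OF ne] by (simp add: m_def n_def z_def)
  have len: "length x = Suc m" "length y = Suc n" "length z = Suc (m + n)"
    using ne lz by (auto simp: m_def n_def z_def comp1_def)
  have Hf: "Poly_Mapping.keys f \<subseteq> homset S x x" and Hg: "Poly_Mapping.keys g \<subseteq> homset S y y"
    using f g by (auto simp: cup_killed_def Hom_iff)
  note hom = hcomp_diagram_homset[OF x y xy]
  have Hom: "hcomp f g \<in> Hom S z z" unfolding Hom_iff
  proof
    fix D assume "D \<in> Poly_Mapping.keys (hcomp f g)"
    from subsetD[OF Poly_Mapping.keys_sum this[unfolded hcomp_def]]
    obtain D' where D': "D' \<in> Poly_Mapping.keys f" "D \<in> Poly_Mapping.keys (\<Sum>E\<in>Poly_Mapping.keys g.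
        Poly_Mapping.single (hcomp_diagram D' E) (Poly_Mapping.lookup f D' * Poly_Mapping.lookup g E))"
      by auto
    from subsetD[OF Poly_Mapping.keys_sum D'(2)]
    obtain E where "E \<in> Poly_Mapping.keys g" "D = hcomp_diagram D' E" by (auto split: if_splits)
    then show "D \<in> homset S z z" using hom(1)[of D' E] D' Hf Hg by (auto simp: z_def)
  qed
  have nc: "arcs D \<in> nc (2 * m)" if "D \<in> homset S x x" for D
    using homset_diag_of[OF that] unfolding m_def by metis
  have nc': "arcs D \<in> nc (2 * n)" if "D \<in> homset S y y" for D
    using homset_diag_of[OF that] unfolding n_def by metis
  have Xi: "Xi (hcomp f g) = (\<lambda>s. Xi f (\<lambda>p. s (outer_pos m n p)) * Xi g (\<lambda>p. s (inner_pos m p)))"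
  proof
    fix s
    have "Xi (hcomp f g) s = (\<Sum>D\<in>Poly_Mapping.keys f. \<Sum>E\<in>Poly_Mapping.keys g.
      \<iota> (Poly_Mapping.lookup f D * Poly_Mapping.lookup g E) *
        (wt (arcs D) (\<lambda>p. s (outer_pos m n p)) * wt (arcs E) (\<lambda>p. s (inner_pos m p))))"
      unfolding hcomp_def Xi_sum Xi_single
    proof (intro sum.cong refl)
      fix D E assume "D \<in> Poly_Mapping.keys f" "E \<in> Poly_Mapping.keys g"
      then have D: "D \<in> homset S x x" and E: "E \<in> homset S y y" using Hf Hg by auto
      have "wt (arcs (hcomp_diagram D E)) s = wt (arcs D) (\<lambda>p. s (outer_pos m n p)) * wt (arcs E) (\<lambda>p. s (inner_pos m p))"
        unfolding hom(2)[OF D E] m_def[symmetric] n_def[symmetric] by (rule wt_join_arcs[OF nc[OF D] nc'[OF E]])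
      then show "\<iota> (Poly_Mapping.lookup f D * Poly_Mapping.lookup g E) * wt (arcs (hcomp_diagram D E)) s =
        \<iota> (Poly_Mapping.lookup f D * Poly_Mapping.lookup g E) *
        (wt (arcs D) (\<lambda>p. s (outer_pos m n p)) * wt (arcs E) (\<lambda>p. s (inner_pos m p)))" by simp
    qed
    also have "\<dots> = Xi f (\<lambda>p. s (outer_pos m n p)) * Xi g (\<lambda>p. s (inner_pos m p))"
      unfolding Xi_def sum_product by (simp add: \<iota>_mult mult_ac)
    finally show "Xi (hcomp f g) s = Xi f (\<lambda>p. s (outer_pos m n p)) * Xi g (\<lambda>p. s (inner_pos m p))" .
  qed
  have kf: "capf j (Xi f) s = 0" if "j \<in> turnbacks x" "Suc j < m" for j s
    using f that by (auto simp: cup_killed_iff killed_def m_def)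
  have kg: "capf j (Xi g) s = 0" if "j \<in> turnbacks y" "Suc j < n" for j s
    using g that by (auto simp: cup_killed_iff killed_def n_def)
  have "capf j (Xi (hcomp f g)) s = 0" if j: "j \<in> turnbacks z" "Suc j < m + n" for j s
  proof -
    \<comment> \<open>A cup across the seam would end at the points \<open>m - 1\<close> and
      \<open>m\<close>; the hypothesis on turnbacks excludes it.\<close>
    have "Suc j \<noteq> m" using nb j(1) unfolding m_def z_def by (metis imageI)
    then consider "Suc j < m" | j' where "j = j' + m" by (metis Suc_lessI le_add_diff_inverse2 not_less not_less_eq)
    then show ?thesis
    proof cases
      case 1
      then have "j \<in> turnbacks x"
        using j(1) nth_comp1_left[of j x y] nth_comp1_left[of "j + 2" x y]
        by (auto simp: turnbacks_def z_def len)
      show ?thesis unfolding Xi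
      proof (rule capf_product[where g = "outer_pos m n" and h = "inner_pos m" and F = "Xi f" and G = "Xi g" and j' = j])
        show "outer_pos m n p \<noteq> j \<and> outer_pos m n p \<noteq> Suc j" if "p \<noteq> j" "p \<noteq> Suc j" for p
          using that 1 by (auto simp: outer_pos_def)
        show "inner_pos m p \<noteq> j \<and> inner_pos m p \<noteq> Suc j" for p
          using 1 by (auto simp: inner_pos_def)
      qed (use 1 kf[OF \<open>j \<in> turnbacks x\<close>] in \<open>auto simp: outer_pos_def\<close>)
    next
      case (2 j')
      have "j' \<in> turnbacks y"
        using j nth_comp1_right[OF ne xy, of j'] nth_comp1_right[OF ne xy, of "j' + 2"] 2
        by (auto simp: turnbacks_def z_def[symmetric] len add.commute add.left_commute)
      have "capf j (\<lambda>s. Xi g (\<lambda>p. s (inner_pos m p)) * Xi f (\<lambda>p. s (outer_pos m n p))) s = 0"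
      proof (rule capf_product[where g = "inner_pos m" and h = "outer_pos m n" and F = "Xi g" and G = "Xi f" and j' = j'])
        show "inner_pos m p \<noteq> j \<and> inner_pos m p \<noteq> Suc j" if "p \<noteq> j'" "p \<noteq> Suc j'" for p
          using that 2 by (auto simp: inner_pos_def)
        show "outer_pos m n p \<noteq> j \<and> outer_pos m n p \<noteq> Suc j" for p
          using 2 j by (auto simp: outer_pos_def)
      qed (use 2 j kg[OF \<open>j' \<in> turnbacks y\<close>] in \<open>auto simp: inner_pos_def\<close>)
      then show ?thesis unfolding Xi by (simp add: mult.commute)
    qed
  qed
  then show "hcomp f g \<in> cup_killed S \<delta> (comp1 x y)"
    using Hom lz unfolding cup_killed_iff z_def[symmetric] by (simp add: killed_def)
  have iff: "hcomp_diagram D E = id_diagram z \<longleftrightarrow> D = id_diagram x \<and> E = id_diagram y"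
    if D: "D \<in> homset S x x" and E: "E \<in> homset S y y" for D E
  proof
    assume "hcomp_diagram D E = id_diagram z"
    then have "join_arcs m n (arcs D) (arcs E) = id_arcs (m + n)"
      using hom(2)[OF D E] arcs_id_diagram[of z] lz by (simp add: m_def n_def)
    from join_arcs_eq_id[OF nc[OF D] nc'[OF E] this]
    have "arcs D = arcs (id_diagram x)" "arcs E = arcs (id_diagram y)" by (simp_all add: arcs_id_diagram m_def n_def)
    then show "D = id_diagram x \<and> E = id_diagram y"
      using inj_onD[OF inj_on_arcs] D E homset_planar id_diagram_homset[OF x] id_diagram_homset[OF y] by blast
  next
    assume "D = id_diagram x \<and> E = id_diagram y"
    then have "hcomp_diagram D E = diag_of z z (join_arcs m n (id_arcs m) (id_arcs n))"
      using hcomp_diagram_diag_of[OF ne xy m_def n_def id_arcs_nc id_arcs_nc]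
      by (simp add: id_diagram_eq z_def m_def n_def)
    then show "hcomp_diagram D E = id_diagram z" unfolding join_arcs_id id_diagram_eq[of z] lz .
  qed
  have "id_coeff z (hcomp f g) = (\<Sum>D\<in>Poly_Mapping.keys f. \<Sum>E\<in>Poly_Mapping.keys g.
      if hcomp_diagram D E = id_diagram z then Poly_Mapping.lookup f D * Poly_Mapping.lookup g E else 0)"
    unfolding id_coeff_def hcomp_def lookup_sum lookup_single when_def ..
  also have "\<dots> = (\<Sum>D\<in>Poly_Mapping.keys f. \<Sum>E\<in>Poly_Mapping.keys g.
      (if D = id_diagram x then Poly_Mapping.lookup f D else 0) * (if E = id_diagram y then Poly_Mapping.lookup g E else 0))"
    by (intro sum.cong refl) (use iff Hf Hg in auto)
  also have "\<dots> = (\<Sum>D\<in>Poly_Mapping.keys f. if D = id_diagram x then Poly_Mapping.lookup f D else 0) *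
      (\<Sum>E\<in>Poly_Mapping.keys g. if E = id_diagram y then Poly_Mapping.lookup g E else 0)"
    by (simp only: sum_product)
  also have "\<dots> = id_coeff x f * id_coeff y g"
    by (simp add: sum.delta' sum.delta id_coeff_def in_keys_iff)
  finally show "id_coeff (comp1 x y) (hcomp f g) = 1" using f g by (simp add: z_def)
qed

end

section \<open>Maximal alternating subsequences\<close>

lemma alternating_iff:
  "alternating y \<longleftrightarrow> y \<noteq> [] \<and> distinct_adj y \<and> (\<forall>i. i + 2 < length y \<longrightarrow> y ! i = y ! (i + 2))"
proof -
  have "card (set y) \<le> 2 \<longleftrightarrow> (\<forall>i. i + 2 < length y \<longrightarrow> y ! i = y ! (i + 2))"
    if y: "y \<noteq> []" "distinct_adj y"
  proof
    assume c: "card (set y) \<le> 2"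
    show "\<forall>i. i + 2 < length y \<longrightarrow> y ! i = y ! (i + 2)"
    proof (intro allI impI)
      fix i assume i: "i + 2 < length y"
      have ne: "y ! i \<noteq> y ! Suc i" "y ! Suc i \<noteq> y ! Suc (Suc i)"
        using y(2) i by (auto simp: distinct_adj_conv_nth)
      show "y ! i = y ! (i + 2)"
      proof (rule ccontr)
        assume "y ! i \<noteq> y ! (i + 2)"
        then have "card {y ! i, y ! Suc i, y ! Suc (Suc i)} = 3" using ne by simp
        moreover have "{y ! i, y ! Suc i, y ! Suc (Suc i)} \<subseteq> set y" using i by auto
        ultimately show False using card_mono[OF finite_set, of "{y ! i, y ! Suc i, y ! Suc (Suc i)}" y] c by linarith
      qed
    qed
  next
    assume alt: "\<forall>i. i + 2 < length y \<longrightarrow> y ! i = y ! (i + 2)"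
    have "y ! i \<in> {y ! 0, y ! 1}" if "i < length y" for i
      using that
    proof (induction i rule: less_induct)
      case (less i)
      show ?case
      proof (cases "i < 2")
        case True
        then show ?thesis by (cases i) auto
      next
        case False
        then show ?thesis using less.IH[of "i - 2"] alt[rule_format, of "i - 2"] less.prems by (simp add: Suc_Suc_minus_2)
      qed
    qed
    then have "set y \<subseteq> {y ! 0, y ! 1}" by (metis in_set_conv_nth subsetI)
    then have "card (set y) \<le> card {y ! 0, y ! 1}" by (intro card_mono) auto
    also have "\<dots> \<le> 2" by (simp add: card_insert_if)
    finally show "card (set y) \<le> 2" .
  qed
  then show ?thesis by (auto simp: alternating_def)
qed

lemma length_slice: "j \<le> length x \<Longrightarrow> length (slice x i j) = j - i"
  by (auto simp: slice_def)

lemma nth_slice: "i + l < j \<Longrightarrow> j \<le> length x \<Longrightarrow> slice x i j ! l = x ! (i + l)"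
  by (simp add: slice_def)

lemma one_morphism_slice:
  assumes "one_morphism S x" "i < j" "j \<le> length x"
  shows "one_morphism S (slice x i j)"
proof -
  have "slice x i j \<noteq> []" using assms length_slice[of j x i] by auto
  moreover have "distinct_adj (slice x i j)"
    using assms(1) unfolding one_morphism_def slice_def by (metis append_take_drop_id distinct_adj_appendD1 distinct_adj_appendD2)
  moreover have "set (slice x i j) \<subseteq> set x"
    unfolding slice_def by (meson set_drop_subset set_take_subset subset_trans)
  ultimately show ?thesis using assms(1) by (auto simp: one_morphism_def)
qed

lemma alternating_at_iff:
  assumes "one_morphism S x"
  shows "alternating_at x i j \<longleftrightarrow> i < j \<and> j \<le> length x \<and> (\<forall>l. i \<le> l \<and> l + 2 < j \<longrightarrow> l \<in> turnbacks x)"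
proof -
  have "alternating (slice x i j) \<longleftrightarrow> (\<forall>l. i \<le> l \<and> l + 2 < j \<longrightarrow> l \<in> turnbacks x)"
    if ij: "i < j" "j \<le> length x"
  proof -
    have "alternating (slice x i j) \<longleftrightarrow> (\<forall>l. l + 2 < j - i \<longrightarrow> x ! (i + l) = x ! (i + l + 2))"
      using one_morphism_slice[OF assms ij] ij
      by (auto simp: alternating_iff one_morphism_def length_slice nth_slice add.assoc)
    also have "\<dots> \<longleftrightarrow> (\<forall>l. i \<le> l \<and> l + 2 < j \<longrightarrow> x ! l = x ! (l + 2))"
    proof safe
      fix l assume *: "\<forall>l. l + 2 < j - i \<longrightarrow> x ! (i + l) = x ! (i + l + 2)" "i \<le> l" "l + 2 < j"
      then show "x ! l = x ! (l + 2)" using *(1)[rule_format, of "l - i"] by simp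
    next
      fix l assume "\<forall>l. i \<le> l \<and> l + 2 < j \<longrightarrow> x ! l = x ! (l + 2)" "l + 2 < j - i"
      then show "x ! (i + l) = x ! (i + l + 2)" by (auto simp: less_diff_conv)
    qed
    also have "\<dots> \<longleftrightarrow> (\<forall>l. i \<le> l \<and> l + 2 < j \<longrightarrow> l \<in> turnbacks x)"
      using ij by (auto simp: turnbacks_def)
    finally show ?thesis .
  qed
  then show ?thesis by (auto simp: alternating_at_def)
qed

lemma set_max_alternating:
  "set (max_alternating x) = {slice x i j |i j. max_alternating_at x i j}"
proof -
  have mem: "y \<in> set (if P then [a] else []) \<longleftrightarrow> P \<and> y = a" for y a :: "'a list" and P by auto
  have "y \<in> set (max_alternating x) \<longleftrightarrow>
      (\<exists>i\<in>{0..<length x}. \<exists>j\<in>{0..<Suc (length x)}. max_alternating_at x i j \<and> y = slice x i j)" for y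
    unfolding max_alternating_def set_concat set_map UN_iff image_iff bex_simps set_upt
    by (simp only: set_concat set_map UN_iff set_upt mem image_image)
  moreover have "i \<in> {0..<length x} \<and> j \<in> {0..<Suc (length x)}" if "max_alternating_at x i j" for i j
    using that by (auto simp: max_alternating_at_def alternating_at_def)
  ultimately show ?thesis by blast
qed

lemma max_alternating_slice:
  assumes "one_morphism S x" "y \<in> set (max_alternating x)"
  shows "one_morphism S y" "alternating y"
  using assms one_morphism_slice[of S x]
  by (auto simp: set_max_alternating max_alternating_at_def alternating_at_def)

text \<open>For the second part: a turnback with only one of \<open>l\<close> and
  \<open>Suc l\<close> in the block would prolong the alternating slice by a colour on that side,
  against maximality. The bound is \<open>j - 1\<close> because a slice of colours
  \<open>i, ..., j - 1\<close> has the points \<open>i, ..., j - 2\<close>.\<close>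

lemma max_alternating_at_turnbacks:
  assumes x: "one_morphism S x" and max: "max_alternating_at x i j"
  shows "i \<le> l \<Longrightarrow> l + 2 < j \<Longrightarrow> l \<in> turnbacks x"
    and "l \<in> turnbacks x \<Longrightarrow> l \<in> {i..<j - 1} \<longleftrightarrow> Suc l \<in> {i..<j - 1}"
proof -
  note iff = alternating_at_iff[OF x]
  have ij: "i < j" "j \<le> length x" and alt: "\<And>l. i \<le> l \<Longrightarrow> l + 2 < j \<Longrightarrow> l \<in> turnbacks x"
    using max by (auto simp: max_alternating_at_def iff)
  then show "i \<le> l \<Longrightarrow> l + 2 < j \<Longrightarrow> l \<in> turnbacks x" by blast
  assume l: "l \<in> turnbacks x"
  have "\<not> (Suc l = i \<and> i < j - 1)"
  proof
    assume *: "Suc l = i \<and> i < j - 1"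
    have "m \<in> turnbacks x" if "l \<le> m" "m + 2 < j" for m
      using alt[of m] that l * by (cases "m = l") auto
    then have "alternating_at x l j" using ij * by (auto simp: iff)
    then have "l = i" using max * unfolding max_alternating_at_def by force
    then show False using * by simp
  qed
  moreover have "\<not> (Suc l = j - 1 \<and> i \<le> l)"
  proof
    assume *: "Suc l = j - 1 \<and> i \<le> l"
    have "m \<in> turnbacks x" if "i \<le> m" "m + 2 < Suc j" for m
      using alt[of m] that l * by (cases "m = l") auto
    moreover have "Suc j \<le> length x" using l * by (auto simp: turnbacks_def)
    ultimately have "alternating_at x i (Suc j)" using ij by (auto simp: iff)
    then have "Suc j = j" using max unfolding max_alternating_at_def by force
    then show False by simp
  qed
  ultimately show "l \<in> {i..<j - 1} \<longleftrightarrow> Suc l \<in> {i..<j - 1}" by auto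
qed

lemma upt_split: "i \<le> j \<Longrightarrow> j \<le> k \<Longrightarrow> [i..<k] = [i..<j] @ [j..<k]"
  using upt_add_eq_append[of i j "k - j"] by simp

text \<open>Groups \<open>max_alternating\<close> by starting index, so that the ranges of starts
  and ends can be cut independently.\<close>

definition row :: "'c list \<Rightarrow> nat \<Rightarrow> nat list \<Rightarrow> 'c list list" where
  "row x i js = concat (map (\<lambda>j. if max_alternating_at x i j then [slice x i j] else []) js)"

lemma max_alternating_rows: "max_alternating x = concat (map (\<lambda>i. row x i [0..<Suc (length x)]) [0..<length x])"
  by (simp add: max_alternating_def row_def)

lemma row_append: "row x i (js @ ks) = row x i js @ row x i ks"
  by (simp add: row_def)

lemma row_Nil: "(\<And>j. j \<in> set js \<Longrightarrow> \<not> max_alternating_at x i j) \<Longrightarrow> row x i js = []"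
  by (simp add: row_def)

lemma row_single:
  assumes "m < n" "\<And>j. max_alternating_at x i j \<longleftrightarrow> j = m"
  shows "row x i [0..<n] = [slice x i m]"
proof -
  have "[0..<n] = [0..<m] @ [m] @ [Suc m..<n]"
  proof -
    have "[0..<n] = [0..<m] @ [m..<n]" using assms(1) by (intro upt_split) simp_all
    then show ?thesis using assms(1) by (simp add: upt_conv_Cons)
  qed
  moreover have "row x i [0..<m] = []" "row x i [Suc m..<n] = []"
    by (rule row_Nil; use assms(2) in auto)+
  moreover have "row x i [m] = [slice x i m]" using assms(2) by (simp add: row_def)
  ultimately show ?thesis by (simp only: row_append append_Nil append_Nil2)
qed

lemma concat_Nil: "(\<And>i. i \<in> set is \<Longrightarrow> f i = []) \<Longrightarrow> concat (map f is) = []"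
  by simp

lemma max_alternating_alternating:
  assumes x: "one_morphism S x" and "alternating x"
  shows "max_alternating x = [x]"
proof -
  have x0: "0 < length x" using x by (simp add: one_morphism_def)
  have "alternating_at x 0 (length x)" using assms x0 by (simp add: alternating_at_def slice_def)
  then have max: "max_alternating_at x i j \<longleftrightarrow> i = 0 \<and> j = length x" for i j
    unfolding max_alternating_at_def by (auto simp: alternating_at_def)
  have "[0..<length x] = [0] @ [1..<length x]" using x0 by (simp add: upt_conv_Cons)
  moreover have "row x 0 [0..<Suc (length x)] = [slice x 0 (length x)]"
    by (rule row_single) (use max in auto)
  moreover have "concat (map (\<lambda>i. row x i [0..<Suc (length x)]) [1..<length x]) = []"
    by (rule concat_Nil, rule row_Nil) (use max in auto)
  ultimately show ?thesis
    by (simp only: max_alternating_rows map_append concat_append list.map concat.simps append_Nil2 append_Nil)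
      (simp add: slice_def)
qed

lemma max_alternating_split:
  assumes x: "one_morphism S x" and "\<not> alternating x"
  obtains y z where "x = comp1 y z" "last y = hd z" "one_morphism S y" "one_morphism S z" "length z < length x"
    "alternating y" "length y - 1 \<notin> Suc ` turnbacks x" "max_alternating x = y # max_alternating z"
proof -
  note iff = alternating_at_iff[OF x]
  have x0: "0 < length x" using x by (simp add: one_morphism_def)
  have "\<not> alternating_at x 0 (length x)" using assms(2) by (simp add: alternating_at_def slice_def)
  then have "\<exists>l. l + 2 < length x \<and> l \<notin> turnbacks x" using x0 by (auto simp: iff)
  then obtain l where l: "l + 2 < length x" "l \<notin> turnbacks x"
    and least: "\<And>m. m < l \<Longrightarrow> m \<in> turnbacks x"
  proof -
    assume ex: "\<exists>l. l + 2 < length x \<and> l \<notin> turnbacks x"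
      and thesis: "\<And>l. l + 2 < length x \<Longrightarrow> l \<notin> turnbacks x \<Longrightarrow> (\<And>m. m < l \<Longrightarrow> m \<in> turnbacks x) \<Longrightarrow> thesis"
    define l where "l = (LEAST l. l + 2 < length x \<and> l \<notin> turnbacks x)"
    have l: "l + 2 < length x" "l \<notin> turnbacks x" using LeastI_ex[OF ex] by (auto simp: l_def)
    have "m \<in> turnbacks x" if "m < l" for m
      using not_less_Least[of m "\<lambda>l. l + 2 < length x \<and> l \<notin> turnbacks x"] that l(1) by (auto simp: l_def)
    then show thesis using thesis l by blast
  qed
  \<comment> \<open>\<open>d\<close> is the index of the colour shared by \<open>y\<close> and
    \<open>z\<close>. The seam lies between the points \<open>l\<close> and \<open>d\<close>, and no
    cup crosses it because \<open>l\<close> is not a turnback.\<close>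
  define d where "d = Suc l"
  define y where "y = slice x 0 (Suc d)"
  define z where "z = drop d x"
  have y: "one_morphism S y" unfolding y_def by (rule one_morphism_slice[OF x]) (use l in \<open>auto simp: d_def\<close>)
  have z_slice: "z = slice x d (length x)" by (simp add: z_def slice_def)
  have z: "one_morphism S z" unfolding z_slice by (rule one_morphism_slice[OF x]) (use l in \<open>auto simp: d_def\<close>)
  have len: "length z = length x - d" "length y = Suc d" using l by (auto simp: z_def y_def length_slice d_def)
  have xyz: "x = comp1 y z"
    unfolding comp1_def y_def z_def slice_def by (simp add: tl_drop flip: drop_Suc)
  have last: "last y = hd z"
    using len l y by (simp add: last_conv_nth one_morphism_def) (simp add: y_def z_def nth_slice hd_drop_conv_nth d_def)
  have alt_y: "alternating_at x 0 (Suc d)" using l least by (auto simp: iff d_def)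
  then have y_alt: "alternating y" by (simp add: alternating_at_def y_def)
  have no: "\<not> alternating_at x i j" if "i \<le> l" "l + 2 < j" for i j
    using that l(2) by (auto simp: iff)
  have shift: "alternating_at x (i + d) (j + d) \<longleftrightarrow> alternating_at z i j" for i j
    using l unfolding alternating_at_def len(1) by (auto simp: z_def slice_def d_def add.commute)
  have max0: "max_alternating_at x 0 j \<longleftrightarrow> j = Suc d" for j
  proof
    assume m: "max_alternating_at x 0 j"
    then have "j \<le> Suc d" using no[of 0 j] by (intro leI notI) (auto simp: max_alternating_at_def d_def)
    then show "j = Suc d" using m alt_y unfolding max_alternating_at_def by fastforce
  next
    assume "j = Suc d"
    moreover have "i' = 0 \<and> j' = Suc d" if "alternating_at x i' j'" "i' \<le> 0" "Suc d \<le> j'" for i' j'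
      using no[of i' j'] that by (intro conjI le_antisym[of j'] leI notI) (auto simp: d_def)
    ultimately show "max_alternating_at x 0 j" using alt_y by (auto simp: max_alternating_at_def)
  qed
  have max1: "\<not> max_alternating_at x i j" if "0 < i" "i < d" for i j
  proof
    assume m: "max_alternating_at x i j"
    then have "alternating_at x i j" by (simp add: max_alternating_at_def)
    then have "j \<le> Suc d" using no[of i j] that by (intro leI notI) (auto simp: d_def)
    then have "0 = i \<and> Suc d = j" using m alt_y unfolding max_alternating_at_def by blast
    then show False using that by simp
  qed
  have max2: "max_alternating_at x (i + d) (j + d) \<longleftrightarrow> max_alternating_at z i j" for i j
  proof
    assume m: "max_alternating_at x (i + d) (j + d)"
    show "max_alternating_at z i j" unfolding max_alternating_at_def
    proof (intro conjI allI impI)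
      show "alternating_at z i j" using m shift by (simp add: max_alternating_at_def)
      fix i' j' assume "alternating_at z i' j' \<and> i' \<le> i \<and> j \<le> j'"
      then have "alternating_at x (i' + d) (j' + d) \<and> i' + d \<le> i + d \<and> j + d \<le> j' + d" using shift by simp
      then have "i' + d = i + d \<and> j' + d = j + d" using m unfolding max_alternating_at_def by blast
      then show "i' = i" "j' = j" by simp_all
    qed
  next
    assume m: "max_alternating_at z i j"
    then have ij: "i < j" by (simp add: max_alternating_at_def alternating_at_def)
    show "max_alternating_at x (i + d) (j + d)" unfolding max_alternating_at_def
    proof (rule conjI)
      show "alternating_at x (i + d) (j + d)" using m shift by (simp add: max_alternating_at_def)
      show "\<forall>i' j'. alternating_at x i' j' \<and> i' \<le> i + d \<and> j + d \<le> j' \<longrightarrow> i' = i + d \<and> j' = j + d"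
      proof (intro allI impI)
        fix i' j' assume *: "alternating_at x i' j' \<and> i' \<le> i + d \<and> j + d \<le> j'"
        show "i' = i + d \<and> j' = j + d"
        proof (cases "d \<le> i'")
          case True
          then obtain i'' j'' where "i' = i'' + d" "j' = j'' + d"
            using * by (metis le_add_diff_inverse2 le_add2 order_trans)
          then show ?thesis using * m shift unfolding max_alternating_at_def by auto
        next
          case False
          \<comment> \<open>A slice that begins before \<open>d\<close> cannot reach past
            \<open>l + 2\<close>, so inside \<open>z\<close> it covers just the single colour with
            index 0; that one is not maximal in \<open>z\<close>, since the first two colours of
            \<open>z\<close> alternate.\<close>
          then have "j' \<le> l + 2" using no[of i' j'] * False by (intro leI notI) (auto simp: d_def)
          then have "i = 0" "j = 1" using * ij by (auto simp: d_def)
          moreover have "alternating_at z 0 2"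
            using l by (auto simp: alternating_at_iff[OF z] len d_def)
          ultimately have "2 = (1 :: nat)" using m unfolding max_alternating_at_def by fastforce
          then show ?thesis by simp
        qed
      qed
    qed
  qed
  have row2: "row x (i + d) [0..<Suc (length x)] = row z i [0..<Suc (length z)]" for i
  proof -
    have "map (\<lambda>j. j + d) [0..<Suc (length z)] = [d..<Suc (length x)]"
    proof -
      have "Suc (length z) + d = Suc (length x)" using l by (simp add: len d_def)
      then show ?thesis by (simp only: map_add_upt)
    qed
    then have "[0..<Suc (length x)] = [0..<d] @ map (\<lambda>j. j + d) [0..<Suc (length z)]"
      using l by (simp only:) (intro upt_split, simp_all add: d_def)
    moreover have "row x (i + d) [0..<d] = []"
      by (rule row_Nil) (auto simp: max_alternating_at_def alternating_at_def)
    moreover have "row x (i + d) (map (\<lambda>j. j + d) js) = row z i js" for js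
    proof -
      have sl: "slice x (i + d) (j + d) = slice z i j" for j by (simp add: slice_def z_def add.commute)
      show ?thesis unfolding row_def map_map o_def max2 sl ..
    qed
    ultimately show ?thesis by (simp only: row_append append_Nil)
  qed
  have "[0..<length x] = [0] @ [1..<d] @ map (\<lambda>i. i + d) [0..<length z]"
  proof -
    have "[0..<length x] = [0..<d] @ [d..<length x]" using l
      by (intro upt_split) (simp_all add: d_def)
    moreover have "[0..<d] = [0] @ [1..<d]" by (simp add: d_def upt_conv_Cons)
    moreover have "[d..<length x] = map (\<lambda>i. i + d) [0..<length z]"
    proof -
      have "length z + d = length x" using l by (simp add: len d_def)
      then show ?thesis by (simp only: map_add_upt)
    qed
    ultimately show ?thesis by (simp only: append_assoc)
  qed
  moreover have "row x 0 [0..<Suc (length x)] = [y]"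
    unfolding y_def by (rule row_single) (use l max0 in \<open>auto simp: d_def\<close>)
  moreover have "concat (map (\<lambda>i. row x i [0..<Suc (length x)]) [1..<d]) = []"
    by (rule concat_Nil, rule row_Nil) (use max1 in auto)
  ultimately have "max_alternating x = y # max_alternating z"
    unfolding max_alternating_rows[of x] max_alternating_rows[of z]
    by (simp only: map_append concat_append list.map concat.simps append_Nil2 append_Nil map_map o_def row2 append_Cons)
  moreover have "length y - 1 \<notin> Suc ` turnbacks x" using l by (auto simp: len d_def)
  moreover have "length z < length x" using len x0 by (simp add: d_def)
  ultimately show ?thesis using that[of y z] xyz last y z y_alt by blast
qed

section \<open>Adjoining a square root of the loop parameter\<close>

text \<open>
  The product of the rings \<open>'k[q] / (q\<^sup>2 - d q + 1)\<close> over all \<open>d\<close> in \<open>'k\<close>, so that the type does not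
  depend on the loop parameter; the elements of each factor are \<open>a + b q\<close>.
\<close>

datatype 'k quad = Quad (const_part: "'k \<Rightarrow> 'k") (q_part: "'k \<Rightarrow> 'k")

instantiation quad :: (comm_ring_1) comm_ring_1
begin

definition "0 = Quad (\<lambda>_. 0) (\<lambda>_. 0)"
definition "1 = Quad (\<lambda>_. 1) (\<lambda>_. 0)"
definition "r + s = Quad (\<lambda>d. const_part r d + const_part s d) (\<lambda>d. q_part r d + q_part s d)"
definition "r - s = Quad (\<lambda>d. const_part r d - const_part s d) (\<lambda>d. q_part r d - q_part s d)"
definition "- r = Quad (\<lambda>d. - const_part r d) (\<lambda>d. - q_part r d)"
definition "r * s = Quad (\<lambda>d. const_part r d * const_part s d - q_part r d * q_part s d)
  (\<lambda>d. const_part r d * q_part s d + q_part r d * const_part s d + d * q_part r d * q_part s d)"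

instance
proof
  fix a b c :: "'a quad"
  show "a * b * c = a * (b * c)" by (simp add: times_quad_def algebra_simps)
  show "a * b = b * a" by (simp add: times_quad_def algebra_simps)
  show "(0 :: 'a quad) \<noteq> 1" by (simp add: zero_quad_def one_quad_def fun_eq_iff)
qed (auto simp: zero_quad_def one_quad_def plus_quad_def minus_quad_def uminus_quad_def times_quad_def
    algebra_simps intro!: quad.expand)

end

text \<open>Supported in the factor \<open>d = \<delta>\<close> alone;
  \<open>quad_embed \<delta> 1\<close> is the idempotent of that factor, which is why
  \<open>spin\<close> does not ask \<iota> to preserve 1.\<close>

definition quad_embed :: "'k::comm_ring_1 \<Rightarrow> 'k \<Rightarrow> 'k quad" where
  "quad_embed \<delta> a = Quad (\<lambda>d. if d = \<delta> then a else 0) (\<lambda>_. 0)"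

text \<open>The relation \<open>q * q - d * q + 1 = 0\<close> says that
  \<open>q * (d - q) = 1\<close>; hence \<open>q' = d - q\<close> and \<open>q + q' = d\<close>,
  which equals \<delta> in the factor that the embedding uses.\<close>

lemma spin_quad:
  "spin \<delta> (Quad (\<lambda>_. 0) (\<lambda>_. 1)) (Quad (\<lambda>d. d) (\<lambda>_. -1)) (quad_embed \<delta>) (\<lambda>r. const_part r \<delta>)"
  by unfold_locales
    (auto simp: quad_embed_def one_quad_def plus_quad_def times_quad_def fun_eq_iff algebra_simps)

section \<open>Existence for alternating words\<close>

lemma alternating_nth:
  assumes "alternating y" "i < length y"
  shows "y ! i = y ! (i mod 2)"
  using assms(2)
proof (induction i rule: less_induct)
  case (less i)
  show ?case
  proof (cases "i < 2")
    case False
    then obtain k where k: "i = k + 2" by (metis le_add_diff_inverse2 not_less)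
    then show ?thesis using less.IH[of k] less.prems assms(1) by (simp add: alternating_iff)
  qed simp
qed

text \<open>The colours of boundary intervals depend only on parity, and by \<open>nc_odd\<close> an
  arc joins points of opposite parity. So every uncoloured matching is available on an alternating
  word.\<close>

lemma alternating_homset:
  assumes y: "one_morphism S y" "alternating y" and T: "T \<in> nc (2 * (length y - 1))"
  shows "diag_of y y T \<in> homset S y y"
proof (rule diag_of_homset[OF y(1) T])
  define n where "n = length y - 1"
  have ne: "y \<noteq> []" and len: "length y = Suc n" using y(1) by (auto simp: one_morphism_def n_def)
  let ?b = "boundary_colors (diag_of y y T)"
  have b: "?b ! i = y ! (i mod 2)" if "i \<le> 2 * n" for i
  proof (cases "i \<le> n")
    case True
    then show ?thesis using boundary_colors_same(1)[OF ne, of i T] alternating_nth[OF y(2), of i] len by simp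
  next
    case False
    then have e: "2 * n - (2 * n - i) = i" and le: "2 * n - i \<le> n" using that by auto
    have "?b ! i = y ! (2 * n - i)"
      using boundary_colors_same(2)[OF ne, of "2 * n - i" T] le unfolding n_def[symmetric] e by blast
    also have "\<dots> = y ! ((2 * n - i) mod 2)" by (rule alternating_nth[OF y(2)]) (use le len in simp)
    also have "(2 * n - i) mod 2 = i mod 2"
    proof -
      have "even (2 * n - i) \<longleftrightarrow> even i" using even_diff_nat[of "2 * n" i] that by auto
      then show ?thesis by (simp only: mod2_eq_if)
    qed
    finally show ?thesis .
  qed
  show "arcs_colored ?b T" unfolding arcs_colored_def
  proof safe
    fix a c assume ac: "(a, c) \<in> T"
    have less: "a < c" "c < 2 * n" using nc_less[OF T ac] by (auto simp: n_def)
    have "odd (c - a)" by (rule nc_odd[OF T ac])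
    then have "a mod 2 = Suc c mod 2" "Suc a mod 2 = c mod 2" using less by (auto simp: mod2_eq_if)
    then show "?b ! a = ?b ! Suc c" "?b ! Suc a = ?b ! c"
      using b[of a] b[of "Suc c"] b[of "Suc a"] b[of c] less by auto
  qed
qed

text \<open>The sum runs over a fixed set of diagrams instead of \<open>keys\<close>: coefficients
  may vanish under a change of ring, and in this form the two rings can be compared term by
  term.\<close>

lemma vcomp_sum_single:
  assumes "finite A"
  shows "vcomp \<delta> (\<Sum>D\<in>A. Poly_Mapping.single D (h D)) (basis c) =
    (\<Sum>D\<in>A. Poly_Mapping.single (vcomp_diagram D c) (h D * (- \<delta>) ^ card (circles D c)))"
proof -
  let ?f = "\<Sum>D\<in>A. Poly_Mapping.single D (h D)"
  have lookup: "Poly_Mapping.lookup ?f D = (if D \<in> A then h D else 0)" for D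
    using assms by (simp add: lookup_sum lookup_single when_def sum.delta')
  have "Poly_Mapping.keys ?f \<subseteq> A" by (auto simp: in_keys_iff lookup split: if_splits)
  then have "vcomp \<delta> ?f (basis c) = (\<Sum>D\<in>A. Poly_Mapping.single (vcomp_diagram D c)
      (Poly_Mapping.lookup ?f D * (- \<delta>) ^ card (circles D c)))"
    unfolding vcomp_basis using assms by (intro sum.mono_neutral_left) (auto simp: in_keys_iff)
  then show ?thesis by (simp add: lookup)
qed

lemma JW_alternating:
  fixes \<delta> :: "'k::comm_ring_1" and y :: "'c list"
  assumes y: "one_morphism S y" "alternating y"
    and inv: "\<And>k. k \<le> length y - 1 \<Longrightarrow> qbinom_in \<delta> (length y - 1) k dvd 1"
  shows "\<exists>f \<in> cup_killed S \<delta> y. id_coeff y f = 1"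
proof -
  define n where "n = length y - 1"
  define X :: "int poly" where "X = [:0, 1:]"
  \<comment> \<open>\<open>Z\<close> works over \<int>[\<delta>], where \<open>qfact n\<close> is
    cancellable; \<open>K\<close> works over the given ring.\<close>
  interpret Z: spin X "Quad (\<lambda>_. 0) (\<lambda>_. 1)" "Quad (\<lambda>d. d) (\<lambda>_. -1)" "quad_embed X" "\<lambda>r. const_part r X"
    by (rule spin_quad)
  interpret K: spin \<delta> "Quad (\<lambda>_. 0) (\<lambda>_. 1)" "Quad (\<lambda>d. d) (\<lambda>_. -1)" "quad_embed \<delta>" "\<lambda>r. const_part r \<delta>"
    by (rule spin_quad)
  define L where "L = (\<Prod>k\<le>n. qbinom n k)"
  define a where "a = qfact n"
  have qX: "qbinom_in X n k = qbinom n k" for k by (simp add: qbinom_in_ev ev_var X_def)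
  obtain c where c: "Z.killed n UNIV (Z.comb (nc (2 * n)) (\<lambda>T. T) c)" "c (id_arcs n) = a"
    using Z.generic_killed[of n] by (auto simp: a_def ev_var X_def)
  have "\<exists>b. L * c T = a * b" if T: "T \<in> nc (2 * n)" for T
  proof -
    obtain b where "L * a * c T = a * a * b"
      using Z.generic_denominators[OF c(1) T] unfolding c(2) qX L_def by blast
    then have "a * (L * c T) = a * (a * b)" by (simp only: mult_ac)
    moreover have "a \<noteq> 0" by (simp add: a_def qfact_nonzero)
    ultimately show ?thesis by auto
  qed
  \<comment> \<open>\<open>b\<close> is the exact quotient of \<open>L * c T\<close> by
    \<open>qfact n\<close>; it is the candidate over \<int>[\<delta>], with identity coefficient
    \<open>L\<close>.\<close>
  then obtain b where b: "\<And>T. T \<in> nc (2 * n) \<Longrightarrow> L * c T = a * b T" by metis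
  have b_id: "b (id_arcs n) = L"
  proof -
    have "a * b (id_arcs n) = a * L" using b[OF id_arcs_nc[of n]] unfolding c(2) by (metis mult.commute)
    then show ?thesis by (simp add: a_def qfact_nonzero)
  qed
  let ?A = "homset S y y"
  define f :: "('c, int poly) two_morphism" where "f = (\<Sum>D\<in>?A. Poly_Mapping.single D (b (arcs D)))"
  have hom: "arcs D \<in> nc (2 * n)" "diag_of y y (arcs D) = D" if "D \<in> ?A" for D
    using homset_diag_of[OF that] unfolding n_def by metis+
  have arcs: "arcs (diag_of y y T) = T" if "T \<in> nc (2 * n)" for T
    by (rule arcs_diag_of[OF that refl refl]) (simp add: n_def)
  have killed: "vcomp X f (basis (cup_at y j)) = 0" if j: "j + 2 < length y" for j
  proof -
    have f_keys: "Poly_Mapping.keys f \<subseteq> ?A"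
      unfolding f_def by (rule order.trans[OF Poly_Mapping.keys_sum]) (auto split: if_splits)
    then have planar: "Poly_Mapping.keys f \<subseteq> planar y y" using homset_planar by blast
    \<comment> \<open>Multiplied by \<open>a\<close>, the candidate acts as a multiple of the
      generic killed element; afterwards \<open>a\<close> is cancelled coefficient by
      coefficient.\<close>
    have Xi_f: "quad_embed X a * Z.Xi f s = quad_embed X L * Z.comb (nc (2 * n)) (\<lambda>T. T) c s" for s
    proof -
      have "quad_embed X a * Z.Xi f s = (\<Sum>D\<in>?A. quad_embed X (L * c (arcs D)) * Z.wt (arcs D) s)"
        unfolding f_def Z.Xi_sum Z.Xi_single sum_distrib_left
        by (intro sum.cong refl) (simp add: b[OF hom(1)] Z.\<iota>_mult mult.assoc)
      also have "\<dots> = (\<Sum>T\<in>nc (2 * n). quad_embed X (L * c T) * Z.wt T s)"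
        by (rule sum.reindex_bij_witness[of _ "diag_of y y" arcs])
          (use hom arcs alternating_homset[OF y] in \<open>auto simp: n_def\<close>)
      also have "\<dots> = quad_embed X L * Z.comb (nc (2 * n)) (\<lambda>T. T) c s"
        by (simp add: Z.comb_def Z.\<iota>_mult sum_distrib_left mult.assoc)
      finally show ?thesis .
    qed
    define v where "v = vcomp X f (basis (cup_at y j))"
    have Xi_v: "quad_embed X a * Z.Xi v s = 0" for s
    proof -
      have "Z.capf j (Z.comb (nc (2 * n)) (\<lambda>T. T) c) s = 0" using c(1) j by (simp add: Z.killed_def n_def)
      then have "quad_embed X L * Z.capf j (Z.comb (nc (2 * n)) (\<lambda>T. T) c) s = 0" by simp
      moreover have "quad_embed X a * Z.capf j (Z.Xi f) s = quad_embed X L * Z.capf j (Z.comb (nc (2 * n)) (\<lambda>T. T) c) s"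
        unfolding Z.capf_def right_diff_distrib mult.left_commute[of "quad_embed X _"] Xi_f ..
      ultimately show ?thesis unfolding v_def Z.vcomp_cup_at(2)[OF planar j] by simp
    qed
    have "Poly_Mapping.lookup v D = 0" for D
    proof -
      have "quad_embed X (Poly_Mapping.lookup v D) \<in> {r. quad_embed X a * r = 0}"
        by (rule Z.Xi_ideal[OF Z.vcomp_cup_at(1)[OF planar j, folded v_def]])
          (auto simp: Xi_v right_diff_distrib mult.assoc[symmetric])
      then have "quad_embed X (a * Poly_Mapping.lookup v D) = quad_embed X 0" by (simp add: Z.\<iota>_mult)
      then have "a * Poly_Mapping.lookup v D = 0" by (simp only: Z.\<iota>_eq_iff)
      then show ?thesis by (simp add: a_def qfact_nonzero)
    qed
    then show ?thesis unfolding v_def by (intro poly_mapping_eqI) simp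
  qed
  have "ev \<delta> L dvd 1"
  proof -
    have "ev \<delta> L = (\<Prod>k\<le>n. qbinom_in \<delta> n k)" by (simp add: L_def ev_prod qbinom_in_ev)
    also have "\<dots> dvd (\<Prod>k\<le>n. 1)" by (rule prod_dvd_prod) (use inv in \<open>simp add: n_def\<close>)
    finally show ?thesis by simp
  qed
  then obtain u where u: "ev \<delta> L * u = 1" by (metis dvd_def)
  \<comment> \<open>The specialisation of \<open>f\<close>, normalised by the inverse
    \<open>u\<close> of the image of \<open>L\<close>.\<close>
  define g :: "('c, 'k) two_morphism" where "g = (\<Sum>D\<in>?A. Poly_Mapping.single D (u * ev \<delta> (b (arcs D))))"
  have "g \<in> Hom S y y" unfolding Hom_iff g_def
    by (rule order.trans[OF Poly_Mapping.keys_sum]) (auto split: if_splits)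
  moreover have "vcomp \<delta> g (basis (cup_at y j)) = 0" if j: "j + 2 < length y" for j
  proof (rule poly_mapping_eqI)
    fix D'
    \<comment> \<open>The composite with a cup has the same formula over both rings, with
      \<open>- X\<close> evaluating to \<open>- \<delta>\<close>; hence its vanishing is inherited
      from \<int>[\<delta>].\<close>
    have "Poly_Mapping.lookup (vcomp \<delta> g (basis (cup_at y j))) D' =
        u * ev \<delta> (Poly_Mapping.lookup (vcomp X f (basis (cup_at y j))) D')"
      unfolding g_def f_def vcomp_sum_single[OF finite_homset] lookup_sum ev_sum sum_distrib_left
    proof (intro sum.cong refl)
      fix D
      have "ev \<delta> (- X) = - \<delta>" by (simp add: X_def)
      then show "Poly_Mapping.lookup (Poly_Mapping.single (vcomp_diagram D (cup_at y j))
            (u * ev \<delta> (b (arcs D)) * (- \<delta>) ^ card (circles D (cup_at y j)))) D' =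
          u * ev \<delta> (Poly_Mapping.lookup (Poly_Mapping.single (vcomp_diagram D (cup_at y j))
            (b (arcs D) * (- X) ^ card (circles D (cup_at y j)))) D')"
        by (simp add: lookup_single when_def ev_mult ev_power mult.assoc)
    qed
    then show "Poly_Mapping.lookup (vcomp \<delta> g (basis (cup_at y j))) D' = Poly_Mapping.lookup 0 D'"
      by (simp add: killed[OF j])
  qed
  ultimately have "g \<in> cup_killed S \<delta> y" by (auto simp: cup_killed_def cups_into_eq)
  moreover have "id_coeff y g = 1"
  proof -
    have "id_coeff y g = (\<Sum>D\<in>?A. if D = id_diagram y then u * ev \<delta> (b (arcs D)) else 0)"
      by (simp add: id_coeff_def g_def lookup_sum lookup_single when_def)
    also have "\<dots> = u * ev \<delta> (b (arcs (id_diagram y)))"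
      by (subst sum.delta[OF finite_homset]) (simp add: id_diagram_homset[OF y(1)])
    also have "\<dots> = 1" using u b_id by (simp add: K.arcs_id_diagram n_def mult.commute)
    finally show ?thesis .
  qed
  ultimately show ?thesis by blast
qed

section \<open>Gluing the pieces and the two directions of the result\<close>

lemma max_alternating_nonempty: "one_morphism S x \<Longrightarrow> max_alternating x \<noteq> []"
  by (cases "alternating x") (metis max_alternating_alternating not_Cons_self2, metis list.distinct(1) max_alternating_split)

text \<open>Peels off the leftmost maximal alternating subsequence; the remaining ones are those of
  the shorter word \<open>z\<close>, and \<open>hcomp_cup_killed\<close> applies at the
  seam.\<close>

lemma hconcat_JW:
  fixes \<delta> :: "'k::comm_ring_1" and x :: "'c list"
  assumes "one_morphism S x"
    and "\<And>y k. y \<in> set (max_alternating x) \<Longrightarrow> k \<le> length y - 1 \<Longrightarrow> qbinom_in \<delta> (length y - 1) k dvd 1"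
  shows "hconcat (map (JW S \<delta>) (max_alternating x)) \<in> cup_killed S \<delta> x \<and>
    id_coeff x (hconcat (map (JW S \<delta>) (max_alternating x))) = 1"
  using assms
proof (induction "length x" arbitrary: x rule: less_induct)
  case less
  interpret spin \<delta> "Quad (\<lambda>_. 0) (\<lambda>_. 1)" "Quad (\<lambda>d. d) (\<lambda>_. -1)" "quad_embed \<delta>" "\<lambda>r. const_part r \<delta>"
    by (rule spin_quad)
  have JW: "JW S \<delta> y \<in> cup_killed S \<delta> y \<and> id_coeff y (JW S \<delta> y) = 1" if y: "y \<in> set (max_alternating x)" for y
  proof -
    note y' = max_alternating_slice[OF less.prems(1) y]
    obtain f where "f \<in> cup_killed S \<delta> y" "id_coeff y f = 1"
      using JW_alternating[OF y' less.prems(2)[OF y]] by blast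
    then show ?thesis using JW_eqI[OF y'(1)] by metis
  qed
  show ?case
  proof (cases "alternating x")
    case True
    then have "max_alternating x = [x]" by (rule max_alternating_alternating[OF less.prems(1)])
    then show ?thesis using JW[of x] by simp
  next
    case False
    obtain y z where yz: "x = comp1 y z" "last y = hd z" "one_morphism S y" "one_morphism S z" "length z < length x"
      "alternating y" "length y - 1 \<notin> Suc ` turnbacks x" "max_alternating x = y # max_alternating z"
      using max_alternating_split[OF less.prems(1) False] by metis
    have "hconcat (map (JW S \<delta>) (max_alternating z)) \<in> cup_killed S \<delta> z \<and>
      id_coeff z (hconcat (map (JW S \<delta>) (max_alternating z))) = 1"
      using less.hyps[OF yz(5,4)] less.prems(2) unfolding yz(8) by simp
    moreover have "hconcat (map (JW S \<delta>) (max_alternating x)) =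
        hcomp (JW S \<delta> y) (hconcat (map (JW S \<delta>) (max_alternating z)))"
      using max_alternating_nonempty[OF yz(4)] unfolding yz(8) by (cases "max_alternating z") auto
    moreover have "JW S \<delta> y \<in> cup_killed S \<delta> y \<and> id_coeff y (JW S \<delta> y) = 1" using JW yz(8) by simp
    ultimately show ?thesis
      using hcomp_cup_killed[OF yz(3,4,2)] yz(7) unfolding yz(1)[symmetric] by simp
  qed
qed

theorem proposition2p22:
  fixes \<delta> :: "'k::comm_ring_1" and S :: "'c set" and x :: "'c list"
  assumes "finite S" and "one_morphism S x"
  shows "((\<forall>k m. m \<le> k \<and> (\<exists>y\<in>set (max_alternating x). length y = k + 1)
             \<longrightarrow> qbinom_in \<delta> k m dvd 1)
          \<longrightarrow> JW_exists S \<delta> x \<and> (\<forall>y\<in>set (max_alternating x). JW_exists S \<delta> y) \<and>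
              JW S \<delta> x = hconcat (map (JW S \<delta>) (max_alternating x)))
       \<and> ((\<exists>k m. m \<le> k \<and> (\<exists>y\<in>set (max_alternating x). length y = k + 1)
             \<and> \<not> qbinom_in \<delta> k m dvd 1)
          \<longrightarrow> \<not> JW_exists S \<delta> x)"
proof (intro conjI impI)
  note x = assms(2)
  interpret spin \<delta> "Quad (\<lambda>_. 0) (\<lambda>_. 1)" "Quad (\<lambda>d. d) (\<lambda>_. -1)" "quad_embed \<delta>" "\<lambda>r. const_part r \<delta>"
    by (rule spin_quad)
  {
    assume inv: "\<forall>k m. m \<le> k \<and> (\<exists>y\<in>set (max_alternating x). length y = k + 1) \<longrightarrow> qbinom_in \<delta> k m dvd 1"
    have inv': "qbinom_in \<delta> (length y - 1) k dvd 1" if y: "y \<in> set (max_alternating x)" "k \<le> length y - 1" for y k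
    proof -
      have "length y = (length y - 1) + 1"
        using max_alternating_slice(1)[OF x y(1)] by (cases y) (auto simp: one_morphism_def)
      then show ?thesis using inv y by blast
    qed
    have h: "hconcat (map (JW S \<delta>) (max_alternating x)) \<in> cup_killed S \<delta> x"
      "id_coeff x (hconcat (map (JW S \<delta>) (max_alternating x))) = 1"
      using hconcat_JW[OF x inv'] by auto
    show "JW_exists S \<delta> x" unfolding JW_exists_def using h by (metis one_dvd)
    show "\<forall>y\<in>set (max_alternating x). JW_exists S \<delta> y"
      using JW_alternating[OF max_alternating_slice[OF x] inv'] unfolding JW_exists_def by (metis one_dvd)
    show "JW S \<delta> x = hconcat (map (JW S \<delta>) (max_alternating x))" by (rule JW_eqI[OF x h])
  next
    assume "\<exists>k m. m \<le> k \<and> (\<exists>y\<in>set (max_alternating x). length y = k + 1) \<and> \<not> qbinom_in \<delta> k m dvd 1"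
    then obtain k m y where km: "m \<le> k" "y \<in> set (max_alternating x)" "length y = k + 1" "\<not> qbinom_in \<delta> k m dvd 1"
      by blast
    obtain i j where ij: "y = slice x i j" "max_alternating_at x i j" using km(2) by (auto simp: set_max_alternating)
    have less: "i < j" "j \<le> length x" using ij(2) by (auto simp: max_alternating_at_def alternating_at_def)
    \<comment> \<open>A slice of \<open>k + 1\<close> colours has \<open>k\<close> points, so the
      block in \<open>qbinom_invertible\<close> is \<open>{i..<i + k}\<close>.\<close>
    have k: "i + k = j - 1" using km(3) less by (simp add: ij(1) length_slice)
    show "\<not> JW_exists S \<delta> x"
    proof
      assume "JW_exists S \<delta> x"
      then obtain f where f: "f \<in> cup_killed S \<delta> x" "id_coeff x f dvd 1" by (auto simp: JW_exists_def)
      have "qbinom_in \<delta> k m dvd 1"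
      proof (rule qbinom_invertible[OF x f, of i k])
        show "i + k < length x" using k less by simp
        show "l \<in> turnbacks x" if "i \<le> l" "Suc l < i + k" for l
          using max_alternating_at_turnbacks(1)[OF x ij(2) that(1)] that(2) k by simp
        show "l \<in> {i..<i + k} \<longleftrightarrow> Suc l \<in> {i..<i + k}" if "l \<in> turnbacks x" for l
          using max_alternating_at_turnbacks(2)[OF x ij(2) that] unfolding k .
      qed (rule km(1))
      then show False using km(4) by simp
    qed
  }
qed

end
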